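(* Let $M$ be a compact smooth $n$-manifold and $E\to M$ a smooth vector bundle of rank $r$. Let $e\in\mathbb{R}$, $q\in(1,\infty)$, and let $\Lambda=\{(U_\alpha,\varphi_\alpha,\rho_\alpha,\psi_\alpha)\}_{\alpha=1}^N$ be an augmented total trivialization atlas for $E\to M$. If $e$ is a noninteger less than $-1$, assume further that $\Lambda$ is GL compatible with itself. Then $W^{e,q}(M,E;\Lambda)$ is a Banach space.
   Context: Manifolds are smooth, Hausdorff and second countable; $E_U=\pi^{-1}(U)$ for a bundle $\pi:E\to M$. Trivializations. A total trivialization triple $(U,\varphi,\rho)$ for $E$ consists of a smooth chart $(U,\varphi)$ of $M$ and a smooth map $\rho=(\rho^1,\dots,\rho^r):E_U\to\mathbb{R}^r$ that is a linear isomorphism on each fibre and such that $(\pi,\rho):E_U\to U\times\mathbb{R}^r$ is a diffeomorphism. An augmented total trivialization atlas is a finite collection $\{(U_\alpha,\varphi_\alpha,\rho_\alpha,\psi_\alpha)\}_{1\le\alpha\le N}$ of such triples, whose charts form a smooth atlas of $M$, together with a smooth nonnegative partition of unity $\{\psi_\alpha\}$ with $\mathrm{supp}\,\psi_\alpha\subseteq U_\alpha$. Euclidean spaces. Let $\Omega\subseteq\mathbb{R}^n$ be nonempty open, $1<p<\infty$. For $k\in\mathbb{N}_0$, $\|u\|_{W^{k,p}(\Omega)}=\sum_{|\nu|\le k}\|\partial^\nu u\|_{L^p(\Omega)}$; for $s=k+\theta$, $\theta\in(0,1)$, $\|u\|_{W^{s,p}(\Omega)}=\|u\|_{W^{k,p}(\Omega)}+\sum_{|\nu|=k}\big(\iint_{\Omega\times\Omega}\frac{|\partial^\nu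 u(x)-\partial^\nu u(y)|^p}{|x-y|^{n+\theta p}}dx\,dy\big)^{1/p}$; $W^{s,p}(\Omega)$ is the set of $u\in L^p(\Omega)$ with finite norm. For $s\ge0$, $W^{s,p}_0(\Omega)$ is the closure of $C_c^\infty(\Omega)$ in $W^{s,p}(\Omega)$. For $s<0$, $W^{s,p}(\Omega)=(W_0^{-s,p'}(\Omega))^*$, $1/p+1/p'=1$, viewed as a subspace of $D'(\Omega)$ by restriction to $C_c^\infty(\Omega)$. Distributions. Let $\mathcal{D}$ be the density bundle of $M$ and $E^\vee=\mathrm{Hom}(E,\mathcal{D})$. $D'(M,E)$ is the topological dual of $D(M,E^\vee)=C^\infty_c(M,E^\vee)$ with its usual test-function topology. For $u\in D'(M,E)$, the local representation $H_\alpha(u)\in D'(\varphi_\alpha(U_\alpha))^r$ has components $[H_\alpha(u)]^l(\xi)=\langle u,g_{l,\xi}\rangle$, where $g_{l,\xi}$ is the section of $E^\vee$ supported in $U_\alpha$ with $g_{l,\xi}(x)(a)=\xi(\varphi_\alpha(x))\,\rho_\alpha^l(a)\,|dx^1\wedge\cdots\wedge dx^n|_x$ for $a\in E_x$, $\varphi_\alpha=(x^i)$. If $u$ is the regular distribution $\eta\mapsto\int_M\eta(f)$ given by a section $f$, then $[H_\alpha(u)]^l=\rho_\alpha^l\circ f\circ\varphi_\alpha^{-1}$. Sobolev spaces. $W^{e,q}(M,E;\Lambda)=\{u\in D'(M,E):\|u\|_{W^{e,q}(M,E;\Lambda)}:=\sum_{\alpha=1}^N\sum_{l=1}^r\|[H_\alpha(\psi_\alpha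 u)]^l\|_{W^{e,q}(\varphi_\alpha(U_\alpha))}<\infty\}$. GL compatibility. $\Lambda$ is GL compatible with itself if every $\varphi_\alpha(U_\alpha)$ is either $\mathbb{R}^n$ or a nonempty bounded open set with Lipschitz boundary, and whenever $U_\alpha\cap U_\beta\ne\emptyset$ each of $\varphi_\alpha(U_\alpha\cap U_\beta)$ and $\varphi_\beta(U_\alpha\cap U_\beta)$ is a nonempty bounded open set with Lipschitz boundary or all of $\mathbb{R}^n$. *)

theory Defs
  imports "HOL-Analysis.Analysis"
begin

section \<open>Smooth maps between Euclidean spaces\<close>

primrec Ck_on :: "nat \<Rightarrow> 'a::real_normed_vector set \<Rightarrow> ('a \<Rightarrow> 'b::real_normed_vector) \<Rightarrow> bool" where
  "Ck_on 0 S f \<longleftrightarrow> continuous_on S f"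
| "Ck_on (Suc k) S f \<longleftrightarrow> (\<forall>x\<in>S. f differentiable (at x)) \<and>
     (\<forall>v. Ck_on k S (\<lambda>x. frechet_derivative f (at x) v))"

text \<open>Only used for open sets \<open>S\<close>.\<close>

definition smooth_on :: "'a::real_normed_vector set \<Rightarrow> ('a \<Rightarrow> 'b::real_normed_vector) \<Rightarrow> bool" where
  "smooth_on S f \<longleftrightarrow> (\<forall>k. Ck_on k S f)"

text \<open>A multi-index is a function \<open>\<nu> :: 'n \<Rightarrow> nat\<close>. Since the index type carries no order, the mixed
  partial derivative is taken along some list that contains each index \<open>i\<close> exactly \<open>\<nu> i\<close> times;
  for smooth functions the choice is irrelevant.\<close>

definition partial_deriv :: "'n::finite \<Rightarrow> (real^'n \<Rightarrow> real) \<Rightarrow> real^'n \<Rightarrow> real" where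
  "partial_deriv i f = (\<lambda>x. frechet_derivative f (at x) (axis i 1))"

definition mi_order :: "('n::finite \<Rightarrow> nat) \<Rightarrow> nat" where
  "mi_order \<nu> = (\<Sum>i\<in>UNIV. \<nu> i)"

definition partials :: "('n::finite \<Rightarrow> nat) \<Rightarrow> (real^'n \<Rightarrow> real) \<Rightarrow> real^'n \<Rightarrow> real" where
  "partials \<nu> f = foldr partial_deriv (SOME is. \<forall>i. count_list is i = \<nu> i) f"

section \<open>Sobolev spaces on open subsets of Euclidean space\<close>

text \<open>\<open>test_fun \<Omega>\<close> is \<open>C\<^sub>c\<^sup>\<infinity>(\<Omega>)\<close>, its members being extended by zero to the whole space.\<close>

definition test_fun :: "(real^'n::finite) set \<Rightarrow> (real^'n \<Rightarrow> real) set" where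
  "test_fun \<Omega> = {\<xi>. smooth_on UNIV \<xi> \<and> compact (closure {x. \<xi> x \<noteq> 0}) \<and> closure {x. \<xi> x \<noteq> 0} \<subseteq> \<Omega>}"

definition ennreal_root :: "real \<Rightarrow> ennreal \<Rightarrow> ennreal" where
  "ennreal_root p I = (if I = top then top else ennreal (enn2real I powr (1 / p)))"

definition Lp_norm :: "real \<Rightarrow> (real^'n::finite) set \<Rightarrow> (real^'n \<Rightarrow> real) \<Rightarrow> ennreal" where
  "Lp_norm p \<Omega> f = ennreal_root p (\<integral>\<^sup>+x. ennreal (\<bar>f x\<bar> powr p) \<partial>lebesgue_on \<Omega>)"

text \<open>Members of Lebesgue and Sobolev spaces on \<open>\<Omega>\<close> are represented by functions; two functions that
  agree almost everywhere on \<open>\<Omega>\<close> stand for the same element.\<close>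

definition Lp :: "real \<Rightarrow> (real^'n::finite) set \<Rightarrow> (real^'n \<Rightarrow> real) set" where
  "Lp p \<Omega> = {f \<in> borel_measurable (lebesgue_on \<Omega>). Lp_norm p \<Omega> f < top}"

definition regular_dist :: "(real^'n::finite) set \<Rightarrow> (real^'n \<Rightarrow> real) \<Rightarrow> (real^'n \<Rightarrow> real) \<Rightarrow> real" where
  "regular_dist \<Omega> f \<xi> = (\<integral>x. f x * \<xi> x \<partial>lebesgue_on \<Omega>)"

text \<open>\<open>g\<close> represents the distributional derivative \<open>\<partial>\<^sup>\<nu> f\<close>:\<close>

definition weak_deriv ::
  "(real^'n::finite) set \<Rightarrow> ('n \<Rightarrow> nat) \<Rightarrow> (real^'n \<Rightarrow> real) \<Rightarrow> (real^'n \<Rightarrow> real) \<Rightarrow> bool" where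
  "weak_deriv \<Omega> \<nu> f g \<longleftrightarrow>
     (\<forall>\<xi>\<in>test_fun \<Omega>. regular_dist \<Omega> g \<xi> = (- 1) ^ mi_order \<nu> * regular_dist \<Omega> f (partials \<nu> \<xi>))"

definition slobodeckij_seminorm ::
  "real \<Rightarrow> real \<Rightarrow> (real^'n::finite) set \<Rightarrow> (real^'n \<Rightarrow> real) \<Rightarrow> ennreal" where
  "slobodeckij_seminorm \<theta> p \<Omega> g = ennreal_root p
     (\<integral>\<^sup>+z. ennreal (\<bar>g (fst z) - g (snd z)\<bar> powr p
              / norm (fst z - snd z) powr (real CARD('n) + \<theta> * p))
        \<partial>(lebesgue_on \<Omega> \<Otimes>\<^sub>M lebesgue_on \<Omega>))"

text \<open>The Sobolev-Slobodeckij norm for \<open>s \<ge> 0\<close>. A weak derivative in \<open>L\<^sup>p\<close> is unique up to null sets, so each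
  infimum below is the common value over all its representatives, or \<open>\<infinity>\<close> if \<open>\<partial>\<^sup>\<nu> f\<close> is not in \<open>L\<^sup>p\<close>.\<close>

definition sobolev_norm :: "real \<Rightarrow> real \<Rightarrow> (real^'n::finite) set \<Rightarrow> (real^'n \<Rightarrow> real) \<Rightarrow> ennreal" where
  "sobolev_norm s p \<Omega> f =
     (let k = nat \<lfloor>s\<rfloor>; \<theta> = s - real k in
       (\<Sum>\<nu> | mi_order \<nu> \<le> k. INF g\<in>{g \<in> Lp p \<Omega>. weak_deriv \<Omega> \<nu> f g}. Lp_norm p \<Omega> g) +
       (if \<theta> = 0 then 0
        else \<Sum>\<nu> | mi_order \<nu> = k. INF g\<in>{g \<in> Lp p \<Omega>. weak_deriv \<Omega> \<nu> f g}. slobodeckij_seminorm \<theta> p \<Omega> g))"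

definition sobolev_space :: "real \<Rightarrow> real \<Rightarrow> (real^'n::finite) set \<Rightarrow> (real^'n \<Rightarrow> real) set" where
  "sobolev_space s p \<Omega> = {f \<in> Lp p \<Omega>. sobolev_norm s p \<Omega> f < top}"

definition sobolev_space0 :: "real \<Rightarrow> real \<Rightarrow> (real^'n::finite) set \<Rightarrow> (real^'n \<Rightarrow> real) set" where
  "sobolev_space0 s p \<Omega> = {f \<in> sobolev_space s p \<Omega>.
     \<forall>\<epsilon>>0. \<exists>\<xi>\<in>test_fun \<Omega>. sobolev_norm s p \<Omega> (\<lambda>x. f x - \<xi> x) < ennreal \<epsilon>}"

definition dual_norm ::
  "real \<Rightarrow> real \<Rightarrow> (real^'n::finite) set \<Rightarrow> ((real^'n \<Rightarrow> real) \<Rightarrow> real) \<Rightarrow> ennreal" where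
  "dual_norm s p \<Omega> F = (SUP f\<in>{f \<in> sobolev_space0 s p \<Omega>. sobolev_norm s p \<Omega> f \<le> 1}. ennreal \<bar>F f\<bar>)"

text \<open>The topological dual of \<open>sobolev_space0\<close>. A functional of finite operator norm vanishes on elements of
  norm zero and hence respects almost-everywhere equality.\<close>

definition sobolev_dual ::
  "real \<Rightarrow> real \<Rightarrow> (real^'n::finite) set \<Rightarrow> ((real^'n \<Rightarrow> real) \<Rightarrow> real) set" where
  "sobolev_dual s p \<Omega> = {F.
     (\<forall>f\<in>sobolev_space0 s p \<Omega>. \<forall>g\<in>sobolev_space0 s p \<Omega>. F (\<lambda>x. f x + g x) = F f + F g) \<and>
     (\<forall>c. \<forall>f\<in>sobolev_space0 s p \<Omega>. F (\<lambda>x. c * f x) = c * F f) \<and>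
     dual_norm s p \<Omega> F < top}"

text \<open>The \<open>W\<^sup>s\<^sup>,\<^sup>p(\<Omega>)\<close> norm, \<open>s\<close> real, of a functional \<open>v\<close> on \<open>C\<^sub>c\<^sup>\<infinity>(\<Omega>)\<close>: the norm of the element of
  \<open>W\<^sup>s\<^sup>,\<^sup>p(\<Omega>)\<close> (a function if \<open>s \<ge> 0\<close>, a member of the dual of \<open>W\<^sub>0\<^sup>-\<^sup>s\<^sup>,\<^sup>p\<^sup>'(\<Omega>)\<close> if \<open>s < 0\<close>) that induces \<open>v\<close>,
  and \<open>\<infinity>\<close> if there is none. That element is unique, so the infima do not minimise anything.\<close>

definition dist_sobolev_norm ::
  "real \<Rightarrow> real \<Rightarrow> (real^'n::finite) set \<Rightarrow> ((real^'n \<Rightarrow> real) \<Rightarrow> real) \<Rightarrow> ennreal" where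
  "dist_sobolev_norm s p \<Omega> v =
     (if s \<ge> 0 then
        INF f\<in>{f \<in> sobolev_space s p \<Omega>. \<forall>\<xi>\<in>test_fun \<Omega>. v \<xi> = regular_dist \<Omega> f \<xi>}. sobolev_norm s p \<Omega> f
      else let p' = p / (p - 1) in
        INF F\<in>{F \<in> sobolev_dual (- s) p' \<Omega>. \<forall>\<xi>\<in>test_fun \<Omega>. v \<xi> = F \<xi>}. dual_norm (- s) p' \<Omega> F)"

section \<open>Smooth manifolds\<close>

text \<open>A manifold is a whole type of class \<open>t2_space\<close> and \<open>second_countable_topology\<close> with a smooth atlas.
  A chart is a pair of its domain and its coordinate map; values of the coordinate map off the domain
  are irrelevant.\<close>

type_synonym ('m, 'v) chart = "'m set \<times> ('m \<Rightarrow> 'v)"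

definition is_chart :: "('m::topological_space, 'v::euclidean_space) chart \<Rightarrow> bool" where
  "is_chart c \<longleftrightarrow> open (fst c) \<and> open (snd c ` fst c) \<and>
     homeomorphism (fst c) (snd c ` fst c) (snd c) (inv_into (fst c) (snd c))"

definition transition :: "('m, 'v) chart \<Rightarrow> ('m, 'w) chart \<Rightarrow> 'v \<Rightarrow> 'w" where
  "transition c d = snd d \<circ> inv_into (fst c) (snd c)"

definition smooth_chart ::
  "('m::topological_space, 'v::euclidean_space) chart set \<Rightarrow> ('m, 'v) chart \<Rightarrow> bool" where
  "smooth_chart A c \<longleftrightarrow> is_chart c \<and>
     (\<forall>d\<in>A. smooth_on (snd c ` (fst c \<inter> fst d)) (transition c d) \<and>
            smooth_on (snd d ` (fst c \<inter> fst d)) (transition d c))"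

definition smooth_atlas :: "('m::topological_space, 'v::euclidean_space) chart set \<Rightarrow> bool" where
  "smooth_atlas A \<longleftrightarrow> (\<Union>c\<in>A. fst c) = UNIV \<and> (\<forall>c\<in>A. smooth_chart A c)"

definition euclidean_atlas :: "('v::euclidean_space, 'v) chart set" where
  "euclidean_atlas = {(UNIV, id)}"

definition prod_atlas :: "('m, 'v) chart set \<Rightarrow> ('m', 'w) chart set \<Rightarrow> ('m \<times> 'm', 'v \<times> 'w) chart set" where
  "prod_atlas A B = {(fst c \<times> fst d, map_prod (snd c) (snd d)) | c d. c \<in> A \<and> d \<in> B}"

definition smooth_map_on ::
  "('m::topological_space, 'v::euclidean_space) chart set \<Rightarrow>
   ('m'::topological_space, 'w::euclidean_space) chart set \<Rightarrow> 'm set \<Rightarrow> ('m \<Rightarrow> 'm') \<Rightarrow> bool" where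
  "smooth_map_on A B W f \<longleftrightarrow> continuous_on W f \<and>
     (\<forall>c\<in>A. \<forall>d\<in>B. smooth_on (snd c ` (W \<inter> fst c \<inter> f -` fst d)) (snd d \<circ> f \<circ> inv_into (fst c) (snd c)))"

definition diffeomorphism_on ::
  "('m::topological_space, 'v::euclidean_space) chart set \<Rightarrow>
   ('m'::topological_space, 'w::euclidean_space) chart set \<Rightarrow> 'm set \<Rightarrow> 'm' set \<Rightarrow> ('m \<Rightarrow> 'm') \<Rightarrow> bool" where
  "diffeomorphism_on A B W W' f \<longleftrightarrow>
     bij_betw f W W' \<and> smooth_map_on A B W f \<and> smooth_map_on B A W' (inv_into W f)"

section \<open>Smooth vector bundles\<close>

text \<open>The base has dimension \<open>CARD('n)\<close> and the rank is \<open>CARD('r)\<close>; the total space is modelled on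
  \<open>\<real>\<^sup>n \<times> \<real>\<^sup>r\<close>. The vector space operations are only meaningful within one fibre.\<close>

record ('m, 'n, 'e, 'r) vbundle =
  base_atlas :: "('m, real^'n) chart set"
  total_atlas :: "('e, (real^'n) \<times> (real^'r)) chart set"
  proj :: "'e \<Rightarrow> 'm"
  fibre_add :: "'e \<Rightarrow> 'e \<Rightarrow> 'e"
  fibre_scale :: "real \<Rightarrow> 'e \<Rightarrow> 'e"

definition fibre :: "('m, 'n::finite, 'e, 'r::finite) vbundle \<Rightarrow> 'm \<Rightarrow> 'e set" where
  "fibre E x = proj E -` {x}"

definition fibre_iso :: "('m, 'n::finite, 'e, 'r::finite) vbundle \<Rightarrow> ('e \<Rightarrow> real^'r) \<Rightarrow> 'm \<Rightarrow> bool" where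
  "fibre_iso E \<rho> x \<longleftrightarrow> bij_betw \<rho> (fibre E x) UNIV \<and>
     (\<forall>a\<in>fibre E x. \<forall>b\<in>fibre E x. \<rho> (fibre_add E a b) = \<rho> a + \<rho> b) \<and>
     (\<forall>t. \<forall>a\<in>fibre E x. \<rho> (fibre_scale E t a) = t *\<^sub>R \<rho> a)"

definition trivialization ::
  "('m::topological_space, 'n::finite, 'e::topological_space, 'r::finite) vbundle \<Rightarrow>
   'm set \<Rightarrow> ('e \<Rightarrow> real^'r) \<Rightarrow> bool" where
  "trivialization E U \<rho> \<longleftrightarrow> open U \<and>
     smooth_map_on (total_atlas E) euclidean_atlas (proj E -` U) \<rho> \<and>
     (\<forall>x\<in>U. fibre_iso E \<rho> x) \<and>
     diffeomorphism_on (total_atlas E) (prod_atlas (base_atlas E) euclidean_atlas)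
       (proj E -` U) (U \<times> UNIV) (\<lambda>a. (proj E a, \<rho> a))"

text \<open>The real vector space axioms on the fibres are not listed: they follow from closure under the
  operations and the existence of a linear bijection onto \<open>\<real>\<^sup>r\<close>.\<close>

definition smooth_vector_bundle ::
  "('m::{t2_space,second_countable_topology}, 'n::finite,
    'e::{t2_space,second_countable_topology}, 'r::finite) vbundle \<Rightarrow> bool" where
  "smooth_vector_bundle E \<longleftrightarrow>
     smooth_atlas (base_atlas E) \<and> smooth_atlas (total_atlas E) \<and>
     smooth_map_on (total_atlas E) (base_atlas E) UNIV (proj E) \<and> surj (proj E) \<and>
     (\<forall>x. \<forall>a\<in>fibre E x. \<forall>b\<in>fibre E x. fibre_add E a b \<in> fibre E x) \<and>
     (\<forall>x t. \<forall>a\<in>fibre E x. fibre_scale E t a \<in> fibre E x) \<and>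
     (\<forall>x. \<exists>U \<rho>. x \<in> U \<and> trivialization E U \<rho>)"

definition total_triv_triple ::
  "('m::topological_space, 'n::finite, 'e::topological_space, 'r::finite) vbundle \<Rightarrow>
   ('m, real^'n) chart \<Rightarrow> ('e \<Rightarrow> real^'r) \<Rightarrow> bool" where
  "total_triv_triple E c \<rho> \<longleftrightarrow> smooth_chart (base_atlas E) c \<and> trivialization E (fst c) \<rho>"

section \<open>Densities and the bundle \<open>E\<^sup>\<or> = Hom(E, D)\<close>\<close>

text \<open>A density \<open>\<mu>\<close> at \<open>x\<close> is given by its values \<open>\<mu> c\<close> on the coordinate frames of the smooth charts \<open>c\<close>
  around \<open>x\<close>, which are related by the absolute Jacobian determinants of the coordinate changes.
  Values at other charts are normalised to zero.\<close>

type_synonym ('m, 'n) density = "('m, real^'n) chart \<Rightarrow> real"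

definition chart_around ::
  "('m::topological_space, real^'n::finite) chart set \<Rightarrow> 'm \<Rightarrow> ('m, real^'n) chart \<Rightarrow> bool" where
  "chart_around A x c \<longleftrightarrow> smooth_chart A c \<and> x \<in> fst c"

definition abs_jacobian ::
  "('m, real^'n::finite) chart \<Rightarrow> ('m, real^'n) chart \<Rightarrow> 'm \<Rightarrow> real" where
  "abs_jacobian d c x = \<bar>det (matrix (frechet_derivative (transition d c) (at (snd d x))))\<bar>"

definition densities ::
  "('m::topological_space, real^'n::finite) chart set \<Rightarrow> 'm \<Rightarrow> ('m, 'n) density set" where
  "densities A x = {\<mu>.
     (\<forall>c. \<not> chart_around A x c \<longrightarrow> \<mu> c = 0) \<and>
     (\<forall>c d. chart_around A x c \<and> chart_around A x d \<longrightarrow> \<mu> d = abs_jacobian d c x * \<mu> c)}"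

text \<open>\<open>|dx\<^sup>1 \<and> \<dots> \<and> dx\<^sup>n|\<close> at \<open>x\<close> for the coordinates of the chart \<open>c\<close>:\<close>

definition coord_density ::
  "('m::topological_space, real^'n::finite) chart set \<Rightarrow> ('m, real^'n) chart \<Rightarrow> 'm \<Rightarrow> ('m, 'n) density" where
  "coord_density A c x = (\<lambda>d. if chart_around A x d then abs_jacobian d c x else 0)"

text \<open>Members of the fibre of \<open>E\<^sup>\<or>\<close> over \<open>x\<close> are linear maps on the fibre of \<open>E\<close> over \<open>x\<close>, extended by zero to
  the total space.\<close>

definition vee_fibre ::
  "('m::topological_space, 'n::finite, 'e, 'r::finite) vbundle \<Rightarrow> 'm \<Rightarrow> ('e \<Rightarrow> ('m, 'n) density) set" where
  "vee_fibre E x = {h.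
     (\<forall>a. a \<notin> fibre E x \<longrightarrow> h a = (\<lambda>d. 0)) \<and>
     (\<forall>a\<in>fibre E x. h a \<in> densities (base_atlas E) x) \<and>
     (\<forall>a\<in>fibre E x. \<forall>b\<in>fibre E x. h (fibre_add E a b) = (\<lambda>d. h a d + h b d)) \<and>
     (\<forall>t. \<forall>a\<in>fibre E x. h (fibre_scale E t a) = (\<lambda>d. t * h a d))}"

type_synonym ('m, 'n, 'e) vee_section = "'m \<Rightarrow> 'e \<Rightarrow> ('m, 'n) density"

text \<open>The coefficient functions \<open>\<eta>\<^sub>l\<close>, on the coordinate domain, of a section
  \<open>\<eta>(x)(a) = (\<Sum>l. \<eta>\<^sub>l(\<phi> x) * \<rho>\<^sup>l(a)) * |dx\<^sup>1 \<and> \<dots> \<and> dx\<^sup>n|\<close>.\<close>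

definition vee_coeff ::
  "('m, 'n::finite, 'e, 'r::finite) vbundle \<Rightarrow> ('m, real^'n) chart \<Rightarrow> ('e \<Rightarrow> real^'r) \<Rightarrow>
   'r \<Rightarrow> ('m, 'n, 'e) vee_section \<Rightarrow> real^'n \<Rightarrow> real" where
  "vee_coeff E c \<rho> l \<eta> y =
     (let x = inv_into (fst c) (snd c) y in \<eta> x (inv_into (fibre E x) \<rho> (axis l 1)) c)"

definition smooth_vee_section ::
  "('m::topological_space, 'n::finite, 'e::topological_space, 'r::finite) vbundle \<Rightarrow>
   ('m, 'n, 'e) vee_section \<Rightarrow> bool" where
  "smooth_vee_section E \<eta> \<longleftrightarrow> (\<forall>x. \<eta> x \<in> vee_fibre E x) \<and>
     (\<forall>c \<rho>. total_triv_triple E c \<rho> \<longrightarrow> (\<forall>l. smooth_on (snd c ` fst c) (vee_coeff E c \<rho> l \<eta>)))"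

definition section_support :: "('m::topological_space, 'n, 'e) vee_section \<Rightarrow> 'm set" where
  "section_support \<eta> = closure {x. \<eta> x \<noteq> (\<lambda>a d. 0)}"

section \<open>The test space \<open>D(M, E\<^sup>\<or>)\<close> and distributions\<close>

definition test_sections ::
  "('m::topological_space, 'n::finite, 'e::topological_space, 'r::finite) vbundle \<Rightarrow>
   ('m, 'n, 'e) vee_section set" where
  "test_sections E = {\<eta>. smooth_vee_section E \<eta> \<and> compact (section_support \<eta>)}"

text \<open>For compact \<open>K\<close>, the sections supported in \<open>K\<close> carry the topology of uniform convergence, on compact
  subsets \<open>L\<close> of total trivialization triples, of all derivatives of the coefficient functions.
  \<open>zero_nbhd E K V\<close> says that \<open>V\<close> meets this space in a neighbourhood of zero.\<close>

definition seminorm_ball ::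
  "('m::topological_space, 'n::finite, 'e::topological_space, 'r::finite) vbundle \<Rightarrow>
   (('m, real^'n) chart \<times> ('e \<Rightarrow> real^'r) \<times> 'm set) set \<Rightarrow> nat \<Rightarrow> real \<Rightarrow> ('m, 'n, 'e) vee_section set" where
  "seminorm_ball E T k \<epsilon> = {\<eta>. \<forall>c \<rho> L. (c, \<rho>, L) \<in> T \<longrightarrow> (\<forall>l \<nu>. mi_order \<nu> \<le> k \<longrightarrow>
     (\<forall>y\<in>snd c ` L. \<bar>partials \<nu> (vee_coeff E c \<rho> l \<eta>) y\<bar> < \<epsilon>))}"

definition zero_nbhd ::
  "('m::topological_space, 'n::finite, 'e::topological_space, 'r::finite) vbundle \<Rightarrow>
   'm set \<Rightarrow> ('m, 'n, 'e) vee_section set \<Rightarrow> bool" where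
  "zero_nbhd E K V \<longleftrightarrow> (\<exists>T k \<epsilon>. finite T \<and> 0 < \<epsilon> \<and>
     (\<forall>c \<rho> L. (c, \<rho>, L) \<in> T \<longrightarrow> total_triv_triple E c \<rho> \<and> compact L \<and> L \<subseteq> fst c) \<and>
     {\<eta> \<in> test_sections E. section_support \<eta> \<subseteq> K} \<inter> seminorm_ball E T k \<epsilon> \<subseteq> V)"

definition absolutely_convex :: "('m, 'n, 'e) vee_section set \<Rightarrow> bool" where
  "absolutely_convex V \<longleftrightarrow> (\<forall>\<eta>\<in>V. \<forall>\<zeta>\<in>V. \<forall>s t. \<bar>s\<bar> + \<bar>t\<bar> \<le> 1 \<longrightarrow>
     (\<lambda>x a d. s * \<eta> x a d + t * \<zeta> x a d) \<in> V)"

text \<open>The locally convex inductive limit topology over all compact sets \<open>K\<close>:\<close>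

definition test_open ::
  "('m::topological_space, 'n::finite, 'e::topological_space, 'r::finite) vbundle \<Rightarrow>
   ('m, 'n, 'e) vee_section set \<Rightarrow> bool" where
  "test_open E W \<longleftrightarrow> W \<subseteq> test_sections E \<and>
     (\<forall>\<eta>\<in>W. \<exists>V \<subseteq> test_sections E. absolutely_convex V \<and> (\<forall>K. compact K \<longrightarrow> zero_nbhd E K V) \<and>
        (\<forall>\<zeta>\<in>V. (\<lambda>x a d. \<eta> x a d + \<zeta> x a d) \<in> W))"

definition test_topology ::
  "('m::topological_space, 'n::finite, 'e::topological_space, 'r::finite) vbundle \<Rightarrow>
   ('m, 'n, 'e) vee_section topology" where
  "test_topology E = topology (test_open E)"

lemma zero_nbhd_Int:
  fixes E :: "('m::topological_space, 'n::finite, 'e::topological_space, 'r::finite) vbundle"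
  assumes "zero_nbhd E K V" "zero_nbhd E K V'"
  shows "zero_nbhd E K (V \<inter> V')"
proof -
  let ?D = "{\<eta> \<in> test_sections E. section_support \<eta> \<subseteq> K}"
  from assms(1) obtain T k \<epsilon> where 1: "finite T" "0 < \<epsilon>"
    "\<forall>c \<rho> L. (c, \<rho>, L) \<in> T \<longrightarrow> total_triv_triple E c \<rho> \<and> compact L \<and> L \<subseteq> fst c"
    "?D \<inter> seminorm_ball E T k \<epsilon> \<subseteq> V"
    unfolding zero_nbhd_def by (elim exE conjE) (rule that)
  from assms(2) obtain T' k' \<epsilon>' where 2: "finite T'" "0 < \<epsilon>'"
    "\<forall>c \<rho> L. (c, \<rho>, L) \<in> T' \<longrightarrow> total_triv_triple E c \<rho> \<and> compact L \<and> L \<subseteq> fst c"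
    "?D \<inter> seminorm_ball E T' k' \<epsilon>' \<subseteq> V'"
    unfolding zero_nbhd_def by (elim exE conjE) (rule that)
  have mono: "seminorm_ball E (T \<union> T') (max k k') (min \<epsilon> \<epsilon>') \<subseteq> seminorm_ball E S j \<delta>"
    if "S \<subseteq> T \<union> T'" "j \<le> max k k'" "min \<epsilon> \<epsilon>' \<le> \<delta>" for S j \<delta>
  proof
    fix \<eta> assume \<eta>: "\<eta> \<in> seminorm_ball E (T \<union> T') (max k k') (min \<epsilon> \<epsilon>')"
    show "\<eta> \<in> seminorm_ball E S j \<delta>"
      unfolding seminorm_ball_def mem_Collect_eq
    proof (intro impI allI ballI)
      fix c :: "('m, real^'n) chart" and \<rho> :: "'e \<Rightarrow> real^'r" and L l y and \<nu> :: "'n \<Rightarrow> nat"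
      assume "(c, \<rho>, L) \<in> S" "mi_order \<nu> \<le> j" "y \<in> snd c ` L"
      with that(1,2) have "(c, \<rho>, L) \<in> T \<union> T'" "mi_order \<nu> \<le> max k k'" "y \<in> snd c ` L"
        by auto
      with \<eta> have "\<bar>partials \<nu> (vee_coeff E c \<rho> l \<eta>) y\<bar> < min \<epsilon> \<epsilon>'"
        unfolding seminorm_ball_def mem_Collect_eq by blast
      with that(3) show "\<bar>partials \<nu> (vee_coeff E c \<rho> l \<eta>) y\<bar> < \<delta>"
        by linarith
    qed
  qed
  have "?D \<inter> seminorm_ball E (T \<union> T') (max k k') (min \<epsilon> \<epsilon>') \<subseteq> V \<inter> V'"
    using 1(4) 2(4) mono[of T k \<epsilon>] mono[of T' k' \<epsilon>']
    by auto
  then show ?thesis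
    unfolding zero_nbhd_def using 1(1-3) 2(1-3)
    by (intro exI[of _ "T \<union> T'"] exI[of _ "max k k'"] exI[of _ "min \<epsilon> \<epsilon>'"]) auto
qed

lemma istopology_test_open: "istopology (test_open E)"
  unfolding istopology_def
proof (intro conjI allI impI)
  fix S T assume S: "test_open E S" and T: "test_open E T"
  show "test_open E (S \<inter> T)"
    unfolding test_open_def
  proof (intro conjI ballI)
    show "S \<inter> T \<subseteq> test_sections E" using S by (auto simp: test_open_def)
    fix \<eta> assume \<eta>: "\<eta> \<in> S \<inter> T"
    obtain V where V: "V \<subseteq> test_sections E" "absolutely_convex V"
      "\<forall>K. compact K \<longrightarrow> zero_nbhd E K V" "\<forall>\<zeta>\<in>V. (\<lambda>x a d. \<eta> x a d + \<zeta> x a d) \<in> S"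
      using S \<eta> unfolding test_open_def by blast
    obtain V' where V': "V' \<subseteq> test_sections E" "absolutely_convex V'"
      "\<forall>K. compact K \<longrightarrow> zero_nbhd E K V'" "\<forall>\<zeta>\<in>V'. (\<lambda>x a d. \<eta> x a d + \<zeta> x a d) \<in> T"
      using T \<eta> unfolding test_open_def by blast
    have "absolutely_convex (V \<inter> V')"
      using V(2) V'(2) by (auto simp: absolutely_convex_def)
    then show "\<exists>V \<subseteq> test_sections E. absolutely_convex V \<and> (\<forall>K. compact K \<longrightarrow> zero_nbhd E K V) \<and>
        (\<forall>\<zeta>\<in>V. (\<lambda>x a d. \<eta> x a d + \<zeta> x a d) \<in> S \<inter> T)"
      using V V' by (intro exI[of _ "V \<inter> V'"]) (auto intro: zero_nbhd_Int)
  qed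
next
  fix \<K> assume "\<forall>S\<in>\<K>. test_open E S"
  then have sub: "S \<subseteq> test_sections E" and nb: "\<And>\<eta>. \<eta> \<in> S \<Longrightarrow>
      \<exists>V \<subseteq> test_sections E. absolutely_convex V \<and> (\<forall>K. compact K \<longrightarrow> zero_nbhd E K V) \<and>
        (\<forall>\<zeta>\<in>V. (\<lambda>x a d. \<eta> x a d + \<zeta> x a d) \<in> S)" if "S \<in> \<K>" for S
    using that unfolding test_open_def by simp_all
  show "test_open E (\<Union>\<K>)"
    unfolding test_open_def
  proof (intro conjI ballI)
    show "\<Union>\<K> \<subseteq> test_sections E" using sub by (rule Union_least)
    fix \<eta> assume "\<eta> \<in> \<Union>\<K>"
    then obtain S where S: "S \<in> \<K>" "\<eta> \<in> S" ..
    obtain V where V: "V \<subseteq> test_sections E" "absolutely_convex V"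
      "\<forall>K. compact K \<longrightarrow> zero_nbhd E K V" "\<forall>\<zeta>\<in>V. (\<lambda>x a d. \<eta> x a d + \<zeta> x a d) \<in> S"
      using nb[OF S] by blast
    then show "\<exists>V \<subseteq> test_sections E. absolutely_convex V \<and> (\<forall>K. compact K \<longrightarrow> zero_nbhd E K V) \<and>
        (\<forall>\<zeta>\<in>V. (\<lambda>x a d. \<eta> x a d + \<zeta> x a d) \<in> \<Union>\<K>)"
      using S(1) by (intro exI[of _ V] conjI ballI) (auto intro: UnionI)
  qed
qed

text \<open>\<open>D'(M, E)\<close>, the topological dual of the test space. Functionals are normalised to vanish outside
  \<open>test_sections E\<close>, so that equality of distributions is equality of functions.\<close>

definition distributions ::
  "('m::topological_space, 'n::finite, 'e::topological_space, 'r::finite) vbundle \<Rightarrow>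
   (('m, 'n, 'e) vee_section \<Rightarrow> real) set" where
  "distributions E = {u.
     (\<forall>\<eta>. \<eta> \<notin> test_sections E \<longrightarrow> u \<eta> = 0) \<and>
     (\<forall>\<eta>\<in>test_sections E. \<forall>\<zeta>\<in>test_sections E. u (\<lambda>x a d. \<eta> x a d + \<zeta> x a d) = u \<eta> + u \<zeta>) \<and>
     (\<forall>t. \<forall>\<eta>\<in>test_sections E. u (\<lambda>x a d. t * \<eta> x a d) = t * u \<eta>) \<and>
     continuous_map (test_topology E) euclideanreal u}"

definition mult_distribution ::
  "('m::topological_space, 'n::finite, 'e::topological_space, 'r::finite) vbundle \<Rightarrow>
   ('m \<Rightarrow> real) \<Rightarrow> (('m, 'n, 'e) vee_section \<Rightarrow> real) \<Rightarrow> ('m, 'n, 'e) vee_section \<Rightarrow> real" where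
  "mult_distribution E \<psi> u \<eta> = (if \<eta> \<in> test_sections E then u (\<lambda>x a d. \<psi> x * \<eta> x a d) else 0)"

text \<open>\<open>local_rep E c \<rho> u l\<close> is the component \<open>[H(u)]\<^sup>l\<close>, meaningful on \<open>test_fun (snd c ` fst c)\<close> only.\<close>

definition local_section ::
  "('m::topological_space, 'n::finite, 'e, 'r::finite) vbundle \<Rightarrow> ('m, real^'n) chart \<Rightarrow>
   ('e \<Rightarrow> real^'r) \<Rightarrow> 'r \<Rightarrow> (real^'n \<Rightarrow> real) \<Rightarrow> ('m, 'n, 'e) vee_section" where
  "local_section E c \<rho> l \<xi> = (\<lambda>x a d.
     if x \<in> fst c \<and> a \<in> fibre E x then \<xi> (snd c x) * (\<rho> a $ l) * coord_density (base_atlas E) c x d else 0)"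

definition local_rep ::
  "('m::topological_space, 'n::finite, 'e, 'r::finite) vbundle \<Rightarrow> ('m, real^'n) chart \<Rightarrow>
   ('e \<Rightarrow> real^'r) \<Rightarrow> (('m, 'n, 'e) vee_section \<Rightarrow> real) \<Rightarrow> 'r \<Rightarrow> (real^'n \<Rightarrow> real) \<Rightarrow> real" where
  "local_rep E c \<rho> u l \<xi> = u (local_section E c \<rho> l \<xi>)"

section \<open>Augmented total trivialization atlases and Sobolev spaces of sections\<close>

record ('m, 'n, 'e, 'r) aug_triple =
  chart :: "('m, real^'n) chart"
  triv :: "'e \<Rightarrow> real^'r"
  cutoff :: "'m \<Rightarrow> real"

definition augmented_atlas ::
  "('m::topological_space, 'n::finite, 'e::topological_space, 'r::finite) vbundle \<Rightarrow>
   nat \<Rightarrow> (nat \<Rightarrow> ('m, 'n, 'e, 'r) aug_triple) \<Rightarrow> bool" where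
  "augmented_atlas E N \<Lambda> \<longleftrightarrow>
     (\<forall>\<alpha>\<in>{1..N}. total_triv_triple E (chart (\<Lambda> \<alpha>)) (triv (\<Lambda> \<alpha>))) \<and>
     smooth_atlas ((\<lambda>\<alpha>. chart (\<Lambda> \<alpha>)) ` {1..N}) \<and>
     (\<forall>\<alpha>\<in>{1..N}. smooth_map_on (base_atlas E) euclidean_atlas UNIV (cutoff (\<Lambda> \<alpha>)) \<and>
        (\<forall>x. 0 \<le> cutoff (\<Lambda> \<alpha>) x) \<and>
        closure {x. cutoff (\<Lambda> \<alpha>) x \<noteq> 0} \<subseteq> fst (chart (\<Lambda> \<alpha>))) \<and>
     (\<forall>x. (\<Sum>\<alpha>\<in>{1..N}. cutoff (\<Lambda> \<alpha>) x) = 1)"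

definition bundle_sobolev_norm ::
  "('m::topological_space, 'n::finite, 'e::topological_space, 'r::finite) vbundle \<Rightarrow>
   nat \<Rightarrow> (nat \<Rightarrow> ('m, 'n, 'e, 'r) aug_triple) \<Rightarrow> real \<Rightarrow> real \<Rightarrow>
   (('m, 'n, 'e) vee_section \<Rightarrow> real) \<Rightarrow> ennreal" where
  "bundle_sobolev_norm E N \<Lambda> e q u = (\<Sum>\<alpha>\<in>{1..N}. \<Sum>l\<in>UNIV.
     dist_sobolev_norm e q (snd (chart (\<Lambda> \<alpha>)) ` fst (chart (\<Lambda> \<alpha>)))
       (local_rep E (chart (\<Lambda> \<alpha>)) (triv (\<Lambda> \<alpha>)) (mult_distribution E (cutoff (\<Lambda> \<alpha>)) u) l))"

definition bundle_sobolev_space ::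
  "('m::topological_space, 'n::finite, 'e::topological_space, 'r::finite) vbundle \<Rightarrow>
   nat \<Rightarrow> (nat \<Rightarrow> ('m, 'n, 'e, 'r) aug_triple) \<Rightarrow> real \<Rightarrow> real \<Rightarrow>
   (('m, 'n, 'e) vee_section \<Rightarrow> real) set" where
  "bundle_sobolev_space E N \<Lambda> e q = {u \<in> distributions E. bundle_sobolev_norm E N \<Lambda> e q u < top}"

text \<open>Near each boundary point \<open>z\<close>, \<open>\<Omega>\<close> is the region above the graph of a Lipschitz function \<open>\<gamma>\<close> on the
  hyperplane orthogonal to a unit vector \<open>w\<close>.\<close>

definition lipschitz_boundary :: "(real^'n::finite) set \<Rightarrow> bool" where
  "lipschitz_boundary \<Omega> \<longleftrightarrow> (\<forall>z\<in>frontier \<Omega>. \<exists>w \<gamma> r h L.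
     norm w = 1 \<and> 0 < r \<and> 0 < h \<and> L-lipschitz_on {y. y \<bullet> w = 0 \<and> norm y < r} \<gamma> \<and>
     (\<forall>y. y \<bullet> w = 0 \<and> norm y < r \<longrightarrow> \<bar>\<gamma> y\<bar> < h) \<and>
     (\<forall>y t. y \<bullet> w = 0 \<and> norm y < r \<and> \<bar>t\<bar> < h \<longrightarrow> (z + y + t *\<^sub>R w \<in> \<Omega> \<longleftrightarrow> \<gamma> y < t)))"

definition GL_domain :: "(real^'n::finite) set \<Rightarrow> bool" where
  "GL_domain \<Omega> \<longleftrightarrow> \<Omega> = UNIV \<or> (\<Omega> \<noteq> {} \<and> bounded \<Omega> \<and> open \<Omega> \<and> lipschitz_boundary \<Omega>)"

definition GL_compatible_with_itself ::
  "nat \<Rightarrow> (nat \<Rightarrow> ('m, 'n::finite, 'e, 'r::finite) aug_triple) \<Rightarrow> bool" where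
  "GL_compatible_with_itself N \<Lambda> \<longleftrightarrow>
     (\<forall>\<alpha>\<in>{1..N}. GL_domain (snd (chart (\<Lambda> \<alpha>)) ` fst (chart (\<Lambda> \<alpha>)))) \<and>
     (\<forall>\<alpha>\<in>{1..N}. \<forall>\<beta>\<in>{1..N}. fst (chart (\<Lambda> \<alpha>)) \<inter> fst (chart (\<Lambda> \<beta>)) \<noteq> {} \<longrightarrow>
        GL_domain (snd (chart (\<Lambda> \<alpha>)) ` (fst (chart (\<Lambda> \<alpha>)) \<inter> fst (chart (\<Lambda> \<beta>)))) \<and>
        GL_domain (snd (chart (\<Lambda> \<beta>)) ` (fst (chart (\<Lambda> \<alpha>)) \<inter> fst (chart (\<Lambda> \<beta>)))))"

text \<open>Banach spaces whose carrier is a set of real-valued functions with pointwise operations.\<close>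

definition banach_space_on :: "('a \<Rightarrow> real) set \<Rightarrow> (('a \<Rightarrow> real) \<Rightarrow> real) \<Rightarrow> bool" where
  "banach_space_on V nrm \<longleftrightarrow>
     (\<lambda>z. 0) \<in> V \<and>
     (\<forall>u\<in>V. \<forall>v\<in>V. (\<lambda>z. u z + v z) \<in> V) \<and>
     (\<forall>t. \<forall>u\<in>V. (\<lambda>z. t * u z) \<in> V) \<and>
     (\<forall>u\<in>V. 0 \<le> nrm u) \<and>
     (\<forall>u\<in>V. nrm u = 0 \<longleftrightarrow> u = (\<lambda>z. 0)) \<and>
     (\<forall>t. \<forall>u\<in>V. nrm (\<lambda>z. t * u z) = \<bar>t\<bar> * nrm u) \<and>
     (\<forall>u\<in>V. \<forall>v\<in>V. nrm (\<lambda>z. u z + v z) \<le> nrm u + nrm v) \<and>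
     Metric_space.mcomplete V (\<lambda>u v. nrm (\<lambda>z. u z - v z))"

end

theory Submission
  imports Defs
begin

text \<open>The norm of the space is a finite sum of Sobolev norms of local representations of \<open>\<psi>\<^sub>\<alpha> u\<close>, so two
things have to be shown: that the Sobolev norms on open sets of \<open>\<real>\<^sup>n\<close> are complete, and that local
limits come from a distribution on the manifold.

Completeness is used throughout in the form of absolutely convergent series: if the norms of a
sequence of functionals have a finite sum, then the functionals have a pointwise sum, and the norm of
the sum is at most the sum of the norms. This contains the triangle inequality as the case of two
summands and passes easily from one norm to the next (\<open>pnorm_suminf\<close>, \<open>dist_sobolev_norm_suminf\<close>,
\<open>bundle_series\<close>); \<open>banach_space_on_of_series\<close> converts it into completeness of the metric.

For nonnegative order the property reduces to \<open>L\<^sup>p\<close>, where it follows from Jensen's inequality with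
weights slightly larger than the given norms. The Slobodeckij seminorm is again an \<open>L\<^sup>p\<close> norm, on
\<open>\<Omega> \<times> \<Omega>\<close>, of an expression linear in the function. Both parts of the norm may be evaluated on the
same weak derivative since weak derivatives in \<open>L\<^sup>p\<close> are unique (\<open>fundamental_lemma\<close>). For negative
order the space is a dual space, where series of functionals are summed pointwise. What makes this
meaningful is that test functions have finite Sobolev norm, bounded by their derivatives up to
finite order on their support (\<open>sobolev_norm_test_fun_bound\<close>); consequently an element of any of the
spaces is a continuous functional on test functions with fixed support (\<open>dist_sobolev_norm_bound\<close>).

On the manifold put \<open>\<omega>\<^sub>\<alpha> = \<psi>\<^sub>\<alpha> / (\<Sum>\<^sub>\<beta> \<psi>\<^sub>\<beta>\<^sup>2)\<close>. Then \<open>\<Sum>\<^sub>\<alpha> \<psi>\<^sub>\<alpha> \<omega>\<^sub>\<alpha> = 1\<close>, so a distribution satisfies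
\<open>u(\<eta>) = \<Sum>\<^sub>\<alpha> (\<psi>\<^sub>\<alpha> u)(\<omega>\<^sub>\<alpha> \<eta>)\<close>, and the section \<open>\<omega>\<^sub>\<alpha> \<eta>\<close> of compact support in one trivialization is the
sum of the local sections of its coefficient functions. Thus \<open>u\<close> is recovered from its local
representations (\<open>reconstruct\<close>). Given an absolutely convergent series of distributions, the local
representations have limits, the same formula defines the limit functional, and by the Leibniz rule
and the continuity of the local limits it is bounded by the seminorms of the test section topology
(\<open>glue_distribution\<close>). Its local representations are the local limits, because both are pointwise
sums of the same series; hence its norm is bounded by the sum of the norms.\<close>

section \<open>Calculus of smooth maps\<close>

lemma frechet_derivative_cong_open:
  assumes "open S" "x \<in> S" "\<And>y. y \<in> S \<Longrightarrow> f y = g y"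
  shows "frechet_derivative f (at x) = frechet_derivative g (at x)"
proof -
  have "(f has_derivative D) (at x) \<longleftrightarrow> (g has_derivative D) (at x)" for D
    using assms by (metis has_derivative_transform_within_open)
  then show ?thesis by (simp add: frechet_derivative_def)
qed

lemma differentiable_cong_open:
  assumes "open S" "x \<in> S" "\<And>y. y \<in> S \<Longrightarrow> f y = g y" "f differentiable at x"
  shows "g differentiable at x"
  using assms by (meson differentiable_def has_derivative_transform_within_open)

lemma has_frechet_derivative:
  "f differentiable at x \<Longrightarrow> (f has_derivative frechet_derivative f (at x)) (at x)"
  by (simp add: frechet_derivative_works)

lemma Ck_on_subset: "Ck_on k S f \<Longrightarrow> T \<subseteq> S \<Longrightarrow> Ck_on k T f"
  by (induction k arbitrary: f) (auto intro: continuous_on_subset)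

lemma Ck_on_cong:
  assumes "open S" "\<And>x. x \<in> S \<Longrightarrow> f x = g x" "Ck_on k S f"
  shows "Ck_on k S g"
  using assms(2,3)
proof (induction k arbitrary: f g)
  case 0
  then show ?case using continuous_on_cong[of S S f g] by simp
next
  case (Suc k)
  have "Ck_on k S (\<lambda>x. frechet_derivative g (at x) v)" for v
  proof (rule Suc.IH[of "\<lambda>x. frechet_derivative f (at x) v"])
    show "frechet_derivative f (at x) v = frechet_derivative g (at x) v" if "x \<in> S" for x
      using frechet_derivative_cong_open[OF assms(1) that Suc.prems(1)] by simp
  qed (use Suc.prems in auto)
  moreover have "g differentiable at x" if "x \<in> S" for x
    using differentiable_cong_open[OF assms(1) that Suc.prems(1)] Suc.prems(2) that by simp
  ultimately show ?case by simp
qed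

lemma Ck_on_Suc_imp: "Ck_on (Suc k) S f \<Longrightarrow> Ck_on k S f"
proof (induction k arbitrary: f)
  case 0
  then show ?case
    by (auto intro!: differentiable_imp_continuous_on
        simp: differentiable_on_def differentiable_at_withinI)
next
  case (Suc k)
  then show ?case by (metis Ck_on.simps(2))
qed

text \<open>Smoothness is a local property; this is what allows coordinate expressions to be checked in a
different chart near every point.\<close>

lemma Ck_on_locally:
  assumes "\<And>x. x \<in> S \<Longrightarrow> \<exists>T. open T \<and> x \<in> T \<and> Ck_on k T f"
  shows "Ck_on k S f"
  using assms
proof (induction k arbitrary: f)
  case 0
  show ?case
  proof (unfold Ck_on.simps, rule continuous_at_imp_continuous_on, rule ballI)
    fix x assume "x \<in> S"
    from 0[OF this] obtain T where "open T" "x \<in> T" "continuous_on T f" by auto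
    then show "isCont f x" by (simp add: continuous_on_eq_continuous_at)
  qed
next
  case (Suc k)
  have "f differentiable at x" if "x \<in> S" for x
    using Suc.prems[OF that] by (elim exE conjE) simp
  moreover have "Ck_on k S (\<lambda>x. frechet_derivative f (at x) v)" for v
  proof (rule Suc.IH)
    fix x assume "x \<in> S"
    from Suc.prems[OF this] obtain T where "open T" "x \<in> T" "Ck_on (Suc k) T f" by blast
    then show "\<exists>T. open T \<and> x \<in> T \<and> Ck_on k T (\<lambda>x. frechet_derivative f (at x) v)"
      by auto
  qed
  ultimately show ?case by simp
qed

lemma Ck_on_const: "Ck_on k S (\<lambda>x. c)"
  by (induction k arbitrary: c) auto

lemma Ck_on_bounded_linear: "bounded_linear f \<Longrightarrow> Ck_on k S f"
  by (cases k) (auto simp: linear_continuous_on bounded_linear_imp_differentiable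
      frechet_derivative_at[OF bounded_linear_imp_has_derivative, symmetric] Ck_on_const)

lemma Ck_on_add:
  assumes "open S" "Ck_on k S f" "Ck_on k S g"
  shows "Ck_on k S (\<lambda>x. f x + g x)"
  using assms(2,3)
proof (induction k arbitrary: f g)
  case (Suc k)
  have D: "((\<lambda>x. f x + g x) has_derivative
      (\<lambda>v. frechet_derivative f (at x) v + frechet_derivative g (at x) v)) (at x)" if "x \<in> S" for x
    using Suc.prems that by (intro has_derivative_add has_frechet_derivative) auto
  have "Ck_on k S (\<lambda>x. frechet_derivative (\<lambda>x. f x + g x) (at x) v)" for v
  proof (rule Ck_on_cong[OF assms(1)])
    show "Ck_on k S (\<lambda>x. frechet_derivative f (at x) v + frechet_derivative g (at x) v)"
      using Suc.prems by (intro Suc.IH) auto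
    show "frechet_derivative f (at x) v + frechet_derivative g (at x) v =
        frechet_derivative (\<lambda>x. f x + g x) (at x) v" if "x \<in> S" for x
      by (subst frechet_derivative_at[OF D[OF that], symmetric]) simp
  qed
  moreover have "(\<lambda>x. f x + g x) differentiable at x" if "x \<in> S" for x
    using D[OF that] by (auto simp: differentiable_def)
  ultimately show ?case by simp
qed (auto intro: continuous_on_add)

text \<open>By the product rule each directional derivative is a sum of two such products, and only one of
  the two factors has lost an order of smoothness.\<close>

lemma Ck_on_bilinear:
  fixes pr :: "'b::real_normed_vector \<Rightarrow> 'c::real_normed_vector \<Rightarrow> 'd::real_normed_vector"
  assumes "bounded_bilinear pr" "open S" "Ck_on k S f" "Ck_on k S g"
  shows "Ck_on k S (\<lambda>x. pr (f x) (g x))"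
  using assms(3,4)
proof (induction k arbitrary: f g)
  case (Suc k)
  have D: "((\<lambda>x. pr (f x) (g x)) has_derivative
      (\<lambda>v. pr (f x) (frechet_derivative g (at x) v) + pr (frechet_derivative f (at x) v) (g x))) (at x)"
    if "x \<in> S" for x
    using Suc.prems that by (intro bounded_bilinear.FDERIV[OF assms(1)] has_frechet_derivative) auto
  have "Ck_on k S (\<lambda>x. frechet_derivative (\<lambda>x. pr (f x) (g x)) (at x) v)" for v
  proof (rule Ck_on_cong[OF assms(2)])
    show "Ck_on k S (\<lambda>x. pr (f x) (frechet_derivative g (at x) v) + pr (frechet_derivative f (at x) v) (g x))"
      using Suc Ck_on_Suc_imp[OF Suc.prems(1)] Ck_on_Suc_imp[OF Suc.prems(2)]
      by (intro Ck_on_add[OF assms(2)] Suc.IH) auto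
    show "pr (f x) (frechet_derivative g (at x) v) + pr (frechet_derivative f (at x) v) (g x) =
        frechet_derivative (\<lambda>x. pr (f x) (g x)) (at x) v" if "x \<in> S" for x
      by (subst frechet_derivative_at[OF D[OF that], symmetric]) simp
  qed
  moreover have "(\<lambda>x. pr (f x) (g x)) differentiable at x" if "x \<in> S" for x
    using D[OF that] by (auto simp: differentiable_def)
  ultimately show ?case by simp
qed (auto intro: bounded_bilinear.continuous_on[OF assms(1)])

lemma Ck_on_sum:
  assumes "open S" "\<And>i. i \<in> I \<Longrightarrow> Ck_on k S (f i)"
  shows "Ck_on k S (\<lambda>x. \<Sum>i\<in>I. f i x)"
  using assms(2)
  by (induction I rule: infinite_finite_induct) (auto intro: Ck_on_const Ck_on_add[OF assms(1)])

lemma Ck_on_linear_comp: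
  assumes "bounded_linear h" "open S" "Ck_on k S f"
  shows "Ck_on k S (\<lambda>x. h (f x))"
  using assms(3)
proof (induction k arbitrary: f)
  case (Suc k)
  have D: "((\<lambda>x. h (f x)) has_derivative (\<lambda>v. h (frechet_derivative f (at x) v))) (at x)"
    if "x \<in> S" for x
    using Suc.prems that by (intro bounded_linear.has_derivative[OF assms(1)] has_frechet_derivative) auto
  have "Ck_on k S (\<lambda>x. frechet_derivative (\<lambda>x. h (f x)) (at x) v)" for v
  proof (rule Ck_on_cong[OF assms(2)])
    show "Ck_on k S (\<lambda>x. h (frechet_derivative f (at x) v))"
      using Suc by auto
    show "h (frechet_derivative f (at x) v) = frechet_derivative (\<lambda>x. h (f x)) (at x) v"
      if "x \<in> S" for x
      by (subst frechet_derivative_at[OF D[OF that], symmetric]) simp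
  qed
  moreover have "(\<lambda>x. h (f x)) differentiable at x" if "x \<in> S" for x
    using D[OF that] by (auto simp: differentiable_def)
  ultimately show ?case by simp
qed (auto intro: bounded_linear.continuous_on[OF assms(1)])

text \<open>The chain rule. The inner derivative is expanded along the finite basis of the middle space,
  because the induction hypothesis speaks about derivatives of \<open>f\<close> in a fixed direction.\<close>

lemma Ck_on_compose:
  fixes f :: "'b::euclidean_space \<Rightarrow> 'c::real_normed_vector" and g :: "'a::real_normed_vector \<Rightarrow> 'b"
  assumes "open S" "Ck_on k T f" "Ck_on k S g" "g ` S \<subseteq> T"
  shows "Ck_on k S (\<lambda>x. f (g x))"
  using assms(2,3)
proof (induction k arbitrary: f)
  case 0
  then show ?case using assms(4) by (auto intro: continuous_on_compose2)
next
  case (Suc k)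
  have gx: "g x \<in> T" if "x \<in> S" for x using that assms(4) by auto
  have D: "((\<lambda>x. f (g x)) has_derivative
      (\<lambda>v. frechet_derivative f (at (g x)) (frechet_derivative g (at x) v))) (at x)"
    if "x \<in> S" for x
    using Suc.prems that gx[OF that]
    by (intro has_derivative_compose[where f=g and g=f] has_frechet_derivative) auto
  have "Ck_on k S (\<lambda>x. frechet_derivative (\<lambda>x. f (g x)) (at x) v)" for v
  proof (rule Ck_on_cong[OF assms(1)])
    show "Ck_on k S (\<lambda>x. \<Sum>b\<in>Basis. (frechet_derivative g (at x) v \<bullet> b) *\<^sub>R
            frechet_derivative f (at (g x)) b)"
    proof (intro Ck_on_sum[OF assms(1)] Ck_on_bilinear[OF bounded_bilinear_scaleR assms(1)])
      fix b :: 'b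
      show "Ck_on k S (\<lambda>x. frechet_derivative g (at x) v \<bullet> b)"
        using Suc.prems by (intro Ck_on_linear_comp[OF bounded_linear_inner_left assms(1)]) auto
      show "Ck_on k S (\<lambda>x. frechet_derivative f (at (g x)) b)"
        using Suc.prems Ck_on_Suc_imp by (intro Suc.IH) auto
    qed
    show "(\<Sum>b\<in>Basis. (frechet_derivative g (at x) v \<bullet> b) *\<^sub>R frechet_derivative f (at (g x)) b) =
        frechet_derivative (\<lambda>x. f (g x)) (at x) v" if "x \<in> S" for x
    proof -
      have lin: "linear (frechet_derivative f (at (g x)))"
        using Suc.prems gx[OF that] by (auto intro: linear_frechet_derivative)
      let ?w = "frechet_derivative g (at x) v"
      have "frechet_derivative f (at (g x)) ?w = frechet_derivative f (at (g x)) (\<Sum>b\<in>Basis. (?w \<bullet> b) *\<^sub>R b)"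
        by (simp add: euclidean_representation)
      then show ?thesis
        by (simp add: frechet_derivative_at[OF D[OF that], symmetric] linear_sum[OF lin] linear_cmul[OF lin])
    qed
  qed
  moreover have "(\<lambda>x. f (g x)) differentiable at x" if "x \<in> S" for x
    using D[OF that] by (auto simp: differentiable_def)
  ultimately show ?case by simp
qed

lemma Ck_on_inverse:
  fixes f :: "'a::real_normed_vector \<Rightarrow> real"
  assumes "open S" "Ck_on k S f" "\<And>x. x \<in> S \<Longrightarrow> f x \<noteq> 0"
  shows "Ck_on k S (\<lambda>x. inverse (f x))"
  using assms(2)
proof (induction k)
  case 0
  then show ?case using assms(3) by (auto intro: continuous_on_inverse)
next
  case (Suc k)
  have D: "((\<lambda>x. inverse (f x)) has_derivative
      (\<lambda>v. - (inverse (f x) * frechet_derivative f (at x) v * inverse (f x)))) (at x)"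
    if "x \<in> S" for x
    using Suc.prems that assms(3) by (intro Deriv.has_derivative_inverse has_frechet_derivative) auto
  have I: "Ck_on k S (\<lambda>x. inverse (f x))"
    by (rule Suc.IH[OF Ck_on_Suc_imp[OF Suc.prems]])
  have "Ck_on k S (\<lambda>x. frechet_derivative (\<lambda>x. inverse (f x)) (at x) v)" for v
  proof (rule Ck_on_cong[OF assms(1)])
    show "Ck_on k S (\<lambda>x. - (inverse (f x) * frechet_derivative f (at x) v * inverse (f x)))"
      using Suc.prems I
      by (intro Ck_on_linear_comp[OF bounded_linear_minus[OF bounded_linear_ident]]
          Ck_on_bilinear[OF bounded_bilinear_mult] assms(1)) auto
    show "- (inverse (f x) * frechet_derivative f (at x) v * inverse (f x)) =
        frechet_derivative (\<lambda>x. inverse (f x)) (at x) v" if "x \<in> S" for x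
      by (subst frechet_derivative_at[OF D[OF that], symmetric]) simp
  qed
  moreover have "(\<lambda>x. inverse (f x)) differentiable at x" if "x \<in> S" for x
    using D[OF that] by (auto simp: differentiable_def)
  ultimately show ?case by simp
qed

lemma smooth_on_subset: "smooth_on S f \<Longrightarrow> T \<subseteq> S \<Longrightarrow> smooth_on T f"
  by (auto simp: smooth_on_def intro: Ck_on_subset)

lemma smooth_on_cong:
  "open S \<Longrightarrow> smooth_on S f \<Longrightarrow> (\<And>x. x \<in> S \<Longrightarrow> f x = g x) \<Longrightarrow> smooth_on S g"
  by (auto simp: smooth_on_def intro: Ck_on_cong)

lemma smooth_on_locally:
  assumes "\<And>x. x \<in> S \<Longrightarrow> \<exists>T. open T \<and> x \<in> T \<and> smooth_on T f"
  shows "smooth_on S f"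
  unfolding smooth_on_def using assms by (meson Ck_on_locally smooth_on_def)

lemma smooth_on_Un:
  "open S \<Longrightarrow> open T \<Longrightarrow> smooth_on S f \<Longrightarrow> smooth_on T f \<Longrightarrow> smooth_on (S \<union> T) f"
  by (rule smooth_on_locally) auto

lemma smooth_on_const: "smooth_on S (\<lambda>x. c)"
  by (simp add: smooth_on_def Ck_on_const)

lemma smooth_on_bounded_linear: "bounded_linear f \<Longrightarrow> smooth_on S f"
  by (simp add: smooth_on_def Ck_on_bounded_linear)

lemma smooth_on_add:
  "open S \<Longrightarrow> smooth_on S f \<Longrightarrow> smooth_on S g \<Longrightarrow> smooth_on S (\<lambda>x. f x + g x)"
  by (simp add: smooth_on_def Ck_on_add)

lemma smooth_on_mult:
  fixes f g :: "'a::real_normed_vector \<Rightarrow> real"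
  shows "open S \<Longrightarrow> smooth_on S f \<Longrightarrow> smooth_on S g \<Longrightarrow> smooth_on S (\<lambda>x. f x * g x)"
  by (simp add: smooth_on_def Ck_on_bilinear[OF bounded_bilinear_mult])

lemma smooth_on_cmult:
  fixes f :: "'a::real_normed_vector \<Rightarrow> real"
  shows "open S \<Longrightarrow> smooth_on S f \<Longrightarrow> smooth_on S (\<lambda>x. c * f x)"
  by (simp add: smooth_on_mult smooth_on_const)

lemma smooth_on_sum:
  "open S \<Longrightarrow> (\<And>i. i \<in> I \<Longrightarrow> smooth_on S (f i)) \<Longrightarrow> smooth_on S (\<lambda>x. \<Sum>i\<in>I. f i x)"
  by (simp add: smooth_on_def Ck_on_sum)

lemma smooth_on_prod:
  fixes f :: "'i \<Rightarrow> 'a::real_normed_vector \<Rightarrow> real"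
  assumes "open S" "\<And>i. i \<in> I \<Longrightarrow> smooth_on S (f i)"
  shows "smooth_on S (\<lambda>x. \<Prod>i\<in>I. f i x)"
  using assms(2)
  by (induction I rule: infinite_finite_induct) (auto intro: smooth_on_const smooth_on_mult[OF assms(1)])

lemma smooth_on_linear_comp:
  "bounded_linear h \<Longrightarrow> open S \<Longrightarrow> smooth_on S f \<Longrightarrow> smooth_on S (\<lambda>x. h (f x))"
  by (simp add: smooth_on_def Ck_on_linear_comp)

lemma smooth_on_compose:
  fixes f :: "'b::euclidean_space \<Rightarrow> 'c::real_normed_vector" and g :: "'a::real_normed_vector \<Rightarrow> 'b"
  shows "open S \<Longrightarrow> smooth_on T f \<Longrightarrow> smooth_on S g \<Longrightarrow> g ` S \<subseteq> T \<Longrightarrow> smooth_on S (\<lambda>x. f (g x))"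
  by (auto simp: smooth_on_def intro: Ck_on_compose)

lemma smooth_on_inverse:
  fixes f :: "'a::real_normed_vector \<Rightarrow> real"
  shows "open S \<Longrightarrow> smooth_on S f \<Longrightarrow> (\<And>x. x \<in> S \<Longrightarrow> f x \<noteq> 0) \<Longrightarrow> smooth_on S (\<lambda>x. inverse (f x))"
  by (simp add: smooth_on_def Ck_on_inverse)

lemma smooth_on_Pair:
  "open S \<Longrightarrow> smooth_on S f \<Longrightarrow> smooth_on S g \<Longrightarrow> smooth_on S (\<lambda>x. (f x, g x))"
  using smooth_on_add[OF _ smooth_on_linear_comp[of "\<lambda>a. (a, 0)" S f] smooth_on_linear_comp[of "\<lambda>b. (0, b)" S g]]
  by (simp add: bounded_linear_Pair bounded_linear_ident bounded_linear_zero)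

lemma smooth_on_imp_differentiable: "smooth_on S f \<Longrightarrow> x \<in> S \<Longrightarrow> f differentiable at x"
  using Ck_on.simps(2) unfolding smooth_on_def by blast

lemma smooth_on_imp_continuous_on: "smooth_on S f \<Longrightarrow> continuous_on S f"
  using Ck_on.simps(1) unfolding smooth_on_def by blast

lemma smooth_on_frechet_derivative: "smooth_on S f \<Longrightarrow> smooth_on S (\<lambda>x. frechet_derivative f (at x) v)"
  using Ck_on.simps(2) unfolding smooth_on_def by blast

section \<open>Iterated partial derivatives\<close>

text \<open>Both mixed second derivatives are limits of the same second difference quotient: two
  applications of the mean value theorem evaluate it as a second derivative at a nearby point.\<close>

lemma second_difference_mean_value:
  fixes f :: "'a::real_normed_vector \<Rightarrow> real"
  assumes "h > 0"
    and S: "\<And>s t. 0 \<le> s \<Longrightarrow> s \<le> h \<Longrightarrow> 0 \<le> t \<Longrightarrow> t \<le> h \<Longrightarrow> x + s *\<^sub>R u + t *\<^sub>R v \<in> S"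
    and f: "Ck_on (Suc (Suc 0)) S f"
  obtains s t where "0 \<le> s" "s \<le> h" "0 \<le> t" "t \<le> h"
    "f (x + h *\<^sub>R u + h *\<^sub>R v) - f (x + h *\<^sub>R u) - f (x + h *\<^sub>R v) + f x =
      h * h * frechet_derivative (\<lambda>y. frechet_derivative f (at y) u) (at (x + s *\<^sub>R u + t *\<^sub>R v)) v"
proof -
  let ?A = "\<lambda>y. frechet_derivative f (at y) u"
  have dA: "?A differentiable at y" if "y \<in> S" for y using f that by auto
  have df: "f differentiable at y" if "y \<in> S" for y using f that by auto
  have line: "((\<lambda>s. g (y + s *\<^sub>R w)) has_real_derivative frechet_derivative g (at (y + s *\<^sub>R w)) w) (at s)"
    if "g differentiable at (y + s *\<^sub>R w)" for g :: "'a \<Rightarrow> real" and y w s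
  proof -
    have "((\<lambda>s. y + s *\<^sub>R w) has_derivative (\<lambda>r. r *\<^sub>R w)) (at s)"
      by (auto intro!: derivative_eq_intros)
    from has_derivative_compose[OF this has_frechet_derivative[OF that]]
    have "((\<lambda>s. g (y + s *\<^sub>R w)) has_derivative (\<lambda>r. frechet_derivative g (at (y + s *\<^sub>R w)) (r *\<^sub>R w))) (at s)" .
    then show ?thesis
      using linear_cmul[OF linear_frechet_derivative[OF that]]
      by (simp add: has_field_derivative_def mult.commute[of _ "frechet_derivative g _ _"])
  qed
  have 1: "((\<lambda>s. f (x + s *\<^sub>R u + h *\<^sub>R v) - f (x + s *\<^sub>R u)) has_real_derivative
      ?A (x + s *\<^sub>R u + h *\<^sub>R v) - ?A (x + s *\<^sub>R u)) (at s)" if "0 \<le> s" "s \<le> h" for s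
    using line[of f "x + h *\<^sub>R v" s u] line[of f x s u] df S[OF that, of h] S[OF that, of 0] \<open>h > 0\<close>
    by (auto intro!: DERIV_diff simp: algebra_simps)
  obtain s where s: "0 < s" "s < h" "(f (x + h *\<^sub>R u + h *\<^sub>R v) - f (x + h *\<^sub>R u)) - (f (x + h *\<^sub>R v) - f x) =
      h * (?A (x + s *\<^sub>R u + h *\<^sub>R v) - ?A (x + s *\<^sub>R u))"
    using MVT2[OF \<open>h > 0\<close> 1] by auto
  have 2: "((\<lambda>t. ?A (x + s *\<^sub>R u + t *\<^sub>R v)) has_real_derivative
      frechet_derivative ?A (at (x + s *\<^sub>R u + t *\<^sub>R v)) v) (at t)" if "0 \<le> t" "t \<le> h" for t
    using line[OF dA[OF S[of s t]]] that s by auto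
  obtain t where t: "0 < t" "t < h" "?A (x + s *\<^sub>R u + h *\<^sub>R v) - ?A (x + s *\<^sub>R u) =
      h * frechet_derivative ?A (at (x + s *\<^sub>R u + t *\<^sub>R v)) v"
    using MVT2[OF \<open>h > 0\<close> 2] by auto
  have "f (x + h *\<^sub>R u + h *\<^sub>R v) - f (x + h *\<^sub>R u) - f (x + h *\<^sub>R v) + f x =
      h * h * frechet_derivative ?A (at (x + s *\<^sub>R u + t *\<^sub>R v)) v"
    using s(3) unfolding t(3) mult.assoc by linarith
  then show thesis
    using s(1,2) t(1,2) by (intro that[of s t]) simp_all
qed

lemma mixed_derivatives_commute:
  fixes f :: "'a::real_normed_vector \<Rightarrow> real"
  assumes "open S" "x \<in> S" and f: "Ck_on (Suc (Suc 0)) S f"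
  shows "frechet_derivative (\<lambda>y. frechet_derivative f (at y) u) (at x) v =
    frechet_derivative (\<lambda>y. frechet_derivative f (at y) v) (at x) u" (is "?A x = ?B x")
proof -
  have A: "isCont ?A x" and B: "isCont ?B x"
    using assms f by (simp_all add: continuous_on_eq_continuous_at[OF assms(1)])
  have "\<bar>?A x - ?B x\<bar> \<le> \<epsilon>" if "\<epsilon> > 0" for \<epsilon>
  proof -
    obtain \<delta>1 where \<delta>1: "\<delta>1 > 0" "\<And>y. dist y x < \<delta>1 \<Longrightarrow> dist (?A y) (?A x) < \<epsilon> / 2"
      using A \<open>\<epsilon> > 0\<close> unfolding continuous_at_eps_delta by (metis half_gt_zero)
    obtain \<delta>2 where \<delta>2: "\<delta>2 > 0" "\<And>y. dist y x < \<delta>2 \<Longrightarrow> dist (?B y) (?B x) < \<epsilon> / 2"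
      using B \<open>\<epsilon> > 0\<close> unfolding continuous_at_eps_delta by (metis half_gt_zero)
    obtain \<delta>3 where \<delta>3: "\<delta>3 > 0" "ball x \<delta>3 \<subseteq> S"
      using assms(1,2) open_contains_ball by blast
    define \<delta> where "\<delta> = min \<delta>1 (min \<delta>2 \<delta>3)"
    define h where "h = \<delta> / (2 * (norm u + norm v + 1))"
    have pos: "norm u + norm v + 1 > 0" by (simp add: add_nonneg_pos)
    have "\<delta> > 0" using \<delta>1 \<delta>2 \<delta>3 by (simp add: \<delta>_def)
    then have h: "h > 0" using pos by (simp add: h_def)
    have near: "dist (x + s *\<^sub>R u + t *\<^sub>R v) x < \<delta>" if "0 \<le> s" "s \<le> h" "0 \<le> t" "t \<le> h" for s t
    proof -
      have "dist (x + s *\<^sub>R u + t *\<^sub>R v) x \<le> norm (s *\<^sub>R u) + norm (t *\<^sub>R v)"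
        using norm_triangle_ineq[of "s *\<^sub>R u" "t *\<^sub>R v"] by (simp add: dist_norm add.assoc)
      also have "\<dots> \<le> h * norm u + h * norm v"
        using that by (auto intro!: add_mono mult_right_mono)
      also have "\<dots> \<le> h * (norm u + norm v + 1)"
        using h by (simp add: distrib_left)
      also have "\<dots> = \<delta> / 2" using pos by (simp add: h_def field_simps)
      also have "\<dots> < \<delta>" using \<open>\<delta> > 0\<close> by simp
      finally show ?thesis .
    qed
    have inS: "x + s *\<^sub>R u + t *\<^sub>R v \<in> S" if "0 \<le> s" "s \<le> h" "0 \<le> t" "t \<le> h" for s t
      using near[OF that] \<delta>3 by (auto simp: \<delta>_def dist_commute)
    have inS': "x + t *\<^sub>R v + s *\<^sub>R u \<in> S" if "0 \<le> t" "t \<le> h" "0 \<le> s" "s \<le> h" for s t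
      using inS[OF that(3,4,1,2)] by (simp add: add_ac)
    obtain s t where st: "0 \<le> s" "s \<le> h" "0 \<le> t" "t \<le> h"
      "f (x + h *\<^sub>R u + h *\<^sub>R v) - f (x + h *\<^sub>R u) - f (x + h *\<^sub>R v) + f x = h * h * ?A (x + s *\<^sub>R u + t *\<^sub>R v)"
      using second_difference_mean_value[OF h inS f] by blast
    obtain s' t' where st': "0 \<le> s'" "s' \<le> h" "0 \<le> t'" "t' \<le> h"
      "f (x + h *\<^sub>R v + h *\<^sub>R u) - f (x + h *\<^sub>R v) - f (x + h *\<^sub>R u) + f x = h * h * ?B (x + s' *\<^sub>R v + t' *\<^sub>R u)"
      using second_difference_mean_value[OF h inS' f] by blast
    have "f (x + h *\<^sub>R v + h *\<^sub>R u) = f (x + h *\<^sub>R u + h *\<^sub>R v)"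
      by (simp add: add_ac)
    then have "h * h * ?A (x + s *\<^sub>R u + t *\<^sub>R v) = h * h * ?B (x + s' *\<^sub>R v + t' *\<^sub>R u)"
      using st(5) st'(5) by linarith
    then have "?A (x + s *\<^sub>R u + t *\<^sub>R v) = ?B (x + s' *\<^sub>R v + t' *\<^sub>R u)"
      using h by simp
    moreover have "dist (?A (x + s *\<^sub>R u + t *\<^sub>R v)) (?A x) < \<epsilon> / 2"
      using near[OF st(1-4)] by (intro \<delta>1) (simp add: \<delta>_def)
    moreover have "dist (?B (x + s' *\<^sub>R v + t' *\<^sub>R u)) (?B x) < \<epsilon> / 2"
      using near[OF st'(3,4,1,2)] by (intro \<delta>2) (simp add: \<delta>_def add_ac)
    ultimately show ?thesis unfolding dist_real_def by linarith
  qed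
  then have "\<bar>?A x - ?B x\<bar> \<le> 0" by (rule field_le_epsilon) simp
  then show ?thesis by simp
qed

lemma smooth_on_partial_deriv: "smooth_on S f \<Longrightarrow> smooth_on S (partial_deriv i f)"
  unfolding partial_deriv_def by (rule smooth_on_frechet_derivative)

lemma smooth_on_foldr_partial_deriv: "smooth_on S f \<Longrightarrow> smooth_on S (foldr partial_deriv is f)"
  by (induction "is") (auto intro: smooth_on_partial_deriv)

lemma partial_deriv_cong_open:
  assumes "open S" "x \<in> S" "\<And>y. y \<in> S \<Longrightarrow> f y = g y"
  shows "partial_deriv i f x = partial_deriv i g x"
  unfolding partial_deriv_def using frechet_derivative_cong_open[OF assms] by simp

lemma foldr_partial_deriv_cong_open:
  assumes "open S" "x \<in> S" "\<And>y. y \<in> S \<Longrightarrow> f y = g y"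
  shows "foldr partial_deriv is f x = foldr partial_deriv is g x"
  using assms(2)
  by (induction "is" arbitrary: x) (auto simp: assms(3) intro: partial_deriv_cong_open[OF assms(1)])

lemma partial_deriv_add:
  assumes "smooth_on S f" "smooth_on S g" "x \<in> S"
  shows "partial_deriv i (\<lambda>y. f y + g y) x = partial_deriv i f x + partial_deriv i g x"
  unfolding partial_deriv_def using assms
  by (subst frechet_derivative_at[OF has_derivative_add[OF has_frechet_derivative has_frechet_derivative], symmetric])
    (auto intro: smooth_on_imp_differentiable)

lemma partial_deriv_mult:
  fixes f g :: "real^'n::finite \<Rightarrow> real"
  assumes "smooth_on S f" "smooth_on S g" "x \<in> S"
  shows "partial_deriv i (\<lambda>y. f y * g y) x = partial_deriv i f x * g x + f x * partial_deriv i g x"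
  unfolding partial_deriv_def using assms
  by (subst frechet_derivative_at[OF has_derivative_mult[OF has_frechet_derivative has_frechet_derivative], symmetric])
    (auto intro: smooth_on_imp_differentiable)

lemma foldr_partial_deriv_add:
  assumes "open S" "smooth_on S f" "smooth_on S g" "x \<in> S"
  shows "foldr partial_deriv is (\<lambda>y. f y + g y) x = foldr partial_deriv is f x + foldr partial_deriv is g x"
  using assms(4)
proof (induction "is" arbitrary: x)
  case (Cons i "is")
  have "foldr partial_deriv (i # is) (\<lambda>y. f y + g y) x =
      partial_deriv i (\<lambda>y. foldr partial_deriv is f y + foldr partial_deriv is g y) x"
    by (simp, rule partial_deriv_cong_open[OF assms(1) Cons.prems]) (simp add: Cons.IH)
  also have "\<dots> = partial_deriv i (foldr partial_deriv is f) x + partial_deriv i (foldr partial_deriv is g) x"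
    by (intro partial_deriv_add[of S] smooth_on_foldr_partial_deriv assms Cons.prems)
  finally show ?case by simp
qed simp

lemma foldr_partial_deriv_move:
  assumes "open S" "smooth_on S f" "x \<in> S"
  shows "foldr partial_deriv (as @ i # bs) f x = foldr partial_deriv (i # as @ bs) f x"
  using assms(3)
proof (induction as arbitrary: x)
  case (Cons c as)
  let ?g = "foldr partial_deriv (as @ bs) f"
  have "foldr partial_deriv ((c # as) @ i # bs) f x = partial_deriv c (partial_deriv i ?g) x"
    using Cons.IH by (auto intro: partial_deriv_cong_open[OF assms(1) Cons.prems])
  also have "\<dots> = partial_deriv i (partial_deriv c ?g) x"
    using smooth_on_foldr_partial_deriv[OF assms(2), of "as @ bs"] unfolding partial_deriv_def smooth_on_def
    by (intro mixed_derivatives_commute[OF assms(1) Cons.prems]) blast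
  finally show ?case by simp
qed simp

text \<open>Symmetry of second derivatives for iterated ones: each derivative is moved to the front in turn.\<close>

lemma foldr_partial_deriv_mset:
  assumes "open S" "smooth_on S f" "x \<in> S" "mset is = mset js"
  shows "foldr partial_deriv is f x = foldr partial_deriv js f x"
  using assms(3,4)
proof (induction "is" arbitrary: js x)
  case (Cons i "is")
  then have "i \<in> set js" by (metis list.set_intros(1) mset_eq_setD)
  then obtain as bs where js: "js = as @ i # bs" by (meson split_list)
  then have perm: "mset is = mset (as @ bs)" using Cons.prems(2) by simp
  have "partial_deriv i (foldr partial_deriv is f) x = partial_deriv i (foldr partial_deriv (as @ bs) f) x"
    by (rule partial_deriv_cong_open[OF assms(1) Cons.prems(1)]) (rule Cons.IH[OF _ perm])
  then have "foldr partial_deriv (i # is) f x = foldr partial_deriv (i # as @ bs) f x"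
    by simp
  then show ?case
    using foldr_partial_deriv_move[OF assms(1,2) Cons.prems(1), of as i bs] js by simp
qed simp

lemma count_list_eq_iff_mset: "count_list is = count_list js \<longleftrightarrow> mset is = mset js"
  by (metis count_mset ext multiset_eqI)

lemma ex_list_of_counts:
  fixes \<nu> :: "'n::finite \<Rightarrow> nat"
  shows "\<exists>is. \<forall>i. count_list is i = \<nu> i"
proof -
  obtain "is" where "mset is = Abs_multiset \<nu>" using ex_mset by blast
  then have "count (mset is) = \<nu>" by (simp add: Abs_multiset_inverse)
  then show ?thesis by (metis count_mset)
qed

lemma mi_order_count_list: "mi_order (count_list is) = length is"
  unfolding mi_order_def by (rule sum_count_set) auto

lemma partials_obtain_list:
  obtains "is" where "partials \<nu> = foldr partial_deriv is" "count_list is = \<nu>" "length is = mi_order \<nu>"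
proof -
  define js where "js = (SOME is. \<forall>i. count_list is i = \<nu> i)"
  have "\<forall>i. count_list js i = \<nu> i" unfolding js_def using ex_list_of_counts by (rule someI_ex)
  then have "count_list js = \<nu>" by auto
  moreover have "partials \<nu> = foldr partial_deriv js" by (simp add: partials_def js_def fun_eq_iff)
  ultimately show thesis using that[of js] mi_order_count_list[of js] by simp
qed

text \<open>For smooth functions the order of differentiation is irrelevant, so the arbitrary list chosen in
  the definition of the mixed partial derivative may be replaced by any other list with the same counts.\<close>

lemma partials_count_list:
  assumes "open S" "smooth_on S f" "x \<in> S"
  shows "partials (count_list is) f x = foldr partial_deriv is f x"
proof -
  obtain js where js: "partials (count_list is) = foldr partial_deriv js" "count_list js = count_list is"
    by (rule partials_obtain_list) (rule that)
  have "mset js = mset is" using js(2) by (simp only: count_list_eq_iff_mset)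
  then show ?thesis unfolding js(1) by (rule foldr_partial_deriv_mset[OF assms])
qed

lemma partials_zero [simp]: "partials (\<lambda>_::'a::finite. 0) f = f"
proof -
  have "\<exists>is :: 'a list. partials (\<lambda>_. 0) = foldr partial_deriv is \<and> length is = mi_order (\<lambda>_::'a. 0)"
    using partials_obtain_list[of "\<lambda>_::'a. 0"] by blast
  then show ?thesis by (auto simp: mi_order_def)
qed

lemma finite_mi_order_le: "finite {\<nu> :: 'n::finite \<Rightarrow> nat. mi_order \<nu> \<le> k}"
proof (rule finite_subset)
  show "{\<nu> :: 'n \<Rightarrow> nat. mi_order \<nu> \<le> k} \<subseteq> PiE UNIV (\<lambda>_. {..k})"
    by (auto simp: mi_order_def intro: order_trans[OF member_le_sum[of _ UNIV]])
qed (simp add: finite_PiE)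

lemma finite_mi_order_eq: "finite {\<nu> :: 'n::finite \<Rightarrow> nat. mi_order \<nu> = k}"
  by (rule finite_subset[OF _ finite_mi_order_le[of k]]) auto

text \<open>Boundedness of multiplication by a fixed smooth function in the seminorms of the test function
  topology; the Leibniz rule is applied one derivative at a time.\<close>

lemma Leibniz_bound_lists:
  fixes h :: "real^'n::finite \<Rightarrow> real"
  assumes S: "open S" and K: "compact K" "K \<subseteq> S" and h: "smooth_on S h"
  shows "\<exists>C\<ge>0. \<forall>g B. smooth_on S g \<longrightarrow> 0 \<le> B \<longrightarrow>
     (\<forall>is. length is \<le> m \<longrightarrow> (\<forall>y\<in>K. \<bar>foldr partial_deriv is g y\<bar> \<le> B)) \<longrightarrow>
     (\<forall>is. length is \<le> m \<longrightarrow> (\<forall>y\<in>K. \<bar>foldr partial_deriv is (\<lambda>y. h y * g y) y\<bar> \<le> C * B))"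
  using h
proof (induction m arbitrary: h)
  case 0
  have "bounded (h ` K)"
    using smooth_on_imp_continuous_on[OF 0] K
    by (intro compact_imp_bounded compact_continuous_image) (auto intro: continuous_on_subset)
  then obtain C where C: "\<forall>y\<in>K. \<bar>h y\<bar> \<le> C" by (auto simp: bounded_iff)
  show ?case
  proof (intro exI[of _ "max 0 C"] conjI allI impI ballI)
    fix g B y and "is" :: "'n list" assume "0 \<le> B" "\<forall>is. length is \<le> 0 \<longrightarrow> (\<forall>y\<in>K. \<bar>foldr partial_deriv is g y\<bar> \<le> B)" "y \<in> K"
      "length is \<le> 0"
    then have "\<bar>h y\<bar> \<le> max 0 C" "\<bar>g y\<bar> \<le> B" using C by force+
    then show "\<bar>foldr partial_deriv is (\<lambda>y. h y * g y) y\<bar> \<le> max 0 C * B"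
      using \<open>length is \<le> 0\<close> by (simp add: abs_mult mult_mono)
  qed auto
next
  case (Suc m)
  obtain C0 where C0: "C0 \<ge> 0" "\<And>g B is y. \<lbrakk>smooth_on S g; 0 \<le> B;
       \<forall>is. length is \<le> m \<longrightarrow> (\<forall>y\<in>K. \<bar>foldr partial_deriv is g y\<bar> \<le> B); length is \<le> m; y \<in> K\<rbrakk>
     \<Longrightarrow> \<bar>foldr partial_deriv is (\<lambda>y. h y * g y) y\<bar> \<le> C0 * B"
    using Suc.IH[OF Suc.prems] by blast
  have "\<exists>C1. \<forall>i. C1 i \<ge> 0 \<and> (\<forall>g B. smooth_on S g \<longrightarrow> 0 \<le> B \<longrightarrow>
     (\<forall>is. length is \<le> m \<longrightarrow> (\<forall>y\<in>K. \<bar>foldr partial_deriv is g y\<bar> \<le> B)) \<longrightarrow>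
     (\<forall>is. length is \<le> m \<longrightarrow> (\<forall>y\<in>K. \<bar>foldr partial_deriv is (\<lambda>y. partial_deriv i h y * g y) y\<bar> \<le> C1 i * B)))"
    using Suc.IH[OF smooth_on_partial_deriv[OF Suc.prems]] by (intro choice allI) blast
  then obtain C1 where C1: "\<And>i. C1 i \<ge> 0" "\<And>i g B is y. \<lbrakk>smooth_on S g; 0 \<le> B;
       \<forall>is. length is \<le> m \<longrightarrow> (\<forall>y\<in>K. \<bar>foldr partial_deriv is g y\<bar> \<le> B); length is \<le> m; y \<in> K\<rbrakk>
     \<Longrightarrow> \<bar>foldr partial_deriv is (\<lambda>y. partial_deriv i h y * g y) y\<bar> \<le> C1 i * B"
    by blast
  show ?case
  proof (intro exI[of _ "C0 + (\<Sum>i\<in>UNIV. C1 i)"] conjI allI impI ballI)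
    show "0 \<le> C0 + (\<Sum>i\<in>UNIV. C1 i)" using C0(1) C1(1) by (simp add: sum_nonneg)
    fix g B y and "is" :: "'n list"
    assume g: "smooth_on S g" and B: "0 \<le> B" and y: "y \<in> K"
      and bd: "\<forall>is. length is \<le> Suc m \<longrightarrow> (\<forall>y\<in>K. \<bar>foldr partial_deriv is g y\<bar> \<le> B)"
      and l: "length is \<le> Suc m"
    have sumC1: "C1 i \<le> (\<Sum>i\<in>UNIV. C1 i)" for i
      using C1(1) by (intro member_le_sum) auto
    show "\<bar>foldr partial_deriv is (\<lambda>y. h y * g y) y\<bar> \<le> (C0 + (\<Sum>i\<in>UNIV. C1 i)) * B"
    proof (cases "is" rule: rev_exhaust)
      case Nil
      have "\<bar>foldr partial_deriv [] (\<lambda>y. h y * g y) y\<bar> \<le> C0 * B"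
        using bd by (intro C0(2)[OF g B _ _ y]) auto
      also have "\<dots> \<le> (C0 + (\<Sum>i\<in>UNIV. C1 i)) * B"
        using B C1(1) by (intro mult_right_mono) (auto simp: sum_nonneg)
      finally show ?thesis using Nil by simp
    next
      case (snoc js i)
      then have lj: "length js \<le> m" using l by simp
      have yS: "y \<in> S" using y K by auto
      have "foldr partial_deriv is (\<lambda>y. h y * g y) y = foldr partial_deriv js (partial_deriv i (\<lambda>y. h y * g y)) y"
        by (simp add: snoc)
      also have "\<dots> = foldr partial_deriv js (\<lambda>y. partial_deriv i h y * g y + h y * partial_deriv i g y) y"
        by (rule foldr_partial_deriv_cong_open[OF S yS]) (rule partial_deriv_mult[OF Suc.prems g])
      also have "\<dots> = foldr partial_deriv js (\<lambda>y. partial_deriv i h y * g y) y +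
          foldr partial_deriv js (\<lambda>y. h y * partial_deriv i g y) y"
        using Suc.prems g by (intro foldr_partial_deriv_add[OF S _ _ yS] smooth_on_mult[OF S] smooth_on_partial_deriv)
      finally have eq: "foldr partial_deriv is (\<lambda>y. h y * g y) y =
          foldr partial_deriv js (\<lambda>y. partial_deriv i h y * g y) y +
          foldr partial_deriv js (\<lambda>y. h y * partial_deriv i g y) y" .
      have 1: "\<bar>foldr partial_deriv js (\<lambda>y. partial_deriv i h y * g y) y\<bar> \<le> C1 i * B"
        using bd by (intro C1(2)[OF g B _ lj y]) auto
      have "\<bar>foldr partial_deriv ks (partial_deriv i g) y\<bar> \<le> B" if "length ks \<le> m" "y \<in> K" for ks y
        using bd[rule_format, of "ks @ [i]" y] that by simp
      then have 2: "\<bar>foldr partial_deriv js (\<lambda>y. h y * partial_deriv i g y) y\<bar> \<le> C0 * B"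
        by (intro C0(2)[OF smooth_on_partial_deriv[OF g] B _ lj y]) auto
      have "\<bar>foldr partial_deriv is (\<lambda>y. h y * g y) y\<bar> \<le> C1 i * B + C0 * B"
        using 1 2 unfolding eq by linarith
      also have "\<dots> \<le> (C0 + (\<Sum>i\<in>UNIV. C1 i)) * B"
        using mult_right_mono[OF sumC1 B, of i] by (simp add: distrib_right)
      finally show ?thesis .
    qed
  qed
qed

lemma bounded_partials_iff:
  fixes f :: "real^'n::finite \<Rightarrow> real"
  assumes "open S" "smooth_on S f" "K \<subseteq> S"
  shows "(\<forall>\<nu>. mi_order \<nu> \<le> m \<longrightarrow> (\<forall>y\<in>K. \<bar>partials \<nu> f y\<bar> \<le> B)) \<longleftrightarrow>
    (\<forall>is. length is \<le> m \<longrightarrow> (\<forall>y\<in>K. \<bar>foldr partial_deriv is f y\<bar> \<le> B))" (is "?L \<longleftrightarrow> ?R")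
proof
  assume ?L
  then show ?R
    using partials_count_list[OF assms(1,2)] mi_order_count_list assms(3) by (metis subsetD)
next
  assume R: ?R
  show ?L
  proof (intro allI impI)
    fix \<nu> :: "'n \<Rightarrow> nat" assume "mi_order \<nu> \<le> m"
    then show "\<forall>y\<in>K. \<bar>partials \<nu> f y\<bar> \<le> B"
      using partials_obtain_list[of \<nu>] R by metis
  qed
qed

lemma Leibniz_bound:
  fixes h :: "real^'n::finite \<Rightarrow> real"
  assumes S: "open S" and K: "compact K" "K \<subseteq> S" and h: "smooth_on S h"
  obtains C where "C \<ge> 0" "\<And>g B \<nu> y. \<lbrakk>smooth_on S g; 0 \<le> B;
     \<And>\<nu> y. mi_order \<nu> \<le> m \<Longrightarrow> y \<in> K \<Longrightarrow> \<bar>partials \<nu> g y\<bar> \<le> B; mi_order \<nu> \<le> m; y \<in> K\<rbrakk>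
     \<Longrightarrow> \<bar>partials \<nu> (\<lambda>y. h y * g y) y\<bar> \<le> C * B"
proof -
  obtain C where C: "C \<ge> 0" "\<And>g B. \<lbrakk>smooth_on S g; 0 \<le> B;
     \<forall>is. length is \<le> m \<longrightarrow> (\<forall>y\<in>K. \<bar>foldr partial_deriv is g y\<bar> \<le> B)\<rbrakk> \<Longrightarrow>
     \<forall>is. length is \<le> m \<longrightarrow> (\<forall>y\<in>K. \<bar>foldr partial_deriv is (\<lambda>y. h y * g y) y\<bar> \<le> C * B)"
    using Leibniz_bound_lists[OF S K h, of m] by blast
  show thesis
  proof (rule that[OF C(1)])
    fix g B y and \<nu> :: "'n \<Rightarrow> nat" assume g: "smooth_on S g" and B: "0 \<le> B"
      and bd: "\<And>\<nu> y. mi_order \<nu> \<le> m \<Longrightarrow> y \<in> K \<Longrightarrow> \<bar>partials \<nu> g y\<bar> \<le> B" and "mi_order \<nu> \<le> m" "y \<in> K"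
    have "\<forall>is. length is \<le> m \<longrightarrow> (\<forall>y\<in>K. \<bar>foldr partial_deriv is g y\<bar> \<le> B)"
      using bounded_partials_iff[OF S g K(2), of m B] bd by blast
    from C(2)[OF g B this]
    have "\<forall>\<nu>. mi_order \<nu> \<le> m \<longrightarrow> (\<forall>y\<in>K. \<bar>partials \<nu> (\<lambda>y. h y * g y) y\<bar> \<le> C * B)"
      using bounded_partials_iff[OF S smooth_on_mult[OF S h g] K(2), of m "C * B"] by blast
    then show "\<bar>partials \<nu> (\<lambda>y. h y * g y) y\<bar> \<le> C * B"
      using \<open>mi_order \<nu> \<le> m\<close> \<open>y \<in> K\<close> by blast
  qed
qed

section \<open>Test functions\<close>

lemma test_fun_smooth: "\<xi> \<in> test_fun \<Omega> \<Longrightarrow> smooth_on UNIV \<xi>"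
  by (simp add: test_fun_def)

lemma test_funI:
  assumes "smooth_on UNIV \<xi>" "compact K" "K \<subseteq> \<Omega>" "\<And>x. x \<notin> K \<Longrightarrow> \<xi> x = 0"
  shows "\<xi> \<in> test_fun \<Omega>"
proof -
  have "closure {x. \<xi> x \<noteq> 0} \<subseteq> K"
    using assms(4) by (intro closure_minimal compact_imp_closed assms(2)) auto
  then show ?thesis
    using assms bounded_subset[OF compact_imp_bounded[OF assms(2)] order_trans[OF closure_subset]]
    by (auto simp: test_fun_def compact_closure)
qed

lemma test_fun_support:
  assumes "\<xi> \<in> test_fun \<Omega>"
  obtains K where "compact K" "K \<subseteq> \<Omega>" "\<And>x. x \<notin> K \<Longrightarrow> \<xi> x = 0"
proof (rule that)
  show "\<xi> x = 0" if "x \<notin> closure {x. \<xi> x \<noteq> 0}" for x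
    using that closure_subset by (metis (mono_tags, lifting) mem_Collect_eq subsetD)
qed (use assms in \<open>auto simp: test_fun_def\<close>)

lemma test_fun_mono: "\<Omega> \<subseteq> \<Omega>' \<Longrightarrow> test_fun \<Omega> \<subseteq> test_fun \<Omega>'"
  by (auto simp: test_fun_def)

text \<open>The next lemmas keep the support inside a fixed closed set \<open>K\<close> rather than the support of the
function itself, because the estimates below are uniform over all functions supported in \<open>K\<close>.\<close>

lemma partial_deriv_vanish:
  assumes "closed K" "\<And>x. x \<notin> K \<Longrightarrow> \<xi> x = 0" "x \<notin> K"
  shows "partial_deriv i \<xi> x = 0"
proof -
  have "partial_deriv i \<xi> x = partial_deriv i (\<lambda>x. 0) x"
    using assms by (intro partial_deriv_cong_open[of "- K"]) auto
  then show ?thesis by (simp add: partial_deriv_def)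
qed

lemma foldr_partial_deriv_vanish:
  assumes "closed K" "\<And>x. x \<notin> K \<Longrightarrow> \<xi> x = 0" "x \<notin> K"
  shows "foldr partial_deriv is \<xi> x = 0"
  using assms(3) by (induction "is" arbitrary: x) (auto simp: assms(2) intro: partial_deriv_vanish[OF assms(1)])

lemma partials_vanish:
  assumes "closed K" "\<And>x. x \<notin> K \<Longrightarrow> \<xi> x = 0" "x \<notin> K"
  shows "partials \<nu> \<xi> x = 0"
  using foldr_partial_deriv_vanish[OF assms] by (simp add: partials_def)

lemma test_fun_foldr_partial_deriv:
  assumes "\<xi> \<in> test_fun \<Omega>"
  shows "foldr partial_deriv is \<xi> \<in> test_fun \<Omega>"
proof -
  obtain K where K: "compact K" "K \<subseteq> \<Omega>" "\<And>x. x \<notin> K \<Longrightarrow> \<xi> x = 0"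
    by (rule test_fun_support[OF assms]) (rule that)
  show ?thesis
  proof (rule test_funI[OF _ K(1,2)])
    show "smooth_on UNIV (foldr partial_deriv is \<xi>)"
      by (rule smooth_on_foldr_partial_deriv[OF test_fun_smooth[OF assms]])
  qed (rule foldr_partial_deriv_vanish[OF compact_imp_closed[OF K(1)] K(3)])
qed

lemma test_fun_partial_deriv: "\<xi> \<in> test_fun \<Omega> \<Longrightarrow> partial_deriv i \<xi> \<in> test_fun \<Omega>"
  using test_fun_foldr_partial_deriv[of \<xi> \<Omega> "[i]"] by simp

lemma test_fun_partials: "\<xi> \<in> test_fun \<Omega> \<Longrightarrow> partials \<nu> \<xi> \<in> test_fun \<Omega>"
  by (simp add: partials_def test_fun_foldr_partial_deriv)

lemma test_fun_mult: "\<xi> \<in> test_fun \<Omega> \<Longrightarrow> smooth_on UNIV \<zeta> \<Longrightarrow> (\<lambda>x. \<xi> x * \<zeta> x) \<in> test_fun \<Omega>"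
  by (rule test_fun_support, assumption, rule test_funI) (auto simp add: smooth_on_mult test_fun_smooth)

lemma test_fun_continuous: "\<xi> \<in> test_fun \<Omega> \<Longrightarrow> continuous_on UNIV \<xi>"
  by (intro smooth_on_imp_continuous_on test_fun_smooth)

lemma test_fun_bounded:
  assumes "\<xi> \<in> test_fun \<Omega>"
  obtains B where "B > 0" "\<And>x. \<bar>\<xi> x\<bar> \<le> B"
proof -
  obtain K where K: "compact K" "\<And>x. x \<notin> K \<Longrightarrow> \<xi> x = 0" by (rule test_fun_support[OF assms]) (rule that)
  have "bounded (\<xi> ` K)"
    using test_fun_continuous[OF assms] K
    by (intro compact_imp_bounded compact_continuous_image) (auto intro: continuous_on_subset)
  then obtain B where "B > 0" "\<forall>y\<in>K. \<bar>\<xi> y\<bar> \<le> B" unfolding bounded_pos by auto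
  then show thesis using K(2) by (intro that[of B]) (metis abs_zero less_imp_le)+
qed

subsection \<open>Test functions approximating boxes\<close>

text \<open>The family of flat functions \<open>exp(-1/t) / t\<^sup>n\<close>, extended by zero, is closed under
  differentiation up to linear combinations; this makes each member smooth.\<close>

definition flat :: "nat \<Rightarrow> real \<Rightarrow> real" where
  "flat n t = (if 0 < t then exp (- (1 / t)) * (1 / t) ^ n else 0)"

text \<open>Dividing by \<open>t\<close> raises the index by one, so this limit also gives the derivative at the origin.\<close>

lemma flat_tendsto_0: "(flat n \<longlongrightarrow> 0) (at 0)"
proof (rule filterlim_split_at)
  have "((\<lambda>t. (inverse t) ^ n / exp (inverse t)) \<longlongrightarrow> (0::real)) (at_right 0)"
    using filterlim_compose[OF tendsto_power_div_exp_0 filterlim_inverse_at_top_right] .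
  then show "(flat n \<longlongrightarrow> 0) (at_right 0)"
    by (rule Lim_transform_eventually)
      (auto simp: flat_def eventually_at_right_less exp_minus field_simps eventually_at_filter)
  show "(flat n \<longlongrightarrow> 0) (at_left 0)"
    by (rule tendsto_eventually) (auto simp: flat_def eventually_at_filter)
qed

lemma flat_has_derivative: "(flat n has_real_derivative flat (n + 2) t - real n * flat (n + 1) t) (at t)"
proof -
  consider "t > 0" | "t < 0" | "t = 0" by linarith
  then show ?thesis
  proof cases
    case 1
    have "((\<lambda>t. exp (- (1 / t)) * (1 / t) ^ n) has_real_derivative flat (n + 2) t - real n * flat (n + 1) t) (at t)"
      using 1 by (auto intro!: derivative_eq_intros simp: flat_def field_simps power2_eq_square) (cases n; simp add: field_simps)
    then show ?thesis
      by (rule has_field_derivative_transform_within_open[of _ _ _ "{0<..}"]) (use 1 in \<open>auto simp: flat_def\<close>)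
  next
    case 2
    have "((\<lambda>t. 0) has_real_derivative 0) (at t)" by simp
    then have "(flat n has_real_derivative 0) (at t)"
      by (rule has_field_derivative_transform_within_open[of _ _ _ "{..<0}"]) (use 2 in \<open>auto simp: flat_def\<close>)
    then show ?thesis using 2 by (simp add: flat_def)
  next
    case 3
    have "((\<lambda>h. (flat n (0 + h) - flat n 0) / h) \<longlongrightarrow> 0) (at 0)"
      by (rule Lim_transform_eventually[OF flat_tendsto_0[of "n + 1"]])
        (auto simp: flat_def eventually_at_filter field_simps)
    then have "(flat n has_real_derivative 0) (at 0)" by (simp add: DERIV_def)
    then show ?thesis using 3 by (simp add: flat_def)
  qed
qed

lemma smooth_on_flat: "smooth_on UNIV (flat n)"
proof -
  have D: "(flat n has_derivative (\<lambda>v. (flat (n + 2) t - real n * flat (n + 1) t) * v)) (at t)" for n t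
    using flat_has_derivative[of n t] by (simp add: has_field_derivative_def)
  have "Ck_on k UNIV (flat n)" for k
  proof (induction k arbitrary: n)
    case 0
    show ?case using has_derivative_continuous[OF D[of n]] by (simp add: continuous_at_imp_continuous_on)
  next
    case (Suc k)
    have "Ck_on k UNIV (\<lambda>t. frechet_derivative (flat n) (at t) v)" for v
    proof (rule Ck_on_cong)
      show "Ck_on k UNIV (\<lambda>t. (flat (n + 2) t + (- real n) * flat (n + 1) t) * v)"
        by (intro Ck_on_bilinear[OF bounded_bilinear_mult] Ck_on_add Ck_on_const Suc.IH open_UNIV)
    qed (simp_all add: frechet_derivative_at[OF D, symmetric])
    moreover have "flat n differentiable at t" for t using D by (auto simp: differentiable_def)
    ultimately show ?case by simp
  qed
  then show ?thesis by (simp add: smooth_on_def)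
qed

lemma flat_0_range: "0 \<le> flat 0 t" "flat 0 t \<le> 1"
  by (auto simp: flat_def)

text \<open>As \<open>j\<close> grows, \<open>flat 0 (j * t)\<close> tends to the indicator of \<open>{0<..}\<close>, so these products tend to the
indicator of the open box.\<close>

definition box_bump :: "nat \<Rightarrow> real^'n::finite \<Rightarrow> real^'n \<Rightarrow> real^'n \<Rightarrow> real" where
  "box_bump j a b x = (\<Prod>i\<in>UNIV. flat 0 (real j * (x $ i - a $ i)) * flat 0 (real j * (b $ i - x $ i)))"

lemma box_bump_range: "0 \<le> box_bump j a b x" "box_bump j a b x \<le> 1"
  unfolding box_bump_def
  by (auto intro!: prod_nonneg prod_le_1 mult_le_one simp: flat_0_range)

lemma box_bump_test_fun:
  fixes a b :: "real^'n::finite"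
  assumes "cbox a b \<subseteq> \<Omega>"
  shows "box_bump j a b \<in> test_fun \<Omega>"
proof (rule test_funI)
  have aff: "smooth_on UNIV (\<lambda>x::real^'n. c * (x $ i - d))" "smooth_on UNIV (\<lambda>x::real^'n. c * (d - x $ i))"
    for c d :: real and i
  proof -
    have 1: "smooth_on UNIV (\<lambda>x::real^'n. c * x $ i + - (c * d))"
      by (intro smooth_on_add smooth_on_const smooth_on_bounded_linear bounded_linear_const_mult bounded_linear_vec_nth) simp
    have 2: "smooth_on UNIV (\<lambda>x::real^'n. (- c) * x $ i + c * d)"
      by (intro smooth_on_add smooth_on_const smooth_on_bounded_linear bounded_linear_const_mult bounded_linear_vec_nth) simp
    show "smooth_on UNIV (\<lambda>x::real^'n. c * (x $ i - d))" "smooth_on UNIV (\<lambda>x::real^'n. c * (d - x $ i))"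
      using 1 2 by (simp_all add: algebra_simps)
  qed
  show "smooth_on UNIV (box_bump j a b)"
    unfolding box_bump_def
    by (intro smooth_on_prod smooth_on_mult smooth_on_compose[OF _ smooth_on_flat] aff) auto
  show "compact (cbox a b)" by (rule compact_cbox)
  show "box_bump j a b x = 0" if "x \<notin> cbox a b" for x
  proof -
    have "\<not> (\<forall>i. a $ i \<le> x $ i \<and> x $ i \<le> b $ i)" using that by (simp add: mem_box_cart)
    then obtain i where "x $ i < a $ i \<or> b $ i < x $ i" by (meson not_le)
    then have "flat 0 (real j * (x $ i - a $ i)) * flat 0 (real j * (b $ i - x $ i)) = 0"
      by (auto simp: flat_def zero_less_mult_iff)
    then show ?thesis unfolding box_bump_def by (intro prod_zero) auto
  qed
qed (fact assms)

lemma box_bump_tendsto: "(\<lambda>j. box_bump j a b x) \<longlonglongrightarrow> indicator (box a b) x"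
proof -
  have 1: "(\<lambda>j. flat 0 (real j * t)) \<longlonglongrightarrow> (if 0 < t then 1 else 0)" for t
  proof (cases "t > 0")
    case True
    have "(\<lambda>j. inverse (real j) * inverse t) \<longlonglongrightarrow> 0 * inverse t"
      by (intro tendsto_intros lim_inverse_n)
    then have "(\<lambda>j. exp (- (inverse (real j) * inverse t))) \<longlonglongrightarrow> exp (- 0)"
      by (intro tendsto_intros) simp
    moreover have "\<forall>\<^sub>F j in sequentially. exp (- (inverse (real j) * inverse t)) = flat 0 (real j * t)"
      using eventually_gt_at_top[of "0::nat"]
      by eventually_elim (use True in \<open>simp add: flat_def divide_inverse\<close>)
    ultimately have "(\<lambda>j. flat 0 (real j * t)) \<longlonglongrightarrow> exp (- 0)"
      by (rule Lim_transform_eventually)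
    then show ?thesis using True by simp
  qed (auto simp: flat_def zero_less_mult_iff)
  have "(\<lambda>j. box_bump j a b x) \<longlonglongrightarrow>
      (\<Prod>i\<in>UNIV. (if 0 < x $ i - a $ i then 1 else 0) * (if 0 < b $ i - x $ i then 1 else 0))"
    unfolding box_bump_def by (intro tendsto_prod tendsto_mult 1)
  also have "(\<Prod>i\<in>UNIV. (if 0 < x $ i - a $ i then 1 else 0) * (if 0 < b $ i - x $ i then 1 else 0)) =
      (indicator (box a b) x :: real)"
    by (auto simp: indicator_def mem_box_cart)
  finally show ?thesis .
qed

section \<open>Lebesgue norms\<close>

lemma ennreal_root_le_iff:
  assumes "0 < p" "0 \<le> b"
  shows "ennreal_root p I \<le> ennreal b \<longleftrightarrow> I \<le> ennreal (b powr p)"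
proof (cases I)
  case (real i)
  have "i powr (1 / p) \<le> b \<longleftrightarrow> i \<le> b powr p"
  proof
    assume "i powr (1 / p) \<le> b"
    then have "(i powr (1 / p)) powr p \<le> b powr p" using assms by (intro powr_mono2) auto
    then show "i \<le> b powr p" using assms real by (simp add: powr_powr)
  next
    assume "i \<le> b powr p"
    then have "i powr (1 / p) \<le> (b powr p) powr (1 / p)" using assms real by (intro powr_mono2) auto
    then show "i powr (1 / p) \<le> b" using assms by (simp add: powr_powr)
  qed
  then show ?thesis using real assms by (simp add: ennreal_root_def)
qed (simp add: ennreal_root_def top_unique)

lemma ennreal_root_mono:
  assumes "0 < p" "I \<le> J"
  shows "ennreal_root p I \<le> ennreal_root p J"
proof (cases "ennreal_root p J")
  case (real b)
  then have "J \<le> ennreal (b powr p)" using ennreal_root_le_iff[OF assms(1)] by (metis order_refl)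
  then show ?thesis using real assms ennreal_root_le_iff[OF assms(1), of b I] by (metis order_trans)
qed simp

lemma ennreal_root_0 [simp]: "ennreal_root p 0 = 0"
  by (simp add: ennreal_root_def)

lemma ennreal_root_cmult:
  assumes "0 < p" "0 \<le> c"
  shows "ennreal_root p (ennreal (c powr p) * I) = ennreal c * ennreal_root p I"
proof (cases "c = 0")
  case False
  then have c: "c > 0" using assms by simp
  show ?thesis
  proof (cases I)
    case (real i)
    then have "(c powr p * i) powr (1 / p) = c * i powr (1 / p)"
      using assms c by (simp add: powr_mult powr_powr)
    then show ?thesis using real c by (simp add: ennreal_root_def ennreal_mult[symmetric])
  next
    case top
    then show ?thesis using c by (simp add: ennreal_root_def ennreal_mult_top)
  qed
qed simp

text \<open>The \<open>L\<^sup>p\<close> norm on an arbitrary measure space: it is applied to Lebesgue measure on \<open>\<Omega>\<close> for the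
Lebesgue norms and to the product measure on \<open>\<Omega> \<times> \<Omega>\<close> for the Slobodeckij seminorm.\<close>

definition pnorm :: "real \<Rightarrow> 'a measure \<Rightarrow> ('a \<Rightarrow> real) \<Rightarrow> ennreal" where
  "pnorm p M h = ennreal_root p (\<integral>\<^sup>+x. ennreal (\<bar>h x\<bar> powr p) \<partial>M)"

lemma Lp_norm_eq_pnorm: "Lp_norm p \<Omega> f = pnorm p (lebesgue_on \<Omega>) f"
  by (simp add: Lp_norm_def pnorm_def)

lemma pnorm_0 [simp]: "pnorm p M (\<lambda>x. 0) = 0"
  by (simp add: pnorm_def)

lemma pnorm_mono_AE:
  assumes "0 < p" "AE x in M. \<bar>f x\<bar> \<le> \<bar>g x\<bar>"
  shows "pnorm p M f \<le> pnorm p M g"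
  unfolding pnorm_def using assms(2)
  by (intro ennreal_root_mono assms(1) nn_integral_mono_AE)
    (auto elim!: eventually_mono intro!: ennreal_leI powr_mono2 less_imp_le[OF assms(1)])

lemma pnorm_cong_AE:
  assumes "0 < p" "AE x in M. f x = g x"
  shows "pnorm p M f = pnorm p M g"
  using assms(2) by (intro antisym pnorm_mono_AE assms(1)) (auto elim!: eventually_mono)

lemma pnorm_cmult:
  assumes "0 < p" "h \<in> borel_measurable M"
  shows "pnorm p M (\<lambda>x. c * h x) = ennreal \<bar>c\<bar> * pnorm p M h"
proof -
  have "(\<integral>\<^sup>+x. ennreal (\<bar>c * h x\<bar> powr p) \<partial>M) = ennreal (\<bar>c\<bar> powr p) * (\<integral>\<^sup>+x. ennreal (\<bar>h x\<bar> powr p) \<partial>M)"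
    using assms(2) by (subst nn_integral_cmult[symmetric])
      (auto simp: abs_mult powr_mult ennreal_mult intro!: nn_integral_cong)
  then show ?thesis using assms by (simp add: pnorm_def ennreal_root_cmult)
qed

text \<open>Jensen's inequality for \<open>t \<mapsto> t\<^sup>p\<close> with weights \<open>b\<^sub>k\<close>. Choosing the weights
  slightly larger than the norms of the summands turns it into Minkowski's inequality for infinitely
  many summands at once.\<close>

lemma powr_sum_weighted_le:
  fixes t b :: "'i \<Rightarrow> real"
  assumes p: "1 \<le> p" and I: "finite I" "\<And>k. k \<in> I \<Longrightarrow> 0 < b k" "\<And>k. k \<in> I \<Longrightarrow> 0 \<le> t k" "(\<Sum>k\<in>I. b k) \<le> B"
  shows "(\<Sum>k\<in>I. t k) powr p \<le> B powr (p - 1) * (\<Sum>k\<in>I. b k powr (1 - p) * t k powr p)"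
proof -
  \<comment> \<open>Convexity of the power function is available on the positive half line only.\<close>
  define J where "J = {k \<in> I. 0 < t k}"
  define \<beta> where "\<beta> = (\<Sum>k\<in>J. b k)"
  have J: "finite J" "J \<subseteq> I" using I(1) by (auto simp: J_def)
  have sums: "(\<Sum>k\<in>I. t k) = (\<Sum>k\<in>J. t k)"
    using I(3) by (intro sum.mono_neutral_right I(1) J(2)) (force simp: J_def)
  show ?thesis
  proof (cases "J = {}")
    case True
    have "0 \<le> B powr (p - 1) * (\<Sum>k\<in>I. b k powr (1 - p) * t k powr p)"
      by (intro mult_nonneg_nonneg sum_nonneg) auto
    then show ?thesis using p by (simp add: sums True)
  next
    case False
    have \<beta>: "\<beta> > 0" unfolding \<beta>_def using False J I(2) by (intro sum_pos) auto
    have "\<beta> \<le> (\<Sum>k\<in>I. b k)" unfolding \<beta>_def using I J by (intro sum_mono2) (auto intro: less_imp_le)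
    then have \<beta>B: "\<beta> \<le> B" using I(4) by simp
    have bpos: "b k > 0" "t k > 0" if "k \<in> J" for k using that J I(2) by (auto simp: J_def)
    have "(\<Sum>k\<in>J. (b k / \<beta>) *\<^sub>R (t k / b k)) powr p \<le> (\<Sum>k\<in>J. (b k / \<beta>) * (t k / b k) powr p)"
      using \<beta> bpos less_imp_le[OF bpos(1)]
      by (intro convex_on_sum[OF J(1) False powr_convex[OF p]])
        (auto simp: sum_divide_distrib[symmetric] \<beta>_def[symmetric])
    also have "(\<Sum>k\<in>J. (b k / \<beta>) *\<^sub>R (t k / b k)) = (\<Sum>k\<in>J. t k) / \<beta>"
      unfolding sum_divide_distrib
    proof (intro sum.cong refl)
      fix k assume "k \<in> J"
      then show "(b k / \<beta>) *\<^sub>R (t k / b k) = t k / \<beta>" using bpos[of k] by simp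
    qed
    also have "(\<Sum>k\<in>J. (b k / \<beta>) * (t k / b k) powr p) = (\<Sum>k\<in>J. b k powr (1 - p) * t k powr p) / \<beta>"
      unfolding sum_divide_distrib
    proof (intro sum.cong refl)
      fix k assume k: "k \<in> J"
      have "b k powr (1 - p) = b k / b k powr p" using bpos[OF k] by (simp add: powr_diff)
      then show "b k / \<beta> * (t k / b k) powr p = b k powr (1 - p) * t k powr p / \<beta>"
        using bpos[OF k] by (simp add: powr_divide)
    qed
    also have "((\<Sum>k\<in>J. t k) / \<beta>) powr p = (\<Sum>k\<in>J. t k) powr p / \<beta> powr p"
      by (rule powr_divide)
    finally have "(\<Sum>k\<in>J. t k) powr p \<le> \<beta> powr p / \<beta> * (\<Sum>k\<in>J. b k powr (1 - p) * t k powr p)"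
      using \<beta> by (simp add: field_simps)
    also have "\<beta> powr p / \<beta> = \<beta> powr (p - 1)" using \<beta> by (simp add: powr_diff)
    also have "\<beta> powr (p - 1) * (\<Sum>k\<in>J. b k powr (1 - p) * t k powr p) \<le>
        B powr (p - 1) * (\<Sum>k\<in>I. b k powr (1 - p) * t k powr p)"
      using p \<beta> \<beta>B J I(1) by (intro mult_mono powr_mono2 sum_mono2) (auto intro: sum_nonneg)
    finally show ?thesis by (simp add: sums)
  qed
qed

text \<open>Jensen's inequality holds for all partial sums with one and the same majorant \<open>R\<close>, which has a
finite integral. This yields both the convergence almost everywhere and the estimate of the sum.\<close>

lemma pnorm_suminf_aux:
  fixes h :: "nat \<Rightarrow> 'a \<Rightarrow> real"
  assumes p: "1 \<le> p" and h: "\<And>k. h k \<in> borel_measurable M"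
    and b: "\<And>k. 0 < b k" "b sums B" "\<And>k. pnorm p M (h k) \<le> ennreal (b k)"
  obtains R where "R \<in> borel_measurable M" "(\<integral>\<^sup>+x. R x \<partial>M) \<le> ennreal (B powr p)"
    "\<And>x n. ennreal ((\<Sum>k<n. \<bar>h k x\<bar>) powr p) \<le> R x"
proof -
  define w where "w k = B powr (p - 1) * b k powr (1 - p)" for k
  define R where "R x = (\<Sum>k. ennreal (w k) * ennreal (\<bar>h k x\<bar> powr p))" for x
  have w: "w k \<ge> 0" for k by (simp add: w_def)
  have "summable b" "suminf b = B" using b(2) by (auto simp: sums_iff)
  have Bn: "(\<Sum>k\<in>{..<n}. b k) \<le> B" for n
    using sum_le_suminf[OF \<open>summable b\<close>, of "{..<n}"] b(1) \<open>suminf b = B\<close> by (simp add: less_imp_le)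
  have B: "B > 0" using suminf_pos[OF \<open>summable b\<close> b(1)] \<open>suminf b = B\<close> by simp
  show thesis
  proof (rule that[of R])
    show meas: "R \<in> borel_measurable M" unfolding R_def using h by measurable
    have "(\<integral>\<^sup>+x. R x \<partial>M) = (\<Sum>k. ennreal (w k) * (\<integral>\<^sup>+x. ennreal (\<bar>h k x\<bar> powr p) \<partial>M))"
      unfolding R_def using h by (subst nn_integral_suminf) (auto simp: nn_integral_cmult)
    also have "\<dots> \<le> (\<Sum>k. ennreal (B powr (p - 1) * b k))"
    proof (intro suminf_le allI summableI)
      fix k
      have "(\<integral>\<^sup>+x. ennreal (\<bar>h k x\<bar> powr p) \<partial>M) \<le> ennreal (b k powr p)"
        using b(3)[of k] b(1)[of k] p by (simp add: pnorm_def ennreal_root_le_iff)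
      then have "ennreal (w k) * (\<integral>\<^sup>+x. ennreal (\<bar>h k x\<bar> powr p) \<partial>M) \<le> ennreal (w k) * ennreal (b k powr p)"
        by (intro mult_left_mono) auto
      also have "\<dots> = ennreal (B powr (p - 1) * b k)"
        using b(1)[of k] by (simp add: w_def ennreal_mult[symmetric] mult.assoc powr_add[symmetric])
      finally show "ennreal (w k) * (\<integral>\<^sup>+x. ennreal (\<bar>h k x\<bar> powr p) \<partial>M) \<le> ennreal (B powr (p - 1) * b k)" .
    qed
    also have "\<dots> = ennreal (B powr (p - 1) * B)"
      using b B by (intro suminf_ennreal_eq sums_mult) (auto intro: less_imp_le)
    also have "B powr (p - 1) * B = B powr p" using B by (simp add: powr_diff)
    finally show "(\<integral>\<^sup>+x. R x \<partial>M) \<le> ennreal (B powr p)" .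
    show "ennreal ((\<Sum>k<n. \<bar>h k x\<bar>) powr p) \<le> R x" for x n
    proof -
      have "(\<Sum>k<n. \<bar>h k x\<bar>) powr p \<le> B powr (p - 1) * (\<Sum>k<n. b k powr (1 - p) * \<bar>h k x\<bar> powr p)"
        using b(1) Bn by (intro powr_sum_weighted_le[OF p]) auto
      also have "\<dots> = (\<Sum>k<n. w k * \<bar>h k x\<bar> powr p)"
        by (simp add: sum_distrib_left w_def mult.assoc)
      finally have "ennreal ((\<Sum>k<n. \<bar>h k x\<bar>) powr p) \<le> ennreal (\<Sum>k<n. w k * \<bar>h k x\<bar> powr p)"
        by (rule ennreal_leI)
      also have "\<dots> = (\<Sum>k<n. ennreal (w k) * ennreal (\<bar>h k x\<bar> powr p))"
        using w by (simp add: ennreal_mult[symmetric])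
      also have "\<dots> \<le> R x" unfolding R_def by (intro sum_le_suminf summableI) auto
      finally show ?thesis .
    qed
  qed
qed

text \<open>Strictly positive weights avoid division by zero for vanishing norms; strict majorants also allow
infima to be approximated termwise.\<close>

lemma ex_positive_majorant:
  fixes c :: "nat \<Rightarrow> ennreal"
  assumes "(\<Sum>k. c k) < top" "\<epsilon> > 0"
  obtains b B where "\<And>k. 0 < b k" "b sums B" "\<And>k. c k < ennreal (b k)" "ennreal B \<le> (\<Sum>k. c k) + ennreal \<epsilon>"
proof -
  have c: "c k = ennreal (enn2real (c k))" for k
    using ennreal_suminf_lessD[OF assms(1), of k] by (simp add: less_top)
  have nt: "(\<Sum>k. ennreal (enn2real (c k))) \<noteq> top" using assms(1) c by (simp flip: c)
  have sm: "summable (\<lambda>k. enn2real (c k))" by (rule summable_suminf_not_top[OF _ nt]) simp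
  then have s: "(\<lambda>k. enn2real (c k) + \<epsilon> * (1 / 2) ^ Suc k) sums (suminf (\<lambda>k. enn2real (c k)) + \<epsilon> * 1)"
    by (intro sums_add sums_mult power_half_series) (rule summable_sums)
  have eq: "(\<Sum>k. c k) = ennreal (suminf (\<lambda>k. enn2real (c k)))"
    using suminf_ennreal[OF _ nt] c by (simp flip: c)
  show thesis
  proof (rule that[OF _ s])
    show "0 < enn2real (c k) + \<epsilon> * (1 / 2) ^ Suc k" for k
      using assms(2) by (simp add: add_nonneg_pos)
    show "c k < ennreal (enn2real (c k) + \<epsilon> * (1 / 2) ^ Suc k)" for k
      by (subst c[of k], subst ennreal_less_iff) (use assms(2) in simp_all)
    show "ennreal (suminf (\<lambda>k. enn2real (c k)) + \<epsilon> * 1) \<le> (\<Sum>k. c k) + ennreal \<epsilon>"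
      using assms(2) suminf_nonneg[OF sm] by (simp add: eq)
  qed
qed

text \<open>The theorem of Riesz and Fischer together with Minkowski's inequality for countably many summands.\<close>

lemma pnorm_suminf:
  fixes h :: "nat \<Rightarrow> 'a \<Rightarrow> real"
  assumes p: "1 \<le> p" and h: "\<And>k. h k \<in> borel_measurable M" and fin: "(\<Sum>k. pnorm p M (h k)) < top"
  shows AE_summable_of_pnorm: "AE x in M. summable (\<lambda>k. \<bar>h k x\<bar>)"
    and pnorm_le_suminf: "(AE x in M. \<bar>g x\<bar> \<le> (\<Sum>k. \<bar>h k x\<bar>)) \<Longrightarrow> pnorm p M g \<le> (\<Sum>k. pnorm p M (h k))"
proof -
  have bound: "summable (\<lambda>k. \<bar>h k x\<bar>)" "ennreal ((\<Sum>k. \<bar>h k x\<bar>) powr p) \<le> r"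
    if r: "r < top" "\<And>n. ennreal ((\<Sum>k<n. \<bar>h k x\<bar>) powr p) \<le> r" for r x
  proof -
    obtain s where s: "r = ennreal s" "s \<ge> 0" using r(1) by (cases r) auto
    have le: "(\<Sum>k<n. \<bar>h k x\<bar>) \<le> s powr (1 / p)" for n
    proof -
      have "(\<Sum>k<n. \<bar>h k x\<bar>) powr p \<le> s" using r(2)[of n] s by simp
      then have "((\<Sum>k<n. \<bar>h k x\<bar>) powr p) powr (1 / p) \<le> s powr (1 / p)"
        using p by (intro powr_mono2) auto
      then show ?thesis using p by (simp add: powr_powr sum_nonneg)
    qed
    show sm: "summable (\<lambda>k. \<bar>h k x\<bar>)"
      by (rule summableI_nonneg_bounded[OF _ le]) simp
    have "(\<Sum>k. \<bar>h k x\<bar>) \<le> s powr (1 / p)"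
      by (rule suminf_le_const[OF sm le])
    then have "(\<Sum>k. \<bar>h k x\<bar>) powr p \<le> (s powr (1 / p)) powr p"
      using p by (intro powr_mono2) (auto intro: suminf_nonneg[OF sm])
    then show "ennreal ((\<Sum>k. \<bar>h k x\<bar>) powr p) \<le> r" using p s by (simp add: powr_powr ennreal_leI)
  qed
  \<comment> \<open>Both claims up to \<open>\<epsilon>\<close>, the total excess of the weights over the norms.\<close>
  {
    fix \<epsilon> :: real assume "\<epsilon> > 0"
    obtain b B where b': "\<And>k. 0 < b k" "b sums B" "\<And>k. pnorm p M (h k) < ennreal (b k)"
      and B: "ennreal B \<le> (\<Sum>k. pnorm p M (h k)) + ennreal \<epsilon>"
      by (rule ex_positive_majorant[OF fin \<open>\<epsilon> > 0\<close>]) (rule that)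
    note b = b'(1,2) less_imp_le[OF b'(3)]
    obtain R where R: "R \<in> borel_measurable M" "(\<integral>\<^sup>+x. R x \<partial>M) \<le> ennreal (B powr p)"
      "\<And>x n. ennreal ((\<Sum>k<n. \<bar>h k x\<bar>) powr p) \<le> R x"
      by (rule pnorm_suminf_aux[OF p h b]) (rule that)
    have "AE x in M. R x \<noteq> \<infinity>"
      using R(1,2) by (intro nn_integral_PInf_AE) (auto simp: top_unique)
    then have AE: "AE x in M. R x < top" by eventually_elim (simp add: less_top)
    have B0: "B \<ge> 0" using sums_le[OF _ sums_zero b(2)] b(1) by (simp add: less_imp_le)
    have 2: "pnorm p M g \<le> (\<Sum>k. pnorm p M (h k)) + ennreal \<epsilon>" if g: "AE x in M. \<bar>g x\<bar> \<le> (\<Sum>k. \<bar>h k x\<bar>)"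
    proof -
      have "AE x in M. ennreal (\<bar>g x\<bar> powr p) \<le> R x"
        using g AE
      proof eventually_elim
        case (elim x)
        have "ennreal (\<bar>g x\<bar> powr p) \<le> ennreal ((\<Sum>k. \<bar>h k x\<bar>) powr p)"
          using elim(1) p by (intro ennreal_leI powr_mono2) auto
        also have "\<dots> \<le> R x" by (rule bound(2)[OF elim(2) R(3)])
        finally show ?case .
      qed
      then have "(\<integral>\<^sup>+x. ennreal (\<bar>g x\<bar> powr p) \<partial>M) \<le> ennreal (B powr p)"
        by (rule order_trans[OF nn_integral_mono_AE R(2)])
      then have "pnorm p M g \<le> ennreal B"
        unfolding pnorm_def using p B0 by (subst ennreal_root_le_iff) auto
      then show ?thesis using B by (rule order_trans)
    qed
    have 1: "AE x in M. summable (\<lambda>k. \<bar>h k x\<bar>)"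
      using AE by eventually_elim (rule bound(1)[OF _ R(3)])
    note 1 2
  } note * = this
  show "AE x in M. summable (\<lambda>k. \<bar>h k x\<bar>)" using *(1)[of 1] by simp
  show "pnorm p M g \<le> (\<Sum>k. pnorm p M (h k))" if "AE x in M. \<bar>g x\<bar> \<le> (\<Sum>k. \<bar>h k x\<bar>)"
  proof (rule ennreal_le_epsilon)
    fix e :: real assume "0 < e"
    then show "pnorm p M g \<le> (\<Sum>k. pnorm p M (h k)) + ennreal e" by (rule *(2)[OF _ that])
  qed
qed

text \<open>A crude substitute for Hoelder's inequality, sufficient for integration against a fixed bounded
  function of bounded support: \<open>t \<le> b + b\<^sup>1\<^sup>-\<^sup>p t\<^sup>p\<close> for all positive \<open>t\<close> and \<open>b\<close>.\<close>

lemma nn_integral_le_pnorm: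
  assumes p: "1 \<le> p" and g: "g \<in> borel_measurable M" and K: "K \<in> sets M"
  shows "(\<integral>\<^sup>+x. ennreal \<bar>g x\<bar> * indicator K x \<partial>M) \<le> pnorm p M g * (emeasure M K + 1)"
proof (cases "pnorm p M g < top \<and> emeasure M K < top")
  case True
  define \<kappa> where "\<kappa> = measure M K"
  define a where "a = enn2real (pnorm p M g)"
  have \<kappa>: "emeasure M K = ennreal \<kappa>" "\<kappa> \<ge> 0"
    using True by (auto simp: \<kappa>_def emeasure_eq_ennreal_measure less_top)
  have a: "pnorm p M g = ennreal a" "a \<ge> 0" using True by (auto simp: a_def less_top)
  have main: "(\<integral>\<^sup>+x. ennreal \<bar>g x\<bar> * indicator K x \<partial>M) \<le> ennreal (b * (\<kappa> + 1))" if "b > a" for b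
  proof -
    have b: "b > 0" using that a by simp
    have pt: "t \<le> b + b powr (1 - p) * t powr p" if "t \<ge> 0" for t
    proof (cases "t \<le> b")
      case True
      have "0 \<le> b powr (1 - p) * t powr p" by simp
      then show ?thesis using True by linarith
    next
      case False
      then have "t > 0" using b by simp
      have "b powr (p - 1) \<le> t powr (p - 1)" using False b p by (intro powr_mono2) auto
      then have "1 \<le> t powr (p - 1) / b powr (p - 1)" using b by simp
      then have "t * 1 \<le> t * (t powr (p - 1) / b powr (p - 1))" using \<open>t > 0\<close> by (intro mult_left_mono) auto
      also have "\<dots> = b powr (1 - p) * t powr p"
        using b \<open>t > 0\<close> by (simp add: powr_diff)
      finally show ?thesis using b by simp
    qed
    have "(\<integral>\<^sup>+x. ennreal \<bar>g x\<bar> * indicator K x \<partial>M) \<le>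
        (\<integral>\<^sup>+x. ennreal b * indicator K x + ennreal (b powr (1 - p)) * ennreal (\<bar>g x\<bar> powr p) \<partial>M)"
    proof (intro nn_integral_mono)
      fix x
      have "ennreal \<bar>g x\<bar> \<le> ennreal b + ennreal (b powr (1 - p)) * ennreal (\<bar>g x\<bar> powr p)"
        using pt[of "\<bar>g x\<bar>"] b by (simp add: ennreal_mult[symmetric] ennreal_plus[symmetric] ennreal_leI del: ennreal_plus)
      then show "ennreal \<bar>g x\<bar> * indicator K x \<le>
          ennreal b * indicator K x + ennreal (b powr (1 - p)) * ennreal (\<bar>g x\<bar> powr p)"
        by (auto split: split_indicator)
    qed
    also have "\<dots> = ennreal b * emeasure M K + ennreal (b powr (1 - p)) * (\<integral>\<^sup>+x. ennreal (\<bar>g x\<bar> powr p) \<partial>M)"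
      using g K by (subst nn_integral_add) (auto simp: nn_integral_cmult nn_integral_cmult_indicator)
    also have "\<dots> \<le> ennreal b * ennreal \<kappa> + ennreal (b powr (1 - p)) * ennreal (b powr p)"
    proof (intro add_mono mult_left_mono)
      have "pnorm p M g \<le> ennreal b" using a that by (simp add: ennreal_leI)
      then show "(\<integral>\<^sup>+x. ennreal (\<bar>g x\<bar> powr p) \<partial>M) \<le> ennreal (b powr p)"
        using p b by (simp add: pnorm_def ennreal_root_le_iff)
    qed (simp_all add: \<kappa>)
    also have "\<dots> = ennreal (b * (\<kappa> + 1))"
      using b \<kappa>(2) by (simp add: ennreal_mult[symmetric] ennreal_plus[symmetric] powr_add[symmetric] algebra_simps del: ennreal_plus)
    finally show ?thesis .
  qed
  have "(\<integral>\<^sup>+x. ennreal \<bar>g x\<bar> * indicator K x \<partial>M) \<le> ennreal (a * (\<kappa> + 1))"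
  proof (rule ennreal_le_epsilon)
    fix e :: real assume "e > 0"
    have "(\<integral>\<^sup>+x. ennreal \<bar>g x\<bar> * indicator K x \<partial>M) \<le> ennreal ((a + e / (\<kappa> + 1)) * (\<kappa> + 1))"
      using \<open>e > 0\<close> \<kappa>(2) by (intro main) simp
    also have "(a + e / (\<kappa> + 1)) * (\<kappa> + 1) = a * (\<kappa> + 1) + e" using \<kappa>(2) by (simp add: field_simps)
    finally show "(\<integral>\<^sup>+x. ennreal \<bar>g x\<bar> * indicator K x \<partial>M) \<le> ennreal (a * (\<kappa> + 1)) + ennreal e"
      using \<open>e > 0\<close> a \<kappa> by (simp add: ennreal_plus[symmetric] del: ennreal_plus)
  qed
  also have "\<dots> = pnorm p M g * (emeasure M K + 1)"
    using a \<kappa> by (simp add: ennreal_mult)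
  finally show ?thesis .
next
  case False
  then consider "pnorm p M g = top" | "emeasure M K = top" "pnorm p M g \<noteq> top"
    using less_top by metis
  then show ?thesis
  proof cases
    case 2
    show ?thesis
    proof (cases "pnorm p M g = 0")
      case True
      then have "ennreal_root p (\<integral>\<^sup>+x. ennreal (\<bar>g x\<bar> powr p) \<partial>M) \<le> ennreal 0" by (simp add: pnorm_def)
      then have "(\<integral>\<^sup>+x. ennreal (\<bar>g x\<bar> powr p) \<partial>M) = 0"
        using p by (subst (asm) ennreal_root_le_iff) auto
      then have "AE x in M. g x = 0" using g by (subst (asm) nn_integral_0_iff_AE) auto
      then have "(\<integral>\<^sup>+x. ennreal \<bar>g x\<bar> * indicator K x \<partial>M) = (\<integral>\<^sup>+x. 0 \<partial>M)"
        by (intro nn_integral_cong_AE) (auto elim!: eventually_mono)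
      then show ?thesis by simp
    qed (simp add: 2 ennreal_mult_top)
  qed (simp add: ennreal_top_mult add_eq_0_iff_both_eq_0)
qed

lemma pnorm_integral_bound:
  assumes p: "1 \<le> p" and g: "g \<in> borel_measurable M" "pnorm p M g < top"
    and \<xi>: "\<xi> \<in> borel_measurable M" "\<And>x. x \<in> space M \<Longrightarrow> \<bar>\<xi> x\<bar> \<le> B" "\<And>x. x \<in> space M \<Longrightarrow> x \<notin> K \<Longrightarrow> \<xi> x = 0"
    and K: "K \<in> sets M" "emeasure M K < top"
  shows "(\<integral>\<^sup>+x. ennreal \<bar>g x * \<xi> x\<bar> \<partial>M) \<le> ennreal (B * (measure M K + 1)) * pnorm p M g"
    and integrable_mult_pnorm: "integrable M (\<lambda>x. g x * \<xi> x)"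
    and abs_integral_le_pnorm: "ennreal \<bar>\<integral>x. g x * \<xi> x \<partial>M\<bar> \<le> ennreal (B * (measure M K + 1)) * pnorm p M g"
proof -
  let ?I = "\<integral>\<^sup>+x. ennreal \<bar>g x * \<xi> x\<bar> \<partial>M"
  have \<kappa>: "emeasure M K + 1 = ennreal (measure M K + 1)"
    using K by (simp add: emeasure_eq_ennreal_measure less_top)
  have "?I \<le> (\<integral>\<^sup>+x. ennreal B * (ennreal \<bar>g x\<bar> * indicator K x) \<partial>M)"
  proof (intro nn_integral_mono)
    fix x assume x: "x \<in> space M"
    have "B \<ge> 0" using \<xi>(2)[OF x] by linarith
    have "\<bar>g x * \<xi> x\<bar> \<le> B * \<bar>g x\<bar>" using mult_left_mono[OF \<xi>(2)[OF x], of "\<bar>g x\<bar>"] by (simp add: abs_mult mult.commute)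
    then show "ennreal \<bar>g x * \<xi> x\<bar> \<le> ennreal B * (ennreal \<bar>g x\<bar> * indicator K x)"
      using \<xi>(3)[OF x] \<open>B \<ge> 0\<close> by (auto simp: ennreal_mult[symmetric] intro!: ennreal_leI split: split_indicator)
  qed
  also have "\<dots> = ennreal B * (\<integral>\<^sup>+x. ennreal \<bar>g x\<bar> * indicator K x \<partial>M)"
    using g(1) K by (intro nn_integral_cmult) auto
  also have "\<dots> \<le> ennreal B * (pnorm p M g * ennreal (measure M K + 1))"
    using nn_integral_le_pnorm[OF p g(1) K(1)] by (intro mult_left_mono) (auto simp: \<kappa>)
  also have "\<dots> = ennreal (B * (measure M K + 1)) * pnorm p M g"
    by (cases "B \<ge> 0") (auto simp: ennreal_mult ennreal_neg mult_nonpos_nonneg mult_ac)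
  finally show I: "?I \<le> ennreal (B * (measure M K + 1)) * pnorm p M g" .
  also have "\<dots> < top" using g(2) by (simp add: ennreal_mult_less_top)
  finally show int: "integrable M (\<lambda>x. g x * \<xi> x)"
    using g(1) \<xi>(1) by (intro integrableI_bounded) auto
  have "ennreal \<bar>\<integral>x. g x * \<xi> x \<partial>M\<bar> \<le> ?I"
    using integral_norm_bound_ennreal[OF int] by simp
  then show "ennreal \<bar>\<integral>x. g x * \<xi> x \<partial>M\<bar> \<le> ennreal (B * (measure M K + 1)) * pnorm p M g"
    using I by (rule order_trans)
qed

text \<open>Integration against a bounded function with support of finite measure commutes with absolutely
convergent sums in \<open>L\<^sup>p\<close>; this lets weak derivatives pass to the limit.\<close>

lemma integral_suminf_mult_sums:
  fixes h :: "nat \<Rightarrow> 'a \<Rightarrow> real"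
  assumes p: "1 \<le> p" and h: "\<And>k. h k \<in> borel_measurable M" "(\<Sum>k. pnorm p M (h k)) < top"
    and \<xi>: "\<xi> \<in> borel_measurable M" "\<And>x. x \<in> space M \<Longrightarrow> \<bar>\<xi> x\<bar> \<le> B" "\<And>x. x \<in> space M \<Longrightarrow> x \<notin> K \<Longrightarrow> \<xi> x = 0"
    and K: "K \<in> sets M" "emeasure M K < top"
  shows "(\<lambda>k. \<integral>x. h k x * \<xi> x \<partial>M) sums (\<integral>x. (\<Sum>k. h k x) * \<xi> x \<partial>M)"
proof -
  have fin: "pnorm p M (h k) < top" for k by (rule ennreal_suminf_lessD[OF h(2)])
  note AE = AE_summable_of_pnorm[OF p h]
  have "(\<lambda>k. \<integral>x. h k x * \<xi> x \<partial>M) sums (\<integral>x. (\<Sum>k. h k x * \<xi> x) \<partial>M)"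
  proof (rule sums_integral)
    show int: "integrable M (\<lambda>x. h k x * \<xi> x)" for k
      by (rule integrable_mult_pnorm[OF p h(1) fin \<xi> K])
    show "AE x in M. summable (\<lambda>k. norm (h k x * \<xi> x))"
      using AE by eventually_elim (auto simp: abs_mult intro: summable_mult2)
    have "(\<Sum>k. ennreal (\<integral>x. norm (h k x * \<xi> x) \<partial>M)) \<le> (\<Sum>k. ennreal (B * (measure M K + 1)) * pnorm p M (h k))"
    proof (intro suminf_le allI summableI)
      fix k
      have "ennreal (\<integral>x. norm (h k x * \<xi> x) \<partial>M) = (\<integral>\<^sup>+x. ennreal \<bar>h k x * \<xi> x\<bar> \<partial>M)"
        using integrable_norm[OF int[of k]] by (subst nn_integral_eq_integral) auto
      also have "\<dots> \<le> ennreal (B * (measure M K + 1)) * pnorm p M (h k)"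
        by (rule pnorm_integral_bound[OF p h(1) fin \<xi> K])
      finally show "ennreal (\<integral>x. norm (h k x * \<xi> x) \<partial>M) \<le> ennreal (B * (measure M K + 1)) * pnorm p M (h k)" .
    qed
    also have "\<dots> < top" using h(2) by (simp add: ennreal_mult_less_top)
    finally show "summable (\<lambda>k. \<integral>x. norm (h k x * \<xi> x) \<partial>M)"
      by (intro summable_suminf_not_top) auto
  qed
  also have "(\<integral>x. (\<Sum>k. h k x * \<xi> x) \<partial>M) = (\<integral>x. (\<Sum>k. h k x) * \<xi> x \<partial>M)"
  proof (rule integral_cong_AE)
    show "AE x in M. (\<Sum>k. h k x * \<xi> x) = (\<Sum>k. h k x) * \<xi> x"
      using AE by eventually_elim (rule suminf_mult2[symmetric], rule summable_rabs_cancel)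
  qed (use h(1) \<xi>(1) in measurable)
  finally show ?thesis .
qed

section \<open>Test functions and Lebesgue spaces\<close>

lemma sigma_finite_lebesgue: "sigma_finite_measure (lebesgue :: 'a::euclidean_space measure)"
proof
  obtain A :: "'a set set" where A: "countable A" "A \<subseteq> sets lborel" "\<Union> A = space lborel"
    "\<forall>a\<in>A. emeasure lborel a \<noteq> \<infinity>"
    using lborel.sigma_finite_countable by blast
  then show "\<exists>A. countable A \<and> A \<subseteq> sets (lebesgue :: 'a measure) \<and> \<Union> A = space lebesgue \<and>
      (\<forall>a\<in>A. emeasure lebesgue a \<noteq> \<infinity>)"
    by (intro exI[of _ A]) auto
qed

lemma sigma_finite_lebesgue_on: "open \<Omega> \<Longrightarrow> sigma_finite_measure (lebesgue_on (\<Omega> :: 'a::euclidean_space set))"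
  by (intro sigma_finite_measure_restrict_space sigma_finite_lebesgue) simp

lemma borel_measurable_lebesgue_on:
  "f \<in> borel_measurable borel \<Longrightarrow> f \<in> borel_measurable (lebesgue_on (\<Omega> :: 'a::euclidean_space set))"
  by (intro measurable_restrict_space1 measurable_completion) simp

lemma compact_lebesgue_on:
  assumes "open \<Omega>" "compact K" "K \<subseteq> (\<Omega> :: 'a::euclidean_space set)"
  shows "K \<in> sets (lebesgue_on \<Omega>)" "emeasure (lebesgue_on \<Omega>) K < top" "measure (lebesgue_on \<Omega>) K = measure lborel K"
proof -
  have K: "K \<in> sets borel" using assms(2) by (intro borel_compact)
  show "K \<in> sets (lebesgue_on \<Omega>)"
    using assms K by (auto simp: sets_restrict_space_iff)
  have e: "emeasure (lebesgue_on \<Omega>) K = emeasure lborel K"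
    using assms K by (simp add: emeasure_restrict_space)
  show "emeasure (lebesgue_on \<Omega>) K < top"
    using emeasure_compact_finite[OF assms(2)] unfolding e by (simp add: less_top)
  show "measure (lebesgue_on \<Omega>) K = measure lborel K"
    by (simp add: measure_def e)
qed

lemma test_fun_borel: "\<xi> \<in> test_fun \<Omega> \<Longrightarrow> \<xi> \<in> borel_measurable borel"
  by (intro borel_measurable_continuous_onI test_fun_continuous)

lemma Lp_measurable: "f \<in> Lp p \<Omega> \<Longrightarrow> f \<in> borel_measurable (lebesgue_on \<Omega>)"
  and Lp_finite: "f \<in> Lp p \<Omega> \<Longrightarrow> pnorm p (lebesgue_on \<Omega>) f < top"
  by (auto simp: Lp_def Lp_norm_eq_pnorm)

lemma integrable_Lp_mult_bounded:
  fixes \<Omega> :: "(real^'n::finite) set"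
  assumes "open \<Omega>" "1 \<le> p" "f \<in> Lp p \<Omega>"
    and "\<xi> \<in> borel_measurable borel" "\<And>x. \<bar>\<xi> x\<bar> \<le> B" "\<And>x. x \<notin> K \<Longrightarrow> \<xi> x = 0" "compact K" "K \<subseteq> \<Omega>"
  shows "integrable (lebesgue_on \<Omega>) (\<lambda>x. f x * \<xi> x)"
  using assms
  by (intro integrable_mult_pnorm[where K=K and B=B and p=p] Lp_measurable[of f p] Lp_finite
      borel_measurable_lebesgue_on compact_lebesgue_on) auto

lemma integrable_Lp_mult_test_fun:
  assumes "open \<Omega>" "1 \<le> p" "f \<in> Lp p \<Omega>" "\<xi> \<in> test_fun \<Omega>"
  shows "integrable (lebesgue_on \<Omega>) (\<lambda>x. f x * \<xi> x)"
proof -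
  obtain K where K: "compact K" "K \<subseteq> \<Omega>" "\<And>x. x \<notin> K \<Longrightarrow> \<xi> x = 0"
    by (rule test_fun_support[OF assms(4)]) (rule that)
  obtain B where B: "\<And>x. \<bar>\<xi> x\<bar> \<le> B"
    by (rule test_fun_bounded[OF assms(4)]) (rule that)
  show ?thesis
    by (rule integrable_Lp_mult_bounded[OF assms(1-3) test_fun_borel[OF assms(4)] B K(3,1,2)])
qed

lemma abs_regular_dist_le:
  assumes "open \<Omega>" "1 \<le> p" "f \<in> Lp p \<Omega>" "\<xi> \<in> test_fun \<Omega>"
    and K: "compact K" "K \<subseteq> \<Omega>" "\<And>x. x \<notin> K \<Longrightarrow> \<xi> x = 0" and B: "\<And>x. x \<in> K \<Longrightarrow> \<bar>\<xi> x\<bar> \<le> B" "0 \<le> B"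
  shows "ennreal \<bar>regular_dist \<Omega> f \<xi>\<bar> \<le> ennreal (B * (measure lborel K + 1)) * Lp_norm p \<Omega> f"
proof -
  have "\<bar>\<xi> x\<bar> \<le> B" for x using B K(3)[of x] by (cases "x \<in> K") auto
  then show ?thesis
    unfolding regular_dist_def Lp_norm_eq_pnorm compact_lebesgue_on(3)[OF assms(1) K(1,2), symmetric]
    by (intro abs_integral_le_pnorm[OF assms(2) Lp_measurable[OF assms(3)] Lp_finite[OF assms(3)]]
        borel_measurable_lebesgue_on test_fun_borel[OF assms(4)] compact_lebesgue_on K assms(1))
qed

subsection \<open>The fundamental lemma of the calculus of variations\<close>

lemma integral_box_eq_0:
  fixes \<Omega> :: "(real^'n::finite) set"
  assumes \<Omega>: "open \<Omega>" and p: "1 \<le> p" and g: "g \<in> Lp p \<Omega>"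
    and 0: "\<And>\<xi>. \<xi> \<in> test_fun \<Omega> \<Longrightarrow> regular_dist \<Omega> g \<xi> = 0" and box: "cbox a b \<subseteq> \<Omega>"
  shows "(\<integral>x. g x * indicator (box a b) x \<partial>lebesgue_on \<Omega>) = 0"
proof -
  note [measurable] = Lp_measurable[OF g]
  have int: "integrable (lebesgue_on \<Omega>) (\<lambda>x. \<bar>g x * indicator (cbox a b) x\<bar>)"
    using \<Omega> p g box
    by (intro integrable_abs integrable_Lp_mult_bounded[where K="cbox a b" and B=1 and p=p])
      (auto split: split_indicator)
  have "(\<lambda>j. \<integral>x. g x * box_bump j a b x \<partial>lebesgue_on \<Omega>) \<longlonglongrightarrow> (\<integral>x. g x * indicator (box a b) x \<partial>lebesgue_on \<Omega>)"
  proof (rule integral_dominated_convergence[OF _ _ int])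
    show "(\<lambda>x. g x * box_bump j a b x) \<in> borel_measurable (lebesgue_on \<Omega>)" for j
      by (intro borel_measurable_times Lp_measurable[OF g] borel_measurable_lebesgue_on
          test_fun_borel[OF box_bump_test_fun[OF box]])
    show "(\<lambda>x. g x * indicator (box a b) x) \<in> borel_measurable (lebesgue_on \<Omega>)"
      by (intro borel_measurable_times Lp_measurable[OF g] borel_measurable_lebesgue_on) auto
    show "AE x in lebesgue_on \<Omega>. (\<lambda>j. g x * box_bump j a b x) \<longlonglongrightarrow> g x * indicator (box a b) x"
      by (intro AE_I2 tendsto_mult tendsto_const box_bump_tendsto)
    show "AE x in lebesgue_on \<Omega>. norm (g x * box_bump j a b x) \<le> \<bar>g x * indicator (cbox a b) x\<bar>" for j
    proof (intro AE_I2)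
      fix x
      have "\<bar>box_bump j a b x\<bar> \<le> indicator (cbox a b) x"
      proof (cases "x \<in> cbox a b")
        case False
        obtain K where "K \<subseteq> cbox a b" "\<And>x. x \<notin> K \<Longrightarrow> box_bump j a b x = 0"
          by (rule test_fun_support[OF box_bump_test_fun[OF order_refl, where a=a and b=b and j=j]]) (rule that)
        then show ?thesis using False by auto
      qed (use box_bump_range[of j a b x] in simp)
      then show "norm (g x * box_bump j a b x) \<le> \<bar>g x * indicator (cbox a b) x\<bar>"
        by (auto simp: abs_mult intro!: mult_left_mono)
    qed
  qed
  then show ?thesis
    using 0[OF box_bump_test_fun[OF box]] by (simp add: regular_dist_def LIMSEQ_const_iff)
qed

text \<open>Boxes form an intersection-stable generator, so the integrals over all Borel sets vanish.\<close>

lemma AE_zero_of_box_integrals: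
  fixes h :: "'a::euclidean_space \<Rightarrow> real"
  assumes h: "integrable lborel h" and 0: "(\<integral>x. h x \<partial>lborel) = 0"
    and box: "\<And>a b. (\<integral>x. indicator (box a b) x * h x \<partial>lborel) = 0"
  shows "AE x in lborel. h x = 0"
proof (rule sigma_finite_measure.density_zero[OF sigma_finite_lborel h])
  let ?G = "range (\<lambda>(a, b). box a b :: 'a set)"
  fix A :: "'a set" assume "A \<in> sets lborel"
  then have A: "A \<in> sigma_sets UNIV ?G" by (simp add: borel_eq_box)
  have stable: "Int_stable ?G"
    by (rule Int_stableI) (clarsimp simp: box_Int_box image_iff, blast)
  have sets: "B \<in> sets lborel" if "B \<in> sigma_sets UNIV ?G" for B
    using that by (simp add: borel_eq_box)
  have "?G \<subseteq> Pow UNIV" by simp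
  from stable this A show "set_lebesgue_integral lborel A h = 0"
  proof (induction rule: sigma_sets_induct_disjoint)
    case (basic A)
    then show ?case using box by (auto simp: set_lebesgue_integral_def)
  next
    case (compl A)
    have "set_lebesgue_integral lborel (UNIV - A) h = (\<integral>x. h x - indicator A x * h x \<partial>lborel)"
      unfolding set_lebesgue_integral_def by (intro Bochner_Integration.integral_cong) (auto split: split_indicator)
    also have "\<dots> = 0"
      using compl 0 h sets[OF compl(1)] integrable_real_mult_indicator[of A lborel h]
      by (subst Bochner_Integration.integral_diff) (auto simp: set_lebesgue_integral_def mult.commute)
    finally show ?case .
  next
    case (union A)
    have "set_integrable lborel (\<Union>i. A i) h"
      unfolding set_integrable_def using h union(2) sets
      by (intro integrable_mult_indicator) (auto intro!: sets.countable_UN)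
    then show ?case
      using union sets
      by (subst lebesgue_integral_countable_add) (auto simp: disjoint_family_on_def range_subsetD)
  qed (simp add: set_lebesgue_integral_def)
qed

text \<open>Indicators of boxes are bounded pointwise limits of test functions, and boxes generate the
  Borel sets.\<close>

lemma fundamental_lemma:
  fixes \<Omega> :: "(real^'n::finite) set"
  assumes \<Omega>: "open \<Omega>" and p: "1 \<le> p" and g: "g \<in> Lp p \<Omega>"
    and 0: "\<And>\<xi>. \<xi> \<in> test_fun \<Omega> \<Longrightarrow> regular_dist \<Omega> g \<xi> = 0"
  shows "AE x in lebesgue_on \<Omega>. g x = 0"
proof -
  have local: "AE x in lborel. x \<in> box c d \<longrightarrow> g x = 0" if cd: "cbox c d \<subseteq> \<Omega>" for c d
  proof -
    \<comment> \<open>Cut off to a box to obtain an integrable function on the whole space, then pass to a Borel representative.\<close>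
    define h where "h x = indicator \<Omega> x * (g x * indicator (box c d) x)" for x
    have intg: "integrable (lebesgue_on \<Omega>) (\<lambda>x. g x * indicator (box c d) x)"
      using \<Omega> p g cd box_subset_cbox[of c d]
      by (intro integrable_Lp_mult_bounded[where K="cbox c d" and B=1 and p=p]) (auto split: split_indicator)
    then have h: "integrable lebesgue h"
      using \<Omega> by (simp add: integrable_restrict_space h_def[abs_def])
    have h_box: "(\<integral>x. indicator (box a b) x * h x \<partial>lebesgue) = 0" for a b
    proof -
      obtain a' b' where ab: "box a b \<inter> box c d = box a' b'" by (auto simp: box_Int_box)
      have "(\<integral>x. indicator (box a b) x * h x \<partial>lebesgue) = (\<integral>x. indicator \<Omega> x * (g x * indicator (box a' b') x) \<partial>lebesgue)"
        unfolding ab[symmetric] h_def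
        by (intro Bochner_Integration.integral_cong) (auto split: split_indicator)
      also have "\<dots> = (\<integral>x. g x * indicator (box a' b') x \<partial>lebesgue_on \<Omega>)"
        using \<Omega> by (simp add: integral_restrict_space)
      also have "\<dots> = 0"
      proof (cases "box a' b' = {}")
        case False
        then have "cbox a' b' = closure (box a' b')" by (simp add: closure_box)
        also have "\<dots> \<subseteq> cbox c d"
          using ab box_subset_cbox[of c d] by (intro closure_minimal) auto
        finally show ?thesis using integral_box_eq_0[OF \<Omega> p g 0] cd by blast
      qed simp
      finally show ?thesis .
    qed
    obtain h' where h': "h' \<in> borel_measurable lborel" "AE x in lborel. h x = h' x"
      using completion_ex_borel_measurable_real[of h lborel] borel_measurable_integrable[OF h] by blast
    have h'int: "(\<integral>x. f x * h x \<partial>lebesgue) = (\<integral>x. f x * h' x \<partial>lborel)" if "f \<in> borel_measurable borel" for f :: "real^'n \<Rightarrow> real"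
    proof -
      have "(\<integral>x. f x * h x \<partial>lebesgue) = (\<integral>x. f x * h' x \<partial>lebesgue)"
        using that h h'(1) AE_completion[OF h'(2)]
        by (intro integral_cong_AE borel_measurable_times)
          (auto intro: measurable_completion borel_measurable_integrable elim!: eventually_mono)
      also have "\<dots> = (\<integral>x. f x * h' x \<partial>lborel)"
        using that h'(1) by (intro integral_completion) auto
      finally show ?thesis .
    qed
    have "integrable lebesgue h'"
      using h h'(1) AE_completion[OF h'(2)]
      by (subst integrable_cong_AE[of _ _ h]) (auto intro: measurable_completion borel_measurable_integrable elim!: eventually_mono)
    then have i': "integrable lborel h'" using h'(1) by (simp add: integrable_completion)
    have "AE x in lborel. h' x = 0"
    proof (rule AE_zero_of_box_integrals[OF i'])
      show "(\<integral>x. indicator (box a b) x * h' x \<partial>lborel) = 0" for a b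
        using h'int[of "indicator (box a b)"] h_box[of a b] by simp
      have "(\<integral>x. 1 * h x \<partial>lebesgue) = (\<integral>x. indicator (box c d) x * h x \<partial>lebesgue)"
        by (intro Bochner_Integration.integral_cong) (auto simp: h_def split: split_indicator)
      then show "(\<integral>x. h' x \<partial>lborel) = 0" using h'int[of "\<lambda>_. 1"] h_box[of c d] by simp
    qed
    then show ?thesis
      using h'(2) by eventually_elim (use cd box_subset_cbox[of c d] in \<open>auto simp: h_def\<close>)
  qed
  have local': "AE x in lebesgue. x \<in> cbox c d \<longrightarrow> g x = 0" if "cbox c d \<subseteq> \<Omega>" for c d
  proof -
    have "cbox c d - box c d \<in> null_sets lebesgue"
      using negligible_frontier_interval[of c d] by (simp add: negligible_iff_null_sets)
    from AE_not_in[OF this] AE_completion[OF local[OF that]] show ?thesis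
      by eventually_elim auto
  qed
  obtain \<D> where D: "countable \<D>" "\<D> \<subseteq> Pow \<Omega>" "\<And>X. X \<in> \<D> \<Longrightarrow> \<exists>a b. X = cbox a b" "\<Union>\<D> = \<Omega>"
    by (rule open_countable_Union_open_cbox[OF \<Omega>]) (rule that)
  have "AE x in lebesgue. x \<in> X \<longrightarrow> g x = 0" if X: "X \<in> \<D>" for X
  proof -
    obtain a b where ab: "X = cbox a b" using D(3)[OF X] by blast
    have "cbox a b \<subseteq> \<Omega>" using D(2) X unfolding ab by blast
    then show ?thesis unfolding ab by (rule local')
  qed
  then have "AE x in lebesgue. \<forall>X\<in>\<D>. x \<in> X \<longrightarrow> g x = 0"
    using D(1) by (subst AE_ball_countable) auto
  then have "AE x in lebesgue. x \<in> \<Omega> \<longrightarrow> g x = 0"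
    by eventually_elim (use D(4) in auto)
  then show ?thesis
    using \<Omega> by (simp add: AE_restrict_space_iff)
qed

subsection \<open>Integration by parts\<close>

lemma test_fun_integrable:
  fixes \<xi> :: "real^'n::finite \<Rightarrow> real"
  assumes "\<xi> \<in> test_fun \<Omega>"
  shows "integrable lborel \<xi>"
proof -
  obtain K where K: "compact K" "\<And>x. x \<notin> K \<Longrightarrow> \<xi> x = 0"
    by (rule test_fun_support[OF assms]) (rule that)
  have "integrable lborel (\<lambda>x. indicator K x *\<^sub>R \<xi> x)"
    using test_fun_continuous[OF assms] K(1)
    by (intro borel_integrable_compact) (auto intro: continuous_on_subset)
  moreover have "(\<lambda>x. indicator K x *\<^sub>R \<xi> x) = \<xi>" using K(2) by (auto split: split_indicator)
  ultimately show ?thesis by simp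
qed

lemma test_fun_lipschitz:
  fixes \<xi> :: "real^'n::finite \<Rightarrow> real"
  assumes "smooth_on UNIV \<xi>" "\<And>i x. \<bar>partial_deriv i \<xi> x\<bar> \<le> B" "0 \<le> B"
  shows "\<bar>\<xi> x - \<xi> y\<bar> \<le> real CARD('n) * B * norm (x - y)"
proof -
  have D: "(\<xi> has_derivative frechet_derivative \<xi> (at x)) (at x)" for x
    by (rule has_frechet_derivative[OF smooth_on_imp_differentiable[OF assms(1)]]) simp
  have "onorm (frechet_derivative \<xi> (at x)) \<le> real CARD('n) * B" for x
  proof (rule onorm_le)
    fix v :: "real^'n"
    have lin: "linear (frechet_derivative \<xi> (at x))"
      using D by (rule has_derivative_linear)
    have "frechet_derivative \<xi> (at x) v = frechet_derivative \<xi> (at x) (\<Sum>i\<in>UNIV. v $ i *\<^sub>R axis i 1)"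
      by (simp add: basis_expansion[of v, unfolded scalar_mult_eq_scaleR])
    also have "\<dots> = (\<Sum>i\<in>UNIV. v $ i * partial_deriv i \<xi> x)"
      by (simp add: linear_sum[OF lin] linear_cmul[OF lin] partial_deriv_def)
    also have "\<bar>\<dots>\<bar> \<le> (\<Sum>i\<in>(UNIV::'n set). norm v * B)"
      by (intro order_trans[OF sum_abs] sum_mono)
        (simp add: abs_mult mult_mono component_le_norm_cart assms)
    finally show "norm (frechet_derivative \<xi> (at x) v) \<le> real CARD('n) * B * norm v"
      by (simp add: mult_ac)
  qed
  then show ?thesis
    using differentiable_bound[of UNIV \<xi> "\<lambda>x. frechet_derivative \<xi> (at x)" "real CARD('n) * B" x y] D
    by (simp add: real_norm_def)
qed

text \<open>The integral of a difference quotient vanishes by translation invariance, and the difference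
  quotients converge boundedly on a bounded set.\<close>

lemma integral_partial_deriv:
  fixes \<xi> :: "real^'n::finite \<Rightarrow> real"
  assumes \<xi>: "\<xi> \<in> test_fun UNIV"
  shows "(\<integral>x. partial_deriv i \<xi> x \<partial>lborel) = 0"
proof -
  let ?e = "axis i 1 :: real^'n"
  define t where "t j = inverse (real (Suc j))" for j
  have t: "0 < t j" "t j \<le> 1" for j by (auto simp: t_def inverse_le_1_iff)
  obtain K where K: "compact K" "\<And>x. x \<notin> K \<Longrightarrow> \<xi> x = 0"
    by (rule test_fun_support[OF \<xi>]) (rule that)
  obtain r where r: "\<And>x. x \<in> K \<Longrightarrow> norm x \<le> r"
    using compact_imp_bounded[OF K(1)] unfolding bounded_iff by blast
  have "\<exists>B. \<forall>i. 0 \<le> B i \<and> (\<forall>x. \<bar>partial_deriv i \<xi> x\<bar> \<le> B i)"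
    by (intro choice allI) (metis test_fun_bounded[OF test_fun_partial_deriv[OF \<xi>]] less_imp_le)
  then obtain B where B: "\<And>i. 0 \<le> B i" "\<And>i x. \<bar>partial_deriv i \<xi> x\<bar> \<le> B i" by blast
  define L where "L = (\<Sum>i\<in>UNIV. B i)"
  have BL: "B i \<le> L" for i unfolding L_def using B(1) by (intro member_le_sum) auto
  have L0: "L \<ge> 0" unfolding L_def using B(1) by (simp add: sum_nonneg)
  have lip: "\<bar>\<xi> x - \<xi> y\<bar> \<le> real CARD('n) * L * norm (x - y)" for x y
    by (rule test_fun_lipschitz[OF test_fun_smooth[OF \<xi>] order_trans[OF B(2) BL] L0])
  have meas: "(\<lambda>x. \<xi> (x + c)) \<in> borel_measurable borel" for c
    using test_fun_borel[OF \<xi>] by measurable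
  note bm = test_fun_borel[OF \<xi>]
  note intx = test_fun_integrable[OF \<xi>]
  have trans: "integrable lborel (\<lambda>x. \<xi> (x + c))" "(\<integral>x. \<xi> (x + c) \<partial>lborel) = (\<integral>x. \<xi> x \<partial>lborel)" for c
  proof -
    have "integrable (distr lborel borel ((+) c)) \<xi>" using intx by (simp add: lborel_distr_plus)
    then show "integrable lborel (\<lambda>x. \<xi> (x + c))"
      using bm by (subst (asm) integrable_distr_eq) (auto simp: add.commute)
    have "(\<integral>x. \<xi> x \<partial>lborel) = (\<integral>x. \<xi> x \<partial>distr lborel borel ((+) c))" by (simp add: lborel_distr_plus)
    also have "\<dots> = (\<integral>x. \<xi> (c + x) \<partial>lborel)" using bm by (intro integral_distr) auto
    finally show "(\<integral>x. \<xi> (x + c) \<partial>lborel) = (\<integral>x. \<xi> x \<partial>lborel)" by (simp add: add.commute)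
  qed
  let ?q = "\<lambda>j x. (\<xi> (x + t j *\<^sub>R ?e) - \<xi> x) / t j"
  have "(\<lambda>j. \<integral>x. ?q j x \<partial>lborel) \<longlonglongrightarrow> (\<integral>x. partial_deriv i \<xi> x \<partial>lborel)"
  proof (rule integral_dominated_convergence)
    show "partial_deriv i \<xi> \<in> borel_measurable lborel"
      using test_fun_continuous[OF test_fun_partial_deriv[OF \<xi>]] by (simp add: borel_measurable_continuous_onI)
    show "?q j \<in> borel_measurable lborel" for j using meas bm by measurable
    show "integrable lborel (\<lambda>x. indicator (cball 0 (r + 1)) x *\<^sub>R (real CARD('n) * L))"
      by (intro borel_integrable_compact) auto
    show "AE x in lborel. (\<lambda>j. ?q j x) \<longlonglongrightarrow> partial_deriv i \<xi> x"
    proof (intro AE_I2)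
      fix x
      have "((\<lambda>s. x + s *\<^sub>R ?e) has_derivative (\<lambda>s. s *\<^sub>R ?e)) (at 0)"
        by (auto intro!: derivative_eq_intros)
      moreover have d: "\<xi> differentiable (at x)"
        by (rule smooth_on_imp_differentiable[OF test_fun_smooth[OF \<xi>]]) simp
      ultimately have "((\<lambda>s. \<xi> (x + s *\<^sub>R ?e)) has_derivative (\<lambda>s. frechet_derivative \<xi> (at x) (s *\<^sub>R ?e))) (at 0)"
        using has_derivative_compose[of "\<lambda>s. x + s *\<^sub>R ?e" "\<lambda>s. s *\<^sub>R ?e" 0 UNIV \<xi>] has_frechet_derivative[OF d] by simp
      then have "((\<lambda>s. \<xi> (x + s *\<^sub>R ?e)) has_real_derivative partial_deriv i \<xi> x) (at 0)"
        using linear_cmul[OF linear_frechet_derivative[OF d]]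
        by (simp add: has_field_derivative_def partial_deriv_def mult.commute[of _ "frechet_derivative _ _ _"])
      then have "((\<lambda>s. (\<xi> (x + s *\<^sub>R ?e) - \<xi> x) / s) \<longlongrightarrow> partial_deriv i \<xi> x) (at 0)"
        by (simp add: DERIV_def)
      moreover have "filterlim t (at 0) sequentially"
        unfolding filterlim_at t_def using LIMSEQ_inverse_real_of_nat by (auto simp: LIMSEQ_inverse_real_of_nat)
      ultimately show "(\<lambda>j. ?q j x) \<longlonglongrightarrow> partial_deriv i \<xi> x" by (rule filterlim_compose)
    qed
    show "AE x in lborel. norm (?q j x) \<le> indicator (cball 0 (r + 1)) x *\<^sub>R (real CARD('n) * L)" for j
    proof (intro AE_I2)
      fix x
      show "norm (?q j x) \<le> indicator (cball 0 (r + 1)) x *\<^sub>R (real CARD('n) * L)"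
      proof (cases "x \<in> cball 0 (r + 1)")
        case True
        have "\<bar>\<xi> (x + t j *\<^sub>R ?e) - \<xi> x\<bar> \<le> real CARD('n) * L * t j"
          using lip[of "x + t j *\<^sub>R ?e" x] t[of j] by simp
        then show ?thesis using t[of j] True by (simp add: divide_le_eq)
      next
        case False
        then have "norm x > r + 1" by simp
        moreover have "norm x \<le> norm (x + t j *\<^sub>R ?e) + t j"
          using norm_triangle_ineq4[of "x + t j *\<^sub>R ?e" "t j *\<^sub>R ?e"] t[of j] by simp
        ultimately have "x \<notin> K" "x + t j *\<^sub>R ?e \<notin> K" using r[of x] r[of "x + t j *\<^sub>R ?e"] t[of j] by force+
        then show ?thesis using K(2) False by simp
      qed
    qed
  qed
  moreover have "(\<lambda>j. \<integral>x. ?q j x \<partial>lborel) = (\<lambda>j. 0)"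
    using trans intx by simp
  ultimately have "(\<lambda>j::nat. 0) \<longlonglongrightarrow> (\<integral>x. partial_deriv i \<xi> x \<partial>lborel)" by simp
  then show ?thesis by (simp add: LIMSEQ_const_iff)
qed

lemma integral_by_parts:
  fixes \<xi> \<zeta> :: "real^'n::finite \<Rightarrow> real"
  assumes "\<xi> \<in> test_fun UNIV" "\<zeta> \<in> test_fun UNIV"
  shows "(\<integral>x. partial_deriv i \<xi> x * \<zeta> x \<partial>lborel) = - (\<integral>x. \<xi> x * partial_deriv i \<zeta> x \<partial>lborel)"
proof -
  have "(\<integral>x. partial_deriv i (\<lambda>x. \<xi> x * \<zeta> x) x \<partial>lborel) = 0"
    by (intro integral_partial_deriv test_fun_mult test_fun_smooth[OF assms(2)] assms(1))
  also have "partial_deriv i (\<lambda>x. \<xi> x * \<zeta> x) = (\<lambda>x. partial_deriv i \<xi> x * \<zeta> x + \<xi> x * partial_deriv i \<zeta> x)"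
    by (intro ext partial_deriv_mult[OF test_fun_smooth test_fun_smooth, OF assms]) simp
  also have "(\<integral>x. partial_deriv i \<xi> x * \<zeta> x + \<xi> x * partial_deriv i \<zeta> x \<partial>lborel) =
      (\<integral>x. partial_deriv i \<xi> x * \<zeta> x \<partial>lborel) + (\<integral>x. \<xi> x * partial_deriv i \<zeta> x \<partial>lborel)"
    by (intro Bochner_Integration.integral_add test_fun_integrable[where \<Omega>=UNIV] test_fun_mult[OF test_fun_partial_deriv[OF assms(1)] test_fun_smooth[OF assms(2)]]
        test_fun_mult[OF assms(1) test_fun_smooth[OF test_fun_partial_deriv[OF assms(2)]]])
  finally show ?thesis by linarith
qed

text \<open>Each integration by parts moves the outermost derivative, hence the reversal of the list.\<close>

lemma integral_by_parts_list:
  fixes \<xi> \<zeta> :: "real^'n::finite \<Rightarrow> real"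
  assumes "\<xi> \<in> test_fun UNIV" "\<zeta> \<in> test_fun UNIV"
  shows "(\<integral>x. foldr partial_deriv is \<xi> x * \<zeta> x \<partial>lborel) =
    (- 1) ^ length is * (\<integral>x. \<xi> x * foldr partial_deriv (rev is) \<zeta> x \<partial>lborel)"
  using assms(2)
proof (induction "is" arbitrary: \<zeta>)
  case (Cons i "is")
  have "(\<integral>x. foldr partial_deriv (i # is) \<xi> x * \<zeta> x \<partial>lborel) =
      - (\<integral>x. foldr partial_deriv is \<xi> x * partial_deriv i \<zeta> x \<partial>lborel)"
    using integral_by_parts[OF test_fun_foldr_partial_deriv[OF assms(1)] Cons.prems, of i "is"] by simp
  also have "\<dots> = - ((- 1) ^ length is * (\<integral>x. \<xi> x * foldr partial_deriv (rev is) (partial_deriv i \<zeta>) x \<partial>lborel))"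
    by (simp only: Cons.IH[OF test_fun_partial_deriv[OF Cons.prems]])
  finally show ?case by simp
qed simp

lemma regular_dist_eq_lborel:
  assumes "open \<Omega>" "f \<in> borel_measurable borel" "\<xi> \<in> test_fun \<Omega>"
  shows "regular_dist \<Omega> f \<xi> = (\<integral>x. f x * \<xi> x \<partial>lborel)"
proof -
  note m = test_fun_borel[OF assms(3)]
  have "regular_dist \<Omega> f \<xi> = (\<integral>x. indicator \<Omega> x *\<^sub>R (f x * \<xi> x) \<partial>lebesgue)"
    unfolding regular_dist_def using assms(1) by (intro integral_restrict_space) simp
  also have "\<dots> = (\<integral>x. f x * \<xi> x \<partial>lebesgue)"
  proof -
    obtain K where "K \<subseteq> \<Omega>" "\<And>x. x \<notin> K \<Longrightarrow> \<xi> x = 0"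
      by (rule test_fun_support[OF assms(3)]) (rule that)
    then show ?thesis by (intro Bochner_Integration.integral_cong) (auto split: split_indicator)
  qed
  also have "\<dots> = (\<integral>x. f x * \<xi> x \<partial>lborel)"
    using assms(2) m by (intro integral_completion) auto
  finally show ?thesis .
qed

text \<open>The reversed list has the same counts as the original one, so that by symmetry of the derivatives
the classical partial derivative satisfies the definition of the weak one.\<close>

lemma weak_deriv_partials:
  assumes "open \<Omega>" "\<xi> \<in> test_fun \<Omega>"
  shows "weak_deriv \<Omega> \<nu> \<xi> (partials \<nu> \<xi>)"
  unfolding weak_deriv_def
proof
  fix \<zeta> assume \<zeta>: "\<zeta> \<in> test_fun \<Omega>"
  obtain "is" where "is": "partials \<nu> = foldr partial_deriv is" "count_list is = \<nu>" "length is = mi_order \<nu>"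
    by (rule partials_obtain_list) (rule that)
  note bm = test_fun_borel
  have U: "\<eta> \<in> test_fun UNIV" if "\<eta> \<in> test_fun \<Omega>" for \<eta>
    using test_fun_mono[of \<Omega> UNIV] that by auto
  have "regular_dist \<Omega> (partials \<nu> \<xi>) \<zeta> = (\<integral>x. foldr partial_deriv is \<xi> x * \<zeta> x \<partial>lborel)"
    unfolding "is"(1)[symmetric]
    by (rule regular_dist_eq_lborel[OF assms(1) bm[OF test_fun_partials[OF assms(2)]] \<zeta>])
  also have "\<dots> = (- 1) ^ mi_order \<nu> * (\<integral>x. \<xi> x * foldr partial_deriv (rev is) \<zeta> x \<partial>lborel)"
    using integral_by_parts_list[OF U U, OF assms(2) \<zeta>] by (simp add: "is")
  also have "foldr partial_deriv (rev is) \<zeta> = partials \<nu> \<zeta>"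
    unfolding "is"(1) by (intro ext foldr_partial_deriv_mset[OF open_UNIV test_fun_smooth[OF \<zeta>]]) auto
  also have "(\<integral>x. \<xi> x * partials \<nu> \<zeta> x \<partial>lborel) = regular_dist \<Omega> \<xi> (partials \<nu> \<zeta>)"
    by (rule regular_dist_eq_lborel[symmetric, OF assms(1) bm[OF assms(2)] test_fun_partials[OF \<zeta>]])
  finally show "regular_dist \<Omega> (partials \<nu> \<xi>) \<zeta> = (- 1) ^ mi_order \<nu> * regular_dist \<Omega> \<xi> (partials \<nu> \<zeta>)" .
qed

section \<open>The Slobodeckij seminorm\<close>

text \<open>The seminorm is an \<open>L\<^sup>p\<close> norm on \<open>\<Omega> \<times> \<Omega>\<close> of a function that is
  linear in \<open>g\<close>, so that the results on \<open>L\<^sup>p\<close> norms apply to it.\<close>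

definition diff_quot :: "real \<Rightarrow> (real^'n::finite \<Rightarrow> real) \<Rightarrow> (real^'n) \<times> (real^'n) \<Rightarrow> real" where
  "diff_quot s g z = (g (fst z) - g (snd z)) * norm (fst z - snd z) powr (- s)"

lemma abs_diff_quot_powr:
  fixes g :: "real^'n::finite \<Rightarrow> real"
  assumes "0 < p"
  shows "\<bar>diff_quot (e / p) g z\<bar> powr p = \<bar>g (fst z) - g (snd z)\<bar> powr p / norm (fst z - snd z) powr e"
proof -
  have "(norm (fst z - snd z) powr (- (e / p))) powr p = inverse (norm (fst z - snd z) powr e)"
    using assms by (simp add: powr_powr flip: powr_minus)
  then show ?thesis by (simp add: diff_quot_def abs_mult powr_mult divide_inverse)
qed

lemma slobodeckij_eq_pnorm:
  fixes \<Omega> :: "(real^'n::finite) set"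
  assumes "0 < p"
  shows "slobodeckij_seminorm \<theta> p \<Omega> g =
    pnorm p (lebesgue_on \<Omega> \<Otimes>\<^sub>M lebesgue_on \<Omega>) (diff_quot ((real CARD('n) + \<theta> * p) / p) g)"
  by (simp only: slobodeckij_seminorm_def pnorm_def abs_diff_quot_powr[OF assms])

lemma diff_quot_measurable:
  fixes \<Omega> :: "(real^'n::finite) set"
  assumes "g \<in> borel_measurable (lebesgue_on \<Omega>)"
  shows "diff_quot s g \<in> borel_measurable (lebesgue_on \<Omega> \<Otimes>\<^sub>M lebesgue_on \<Omega>)"
proof -
  let ?P = "lebesgue_on \<Omega> \<Otimes>\<^sub>M lebesgue_on \<Omega>"
  have id: "(\<lambda>x. x) \<in> borel_measurable (lebesgue_on \<Omega>)"
    by (intro borel_measurable_lebesgue_on) simp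
  have [measurable]: "(\<lambda>z. g (fst z)) \<in> borel_measurable ?P" "(\<lambda>z. g (snd z)) \<in> borel_measurable ?P"
    "(\<lambda>z. fst z) \<in> borel_measurable ?P" "(\<lambda>z. snd z) \<in> borel_measurable ?P"
    using measurable_compose[OF measurable_fst assms] measurable_compose[OF measurable_snd assms]
      measurable_compose[OF measurable_fst id] measurable_compose[OF measurable_snd id] by auto
  show ?thesis unfolding diff_quot_def[abs_def] by measurable
qed

text \<open>A null set times the whole space is a null set of the product.\<close>

lemma AE_pair_components:
  assumes "sigma_finite_measure M" "AE x in M. P x"
  shows "AE z in M \<Otimes>\<^sub>M M. P (fst z) \<and> P (snd z)"
proof -
  interpret M: sigma_finite_measure M by fact
  obtain N where N: "N \<in> null_sets M" "{x \<in> space M. \<not> P x} \<subseteq> N"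
    using assms(2) unfolding eventually_ae_filter by auto
  have "N \<times> space M \<in> null_sets (M \<Otimes>\<^sub>M M)" "space M \<times> N \<in> null_sets (M \<Otimes>\<^sub>M M)"
    using N(1) by (auto simp: null_sets_def M.emeasure_pair_measure_Times)
  then have "N \<times> space M \<union> space M \<times> N \<in> null_sets (M \<Otimes>\<^sub>M M)" by (rule null_sets.Un)
  then show ?thesis
    by (rule AE_I') (use N(2) in \<open>auto simp: space_pair_measure\<close>)
qed

lemma slobodeckij_cong_AE:
  fixes \<Omega> :: "(real^'n::finite) set"
  assumes "open \<Omega>" "0 < p" "AE x in lebesgue_on \<Omega>. f x = g x"
  shows "slobodeckij_seminorm \<theta> p \<Omega> f = slobodeckij_seminorm \<theta> p \<Omega> g"
  unfolding slobodeckij_eq_pnorm[OF assms(2)]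
proof (rule pnorm_cong_AE[OF assms(2)])
  show "AE z in lebesgue_on \<Omega> \<Otimes>\<^sub>M lebesgue_on \<Omega>.
      diff_quot ((real CARD('n) + \<theta> * p) / p) f z = diff_quot ((real CARD('n) + \<theta> * p) / p) g z"
    using AE_pair_components[OF sigma_finite_lebesgue_on[OF assms(1)] assms(3)]
    by eventually_elim (simp add: diff_quot_def)
qed

lemma slobodeckij_cmult:
  fixes \<Omega> :: "(real^'n::finite) set"
  assumes "0 < p" "g \<in> borel_measurable (lebesgue_on \<Omega>)"
  shows "slobodeckij_seminorm \<theta> p \<Omega> (\<lambda>x. c * g x) = ennreal \<bar>c\<bar> * slobodeckij_seminorm \<theta> p \<Omega> g"
proof -
  have "diff_quot s (\<lambda>x. c * g x) = (\<lambda>z. c * diff_quot s g z)" for s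
    by (auto simp: diff_quot_def algebra_simps)
  then show ?thesis
    unfolding slobodeckij_eq_pnorm[OF assms(1)]
    by (simp add: pnorm_cmult[OF assms(1) diff_quot_measurable[OF assms(2)]])
qed

lemma slobodeckij_suminf:
  fixes \<Omega> :: "(real^'n::finite) set"
  assumes \<Omega>: "open \<Omega>" and p: "1 \<le> p" and h: "\<And>k. h k \<in> borel_measurable (lebesgue_on \<Omega>)"
    and sm: "AE x in lebesgue_on \<Omega>. summable (\<lambda>k. h k x)"
    and fin: "(\<Sum>k. slobodeckij_seminorm \<theta> p \<Omega> (h k)) < top"
  shows "slobodeckij_seminorm \<theta> p \<Omega> (\<lambda>x. \<Sum>k. h k x) \<le> (\<Sum>k. slobodeckij_seminorm \<theta> p \<Omega> (h k))"
proof -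
  have p0: "0 < p" using p by simp
  let ?s = "(real CARD('n) + \<theta> * p) / p" and ?P = "lebesgue_on \<Omega> \<Otimes>\<^sub>M lebesgue_on \<Omega>"
  note fin' = fin[unfolded slobodeckij_eq_pnorm[OF p0]]
  have "AE z in ?P. \<bar>diff_quot ?s (\<lambda>x. \<Sum>k. h k x) z\<bar> \<le> (\<Sum>k. \<bar>diff_quot ?s (h k) z\<bar>)"
    using AE_pair_components[OF sigma_finite_lebesgue_on[OF \<Omega>] sm]
      AE_summable_of_pnorm[OF p diff_quot_measurable[OF h] fin']
  proof eventually_elim
    case (elim z)
    then have "diff_quot ?s (\<lambda>x. \<Sum>k. h k x) z = (\<Sum>k. diff_quot ?s (h k) z)"
      unfolding diff_quot_def by (simp add: suminf_diff suminf_mult2 summable_diff)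
    then show ?case using summable_rabs[OF elim(2)] by simp
  qed
  then show ?thesis
    unfolding slobodeckij_eq_pnorm[OF p0]
    by (rule pnorm_le_suminf[OF p diff_quot_measurable[OF h] fin'])
qed

subsection \<open>Smooth functions of compact support have finite seminorm\<close>

text \<open>The kernel left after estimating the difference quotient of a bounded Lipschitz function. It is
  integrable because it behaves like \<open>|u|\<close> to the power \<open>(1 - \<theta>)p - n\<close> near the
  origin and like \<open>|u|\<close> to the power \<open>-n - \<theta>p\<close> at infinity; both estimates sum up over
  dyadic shells.\<close>

definition slob_kernel :: "real \<Rightarrow> real \<Rightarrow> real^'n::finite \<Rightarrow> real" where
  "slob_kernel \<theta> p u = min 2 (norm u) powr p / norm u powr (real CARD('n) + \<theta> * p)"

lemma slob_kernel_nonneg: "0 \<le> slob_kernel \<theta> p u"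
  by (simp add: slob_kernel_def)

lemma slob_kernel_minus: "slob_kernel \<theta> p (- u) = slob_kernel \<theta> p u"
  by (simp add: slob_kernel_def)

lemma slob_kernel_measurable [measurable]: "slob_kernel \<theta> p \<in> borel_measurable borel"
  unfolding slob_kernel_def[abs_def] by measurable

lemma dyadic_small:
  fixes r :: real
  assumes "0 < r" "r \<le> 1"
  obtains k :: nat where "(1 / 2) ^ Suc k < r" "r \<le> (1 / 2) ^ k"
proof -
  have ex: "\<exists>k. (1 / 2) ^ Suc k < r"
  proof -
    obtain k where "(1 / 2) ^ k < r" using real_arch_pow_inv[OF assms(1), of "1 / 2"] by auto
    moreover have "(1 / 2 :: real) ^ Suc k \<le> (1 / 2) ^ k" by simp
    ultimately show ?thesis by (intro exI[of _ k]) linarith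
  qed
  define k where "k = (LEAST k. (1 / 2) ^ Suc k < r)"
  have "(1 / 2) ^ Suc k < r" unfolding k_def by (rule LeastI_ex[OF ex])
  moreover have "r \<le> (1 / 2) ^ k"
  proof (cases k)
    case (Suc j)
    then have "\<not> (1 / 2) ^ Suc j < r" using not_less_Least[of j "\<lambda>k. (1 / 2) ^ Suc k < r"] k_def by simp
    then show ?thesis using Suc by simp
  qed (use assms in simp)
  ultimately show thesis by (rule that)
qed

lemma dyadic_large:
  fixes r :: real
  assumes "1 < r"
  obtains k :: nat where "2 ^ k \<le> r" "r < 2 ^ Suc k"
proof -
  have ex: "\<exists>k. r < 2 ^ Suc k"
  proof -
    obtain k where "r < 2 ^ k" using real_arch_pow[of 2 r] by auto
    moreover have "(2 :: real) ^ k \<le> 2 ^ Suc k" by simp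
    ultimately show ?thesis by (intro exI[of _ k]) linarith
  qed
  define k where "k = (LEAST k. r < 2 ^ Suc k)"
  have "r < 2 ^ Suc k" unfolding k_def by (rule LeastI_ex[OF ex])
  moreover have "2 ^ k \<le> r"
  proof (cases k)
    case (Suc j)
    then have "\<not> r < 2 ^ Suc j" using not_less_Least[of j "\<lambda>k. r < 2 ^ Suc k"] k_def by simp
    then show ?thesis using Suc by simp
  qed (use assms in simp)
  ultimately show thesis using that by blast
qed

lemma ennreal_term_le_suminf: "f k \<le> (\<Sum>k. f k :: ennreal)"
  using sum_le_suminf[OF summableI, of "{k}" f] by simp

lemma slob_kernel_integrable:
  assumes p: "1 \<le> p" and \<theta>: "0 < \<theta>" "\<theta> < 1"
  shows "(\<integral>\<^sup>+u. ennreal (slob_kernel \<theta> p (u :: real^'n::finite)) \<partial>lborel) < top"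
proof -
  let ?n = "CARD('n)"
  define e where "e = real ?n + \<theta> * p"
  define V where "V = unit_ball_vol (real ?n)"
  define a where "a = (1 - \<theta>) * p"
  define c where "c k = ((1 / 2) ^ k :: real) powr p * ((1 / 2) ^ Suc k) powr (- e)" for k :: nat
  define d where "d k = 2 powr p * ((2::real) ^ k) powr (- e)" for k :: nat
  have e: "e > 0" using \<theta> p by (simp add: e_def add_nonneg_pos)
  have V: "V \<ge> 0" by (simp add: V_def)
  have cd: "c k \<ge> 0" "d k \<ge> 0" for k by (auto simp: c_def d_def)
  have decay: "norm u powr (- e) \<le> r powr (- e)" if "0 < r" "r \<le> norm u" for r and u :: "real^'n"
    using that e by (intro powr_mono2') auto
  have pt: "ennreal (slob_kernel \<theta> p u) \<le>
      (\<Sum>k. ennreal (c k) * indicator (cball 0 ((1 / 2) ^ k)) u) +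
      (\<Sum>k. ennreal (d k) * indicator (cball 0 (2 ^ Suc k)) u)" for u :: "real^'n"
  proof (cases "u = 0")
    case True
    then show ?thesis by (simp add: slob_kernel_def)
  next
    case False
    have sk: "slob_kernel \<theta> p u = min 2 (norm u) powr p * norm u powr (- e)"
      by (simp add: slob_kernel_def e_def[symmetric] powr_minus divide_inverse)
    show ?thesis
    proof (cases "norm u \<le> 1")
      case True
      obtain k :: nat where k: "(1 / 2) ^ Suc k < norm u" "norm u \<le> (1 / 2) ^ k"
        using dyadic_small[of "norm u"] False True by auto
      have "slob_kernel \<theta> p u \<le> c k"
        unfolding sk c_def using k p by (intro mult_mono powr_mono2 decay) auto
      then have "ennreal (slob_kernel \<theta> p u) \<le> ennreal (c k) * indicator (cball 0 ((1 / 2) ^ k)) u"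
        using k by (simp add: ennreal_leI)
      also have "\<dots> \<le> (\<Sum>k. ennreal (c k) * indicator (cball 0 ((1 / 2) ^ k)) u)"
        by (rule ennreal_term_le_suminf)
      finally show ?thesis by (rule order_trans) simp
    next
      case False
      obtain k :: nat where k: "2 ^ k \<le> norm u" "norm u < 2 ^ Suc k"
        using dyadic_large[of "norm u"] False by auto
      have "slob_kernel \<theta> p u \<le> d k"
        unfolding sk d_def using k p by (intro mult_mono powr_mono2 decay) auto
      then have "ennreal (slob_kernel \<theta> p u) \<le> ennreal (d k) * indicator (cball 0 (2 ^ Suc k)) u"
        using k by (simp add: ennreal_leI)
      also have "\<dots> \<le> (\<Sum>k. ennreal (d k) * indicator (cball 0 (2 ^ Suc k)) u)"
        by (rule ennreal_term_le_suminf)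
      finally show ?thesis by (rule order_trans) simp
    qed
  qed
  have [measurable]: "(\<lambda>u. ennreal w * indicator (cball 0 r) u) \<in> borel_measurable (borel :: (real^'n) measure)"
    for w r by (intro borel_measurable_times_ennreal borel_measurable_indicator) auto
  have meas: "(\<lambda>u. \<Sum>k. ennreal (w k) * indicator (cball 0 (r k)) u) \<in> borel_measurable (lborel :: (real^'n) measure)"
    for w r :: "nat \<Rightarrow> real" by measurable
  have int: "(\<integral>\<^sup>+u. (\<Sum>k. ennreal (w k) * indicator (cball 0 (r k)) u) \<partial>(lborel :: (real^'n) measure)) =
      (\<Sum>k. ennreal (w k * (V * r k ^ ?n)))" if "\<And>k. 0 \<le> r k" "\<And>k. 0 \<le> w k" for r w :: "nat \<Rightarrow> real"
    using that V
    by (subst nn_integral_suminf)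
      (auto simp: nn_integral_cmult_indicator emeasure_cball V_def ennreal_mult
        intro!: borel_measurable_times_ennreal borel_measurable_indicator)
  have pw: "(b ^ k) powr x = b powr (real k * x)" "(b ^ k) ^ j = b powr (real k * real j)"
    if "b > 0" for b x :: real and k j :: nat
    using that by (simp_all add: powr_realpow[symmetric] powr_powr powr_mult flip: power_mult)
  have c_geo: "c k * (V * ((1 / 2) ^ k) ^ ?n) = (2 powr e * V) * ((1 / 2) powr a) ^ k" for k
  proof -
    have "c k * ((1 / 2) ^ k) ^ ?n = (1 / 2) powr (real k * p) * (1 / 2) powr (- e * real (Suc k)) * (1 / 2) powr (real k * real ?n)"
      unfolding c_def by (simp add: pw mult_ac del: power_Suc)
    also have "\<dots> = (1 / 2) powr (- e + a * real k)"
      by (simp add: powr_add[symmetric] e_def a_def algebra_simps)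
    also have "\<dots> = 2 powr e * ((1 / 2) powr a) ^ k"
    proof -
      have "(1 / 2 :: real) powr (- e) = 2 powr e" by (simp add: powr_minus powr_divide divide_simps)
      moreover have "(1 / 2 :: real) powr (a * real k) = ((1 / 2) powr a) ^ k"
        by (simp add: powr_powr[symmetric] powr_realpow)
      ultimately show ?thesis by (simp only: powr_add)
    qed
    finally show ?thesis by (simp add: mult_ac)
  qed
  have d_geo: "d k * (V * (2 ^ Suc k) ^ ?n) = (2 powr p * 2 ^ ?n * V) * (2 powr (- (\<theta> * p))) ^ k" for k
  proof -
    have "((2::real) ^ k) powr (- e) * (2 ^ k) ^ ?n = 2 powr (- e * real k) * 2 powr (real k * real ?n)"
      by (simp add: pw mult_ac)
    also have "\<dots> = 2 powr (- (\<theta> * p) * real k)"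
      by (simp add: powr_add[symmetric] e_def algebra_simps)
    also have "\<dots> = (2 powr (- (\<theta> * p))) ^ k"
      by (simp add: powr_realpow[symmetric] powr_powr)
    finally show ?thesis by (simp add: d_def power_mult_distrib mult_ac)
  qed
  have geo: "(\<Sum>k. ennreal (x * y ^ k)) < top" if "0 \<le> x" "0 \<le> y" "y < 1" for x y :: real
  proof -
    have "(\<lambda>k. x * y ^ k) sums (x * (1 / (1 - y)))"
      using that by (intro sums_mult geometric_sums) auto
    then have "(\<Sum>k. ennreal (x * y ^ k)) = ennreal (x * (1 / (1 - y)))"
      using that by (intro suminf_ennreal_eq) auto
    then show ?thesis by simp
  qed
  have "(\<integral>\<^sup>+u. ennreal (slob_kernel \<theta> p (u :: real^'n)) \<partial>lborel) \<le>
      (\<integral>\<^sup>+u. (\<Sum>k. ennreal (c k) * indicator (cball 0 ((1 / 2) ^ k)) u) +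
        (\<Sum>k. ennreal (d k) * indicator (cball 0 (2 ^ Suc k)) u) \<partial>(lborel :: (real^'n) measure))"
    by (intro nn_integral_mono pt)
  also have "\<dots> = (\<Sum>k. ennreal (c k * (V * ((1 / 2) ^ k) ^ ?n))) + (\<Sum>k. ennreal (d k * (V * (2 ^ Suc k) ^ ?n)))"
    using cd by (subst nn_integral_add[OF meas meas]) (simp add: int del: power_Suc)
  also have "\<dots> = (\<Sum>k. ennreal ((2 powr e * V) * ((1 / 2) powr a) ^ k)) +
      (\<Sum>k. ennreal ((2 powr p * 2 ^ ?n * V) * (2 powr (- (\<theta> * p))) ^ k))"
    by (simp only: c_geo d_geo)
  also have "\<dots> < top"
  proof -
    have "a > 0" using \<theta> p by (simp add: a_def)
    then have "(2 :: real) powr (- a) < 1" using powr_less_mono[of "- a" 0 2] by simp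
    moreover have "(1 / 2 :: real) powr a = 2 powr (- a)" by (simp add: powr_divide powr_minus_divide)
    ultimately have "(1 / 2 :: real) powr a < 1" by (simp only:)
    then have 1: "(\<Sum>k. ennreal ((2 powr e * V) * ((1 / 2) powr a) ^ k)) < top"
      using V by (intro geo) auto
    have "(2 :: real) powr (- (\<theta> * p)) < 1"
      using \<theta> p powr_less_mono[of "- (\<theta> * p)" 0 2] by simp
    then have 2: "(\<Sum>k. ennreal ((2 powr p * 2 ^ ?n * V) * (2 powr (- (\<theta> * p))) ^ k)) < top"
      using V by (intro geo) auto
    show ?thesis using 1 2 unfolding ennreal_add_less_top by (rule conjI)
  qed
  finally show ?thesis .
qed

text \<open>The integrand vanishes unless one of the two points lies in \<open>K\<close>. By the two
bounds on \<open>g\<close> it is at most \<open>L powr p\<close> times the kernel of the difference, whose integral over one of the points does not depend on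
the other, so that Fubini's theorem leaves twice the measure of \<open>K\<close> times the integral of the kernel.\<close>

lemma slobodeckij_lipschitz_bound:
  fixes K \<Omega> :: "(real^'n::finite) set"
  assumes \<Omega>: "open \<Omega>" and K: "compact K" and p: "1 \<le> p" and \<theta>: "0 < \<theta>" "\<theta> < 1"
  obtains C where "C \<ge> 0" "\<And>g L. \<lbrakk>g \<in> borel_measurable borel; 0 \<le> L; \<And>x. \<bar>g x\<bar> \<le> L;
      \<And>x y. \<bar>g x - g y\<bar> \<le> L * norm (x - y); \<And>x. x \<notin> K \<Longrightarrow> g x = 0\<rbrakk>
    \<Longrightarrow> slobodeckij_seminorm \<theta> p \<Omega> g \<le> ennreal (C * L)"
proof -
  define W where "W = enn2real (\<integral>\<^sup>+u. ennreal (slob_kernel \<theta> p (u :: real^'n)) \<partial>lborel)"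
  have W: "(\<integral>\<^sup>+u. ennreal (slob_kernel \<theta> p (u :: real^'n)) \<partial>lborel) = ennreal W" "W \<ge> 0"
    using slob_kernel_integrable[OF p \<theta>, where 'n='n] by (auto simp: W_def less_top)
  define \<kappa> where "\<kappa> = measure lborel K"
  have Kb [measurable]: "K \<in> sets borel" using K by (rule borel_compact)
  have \<kappa>: "emeasure lborel K = ennreal \<kappa>" "\<kappa> \<ge> 0"
    using emeasure_compact_finite[OF K] by (auto simp: \<kappa>_def emeasure_eq_ennreal_measure less_top)
  define C where "C = (2 * \<kappa> * W) powr (1 / p)"
  let ?w = "\<lambda>u. ennreal (slob_kernel \<theta> p (u :: real^'n))"
  have W1: "(\<integral>\<^sup>+y. ?w (x - y) \<partial>lborel) = ennreal W" for x
  proof -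
    have "ennreal W = (\<integral>\<^sup>+u. ?w u \<partial>distr lborel borel ((+) (- x)))" by (simp add: lborel_distr_plus W)
    also have "\<dots> = (\<integral>\<^sup>+y. ?w (- x + y) \<partial>lborel)" by (subst nn_integral_distr) auto
    also have "\<dots> = (\<integral>\<^sup>+y. ?w (x - y) \<partial>lborel)"
      using slob_kernel_minus[of \<theta> p "x - _"] by (intro nn_integral_cong) (simp flip: slob_kernel_minus[of \<theta> p "x - _"])
    finally show ?thesis by simp
  qed
  have pair: "(\<integral>\<^sup>+x. \<integral>\<^sup>+y. (indicator K x + indicator K y) * ?w (x - y) \<partial>lborel \<partial>lborel) = ennreal (2 * \<kappa> * W)"
  proof -
    have wm: "(\<lambda>z. ?w (fst z - snd z)) \<in> borel_measurable (lborel \<Otimes>\<^sub>M lborel)"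
      by measurable
    have wm1: "(\<lambda>y. ?w (x - y)) \<in> borel_measurable lborel" for x by measurable
    have wm2: "(\<lambda>x. ?w (x - y)) \<in> borel_measurable lborel" for y by measurable
    have W2: "(\<integral>\<^sup>+x. ?w (x - y) \<partial>lborel) = ennreal W" for y
      using W1[of y] slob_kernel_minus[of \<theta> p "y - _"] by simp
    have "(\<integral>\<^sup>+x. \<integral>\<^sup>+y. (indicator K x + indicator K y) * ?w (x - y) \<partial>lborel \<partial>lborel) =
        (\<integral>\<^sup>+x. (\<integral>\<^sup>+y. indicator K x * ?w (x - y) \<partial>lborel) + (\<integral>\<^sup>+y. indicator K y * ?w (x - y) \<partial>lborel) \<partial>lborel)"
      by (intro nn_integral_cong) (simp add: distrib_right nn_integral_add)
    also have "\<dots> = (\<integral>\<^sup>+x. \<integral>\<^sup>+y. indicator K x * ?w (x - y) \<partial>lborel \<partial>lborel) +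
        (\<integral>\<^sup>+x. \<integral>\<^sup>+y. indicator K y * ?w (x - y) \<partial>lborel \<partial>lborel)"
      by (intro nn_integral_add) measurable
    also have "(\<integral>\<^sup>+x. \<integral>\<^sup>+y. indicator K x * ?w (x - y) \<partial>lborel \<partial>lborel) = (\<integral>\<^sup>+x. indicator K x * ennreal W \<partial>lborel)"
      by (intro nn_integral_cong) (simp add: nn_integral_cmult wm1 W1)
    also have "(\<integral>\<^sup>+x. \<integral>\<^sup>+y. indicator K y * ?w (x - y) \<partial>lborel \<partial>lborel) =
        (\<integral>\<^sup>+y. \<integral>\<^sup>+x. indicator K y * ?w (x - y) \<partial>lborel \<partial>lborel)"
      by (rule lborel_pair.Fubini'[symmetric]) measurable
    also have "\<dots> = (\<integral>\<^sup>+y. indicator K y * ennreal W \<partial>lborel)"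
      by (intro nn_integral_cong) (simp add: nn_integral_cmult wm2 W2)
    also have "(\<integral>\<^sup>+x. indicator K x * ennreal W \<partial>lborel) = ennreal (\<kappa> * W)"
      using \<kappa> W(2) by (simp add: nn_integral_multc ennreal_mult)
    also have "ennreal (\<kappa> * W) + ennreal (\<kappa> * W) = ennreal (2 * \<kappa> * W)"
      using \<kappa> W(2) by (simp flip: ennreal_plus)
    finally show ?thesis .
  qed
  show thesis
  proof (rule that[of C])
    show "C \<ge> 0" by (simp add: C_def)
    fix g :: "real^'n \<Rightarrow> real" and L :: real
    assume g [measurable]: "g \<in> borel_measurable borel" and L: "0 \<le> L" and bd: "\<And>x. \<bar>g x\<bar> \<le> L"
      and lip: "\<And>x y. \<bar>g x - g y\<bar> \<le> L * norm (x - y)" and van: "\<And>x. x \<notin> K \<Longrightarrow> g x = 0"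
    let ?e = "real CARD('n) + \<theta> * p" and ?M = "lebesgue_on \<Omega>"
    let ?F = "\<lambda>z. ennreal (\<bar>g (fst z) - g (snd z)\<bar> powr p / norm (fst z - snd z) powr ?e)"
    interpret M: sigma_finite_measure ?M by (rule sigma_finite_lebesgue_on[OF \<Omega>])
    have F: "?F \<in> borel_measurable (?M \<Otimes>\<^sub>M ?M)"
    proof -
      have "?F = (\<lambda>z. ennreal (\<bar>diff_quot (?e / p) g z\<bar> powr p))"
        using p by (simp only: abs_diff_quot_powr)
      moreover have [measurable]: "diff_quot (?e / p) g \<in> borel_measurable (?M \<Otimes>\<^sub>M ?M)"
        by (intro diff_quot_measurable borel_measurable_lebesgue_on g)
      ultimately show ?thesis by simp
    qed
    have pt: "?F (x, y) \<le> ennreal (L powr p) * ((indicator K x + indicator K y) * ?w (x - y))" for x y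
    proof (cases "x \<in> K \<or> y \<in> K")
      case True
      have "\<bar>g x - g y\<bar> \<le> L * min 2 (norm (x - y))"
        using bd[of x] bd[of y] lip[of x y] by (auto simp: min_def)
      then have "\<bar>g x - g y\<bar> powr p \<le> L powr p * min 2 (norm (x - y)) powr p"
        using p powr_mono2[of p "\<bar>g x - g y\<bar>" "L * min 2 (norm (x - y))"] by (simp add: powr_mult)
      then have "\<bar>g x - g y\<bar> powr p / norm (x - y) powr ?e \<le> L powr p * slob_kernel \<theta> p (x - y)"
        by (simp add: slob_kernel_def divide_right_mono)
      then have "?F (x, y) \<le> ennreal (L powr p) * ?w (x - y)"
        by (simp add: ennreal_mult[symmetric] slob_kernel_nonneg ennreal_leI)
      also have "\<dots> = ennreal (L powr p) * (1 * ?w (x - y))" by simp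
      also have "\<dots> \<le> ennreal (L powr p) * ((indicator K x + indicator K y) * ?w (x - y))"
        using True by (intro mult_left_mono mult_right_mono) (auto split: split_indicator)
      finally show ?thesis .
    qed (simp add: van)
    have le_lborel: "(\<integral>\<^sup>+x. f x \<partial>?M) \<le> (\<integral>\<^sup>+x. f x \<partial>lborel)" for f
    proof -
      have "(\<integral>\<^sup>+x. f x \<partial>?M) = (\<integral>\<^sup>+x. f x * indicator \<Omega> x \<partial>lebesgue)"
        using \<Omega> by (intro nn_integral_restrict_space) simp
      also have "\<dots> \<le> (\<integral>\<^sup>+x. f x \<partial>lebesgue)"
        by (intro nn_integral_mono) (auto split: split_indicator)
      finally show ?thesis by (simp add: nn_integral_completion)
    qed
    have "(\<integral>\<^sup>+z. ?F z \<partial>(?M \<Otimes>\<^sub>M ?M)) = (\<integral>\<^sup>+x. \<integral>\<^sup>+y. ?F (x, y) \<partial>?M \<partial>?M)"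
      by (rule M.nn_integral_fst[OF F, symmetric])
    also have "\<dots> \<le> (\<integral>\<^sup>+x. \<integral>\<^sup>+y. ennreal (L powr p) * ((indicator K x + indicator K y) * ?w (x - y)) \<partial>lborel \<partial>lborel)"
      by (intro order_trans[OF le_lborel] nn_integral_mono) (intro order_trans[OF le_lborel] nn_integral_mono pt)
    also have "\<dots> = ennreal (L powr p) * ennreal (2 * \<kappa> * W)"
      unfolding pair[symmetric] by (subst nn_integral_cmult[symmetric]; (intro nn_integral_cong nn_integral_cmult)?) measurable
    also have "\<dots> = ennreal ((C * L) powr p)"
      using \<kappa> W L p by (simp add: ennreal_mult[symmetric] C_def powr_mult powr_powr mult.commute)
    finally show "slobodeckij_seminorm \<theta> p \<Omega> g \<le> ennreal (C * L)"
      unfolding slobodeckij_seminorm_def using p L by (subst ennreal_root_le_iff) (auto simp: C_def)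
  qed
qed

section \<open>Sobolev norms\<close>

abbreviation (input) sob_order :: "real \<Rightarrow> nat" where "sob_order s \<equiv> nat \<lfloor>s\<rfloor>"
abbreviation (input) sob_frac :: "real \<Rightarrow> real" where "sob_frac s \<equiv> s - real (sob_order s)"

lemma sob_frac_bounds: "0 \<le> s \<Longrightarrow> 0 \<le> sob_frac s \<and> sob_frac s < 1"
  by linarith

lemma Lp_zero: "(\<lambda>x. 0) \<in> Lp p \<Omega>"
  by (simp add: Lp_def Lp_norm_eq_pnorm)

lemma Lp_cmult: "0 < p \<Longrightarrow> f \<in> Lp p \<Omega> \<Longrightarrow> (\<lambda>x. c * f x) \<in> Lp p \<Omega>"
  by (auto simp: Lp_def Lp_norm_eq_pnorm pnorm_cmult ennreal_mult_less_top)

lemma Lp_diff: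
  assumes p: "1 \<le> p" and f: "f \<in> Lp p \<Omega>" and g: "g \<in> Lp p \<Omega>"
  shows "(\<lambda>x. f x - g x) \<in> Lp p \<Omega>"
proof -
  let ?M = "lebesgue_on \<Omega>"
  \<comment> \<open>The two summands as a series, to apply the countable Minkowski inequality.\<close>
  define h where "h k = (if k = 0 then f else if k = Suc 0 then g else (\<lambda>x. 0))" for k :: nat
  have h: "h k \<in> borel_measurable ?M" for k
    using f g by (auto simp: h_def Lp_def)
  have sums2: "(\<lambda>k. F (h k)) sums (F f + F g)" if "F (\<lambda>x. 0) = 0" for F :: "(real^'a \<Rightarrow> real) \<Rightarrow> 'b::{comm_monoid_add, t2_space}"
    using sums_finite[of "{0, Suc 0}" "\<lambda>k. F (h k)"] that by (simp add: h_def)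
  have "(\<Sum>k. pnorm p ?M (h k)) = pnorm p ?M f + pnorm p ?M g"
    by (rule sums_unique[symmetric], rule sums2) simp
  then have fin: "(\<Sum>k. pnorm p ?M (h k)) < top"
    using Lp_finite[OF f] Lp_finite[OF g] by simp
  have "(\<Sum>k. \<bar>h k x\<bar>) = \<bar>f x\<bar> + \<bar>g x\<bar>" for x
    by (rule sums_unique[symmetric], rule sums2) simp
  then have "pnorm p ?M (\<lambda>x. f x - g x) \<le> (\<Sum>k. pnorm p ?M (h k))"
    by (intro pnorm_le_suminf[OF p h fin]) auto
  then show ?thesis
    using fin f g by (auto simp: Lp_def Lp_norm_eq_pnorm)
qed

lemma regular_dist_cmult: "regular_dist \<Omega> (\<lambda>x. c * f x) \<xi> = c * regular_dist \<Omega> f \<xi>"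
  by (simp add: regular_dist_def mult.assoc)

lemma weak_deriv_cmult: "weak_deriv \<Omega> \<nu> f g \<Longrightarrow> weak_deriv \<Omega> \<nu> (\<lambda>x. c * f x) (\<lambda>x. c * g x)"
  by (simp add: weak_deriv_def regular_dist_cmult)

lemma weak_deriv_zero: "weak_deriv \<Omega> \<nu> (\<lambda>x. 0) (\<lambda>x. 0)"
  by (simp add: weak_deriv_def regular_dist_def)

lemma weak_deriv_unique:
  fixes \<Omega> :: "(real^'n::finite) set"
  assumes \<Omega>: "open \<Omega>" and p: "1 \<le> p" and "g \<in> Lp p \<Omega>" "g' \<in> Lp p \<Omega>" "weak_deriv \<Omega> \<nu> f g" "weak_deriv \<Omega> \<nu> f g'"
  shows "AE x in lebesgue_on \<Omega>. g x = g' x"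
proof -
  have "AE x in lebesgue_on \<Omega>. g x - g' x = 0"
  proof (rule fundamental_lemma[OF \<Omega> p Lp_diff[OF p assms(3,4)]])
    fix \<xi> assume \<xi>: "\<xi> \<in> test_fun \<Omega>"
    have "regular_dist \<Omega> (\<lambda>x. g x - g' x) \<xi> = regular_dist \<Omega> g \<xi> - regular_dist \<Omega> g' \<xi>"
      unfolding regular_dist_def left_diff_distrib
      by (intro Bochner_Integration.integral_diff integrable_Lp_mult_test_fun[OF \<Omega> p _ \<xi>] assms)
    also have "\<dots> = 0" using assms(5,6) \<xi> by (simp add: weak_deriv_def)
    finally show "regular_dist \<Omega> (\<lambda>x. g x - g' x) \<xi> = 0" .
  qed
  then show ?thesis by eventually_elim simp
qed

text \<open>By uniqueness of weak derivatives the infima in the definition are attained by every choice of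
  representatives, and the same representative serves for the \<open>L\<^sup>p\<close> norm and for the seminorm.\<close>

lemma sobolev_norm_eq:
  fixes \<Omega> :: "(real^'n::finite) set"
  assumes \<Omega>: "open \<Omega>" and p: "1 \<le> p"
    and G: "\<And>\<nu>. mi_order \<nu> \<le> sob_order s \<Longrightarrow> G \<nu> \<in> Lp p \<Omega>" "\<And>\<nu>. mi_order \<nu> \<le> sob_order s \<Longrightarrow> weak_deriv \<Omega> \<nu> f (G \<nu>)"
  shows "sobolev_norm s p \<Omega> f = (\<Sum>\<nu> | mi_order \<nu> \<le> sob_order s. Lp_norm p \<Omega> (G \<nu>)) +
    (if sob_frac s = 0 then 0 else \<Sum>\<nu> | mi_order \<nu> = sob_order s. slobodeckij_seminorm (sob_frac s) p \<Omega> (G \<nu>))"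
proof -
  have p0: "0 < p" using p by simp
  have INF_eq: "(INF g\<in>{g \<in> Lp p \<Omega>. weak_deriv \<Omega> \<nu> f g}. N g) = N (G \<nu>)"
    if "mi_order \<nu> \<le> sob_order s" "\<And>g g'. AE x in lebesgue_on \<Omega>. g x = g' x \<Longrightarrow> N g = N g'"
    for \<nu> and N :: "(real^'n \<Rightarrow> real) \<Rightarrow> ennreal"
  proof (rule antisym)
    show "(INF g\<in>{g \<in> Lp p \<Omega>. weak_deriv \<Omega> \<nu> f g}. N g) \<le> N (G \<nu>)"
      using G[OF that(1)] by (intro INF_lower) auto
    show "N (G \<nu>) \<le> (INF g\<in>{g \<in> Lp p \<Omega>. weak_deriv \<Omega> \<nu> f g}. N g)"
    proof (rule INF_greatest)
      fix g assume "g \<in> {g \<in> Lp p \<Omega>. weak_deriv \<Omega> \<nu> f g}"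
      then have "AE x in lebesgue_on \<Omega>. G \<nu> x = g x"
        by (intro weak_deriv_unique[OF \<Omega> p G(1)[OF that(1)] _ G(2)[OF that(1)]]) auto
      then show "N (G \<nu>) \<le> N g" using that(2) by simp
    qed
  qed
  have "(INF g\<in>{g \<in> Lp p \<Omega>. weak_deriv \<Omega> \<nu> f g}. Lp_norm p \<Omega> g) = Lp_norm p \<Omega> (G \<nu>)"
    if "mi_order \<nu> \<le> sob_order s" for \<nu>
    using that by (rule INF_eq) (simp add: Lp_norm_eq_pnorm pnorm_cong_AE[OF p0])
  moreover have "(INF g\<in>{g \<in> Lp p \<Omega>. weak_deriv \<Omega> \<nu> f g}. slobodeckij_seminorm (sob_frac s) p \<Omega> g) =
      slobodeckij_seminorm (sob_frac s) p \<Omega> (G \<nu>)" if "mi_order \<nu> = sob_order s" for \<nu>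
    using that by (intro INF_eq slobodeckij_cong_AE[OF \<Omega> p0]) auto
  ultimately show ?thesis
    unfolding sobolev_norm_def Let_def by simp
qed

lemma sobolev_norm_finiteE:
  fixes \<Omega> :: "(real^'n::finite) set"
  assumes "sobolev_norm s p \<Omega> f < top"
  obtains G where "\<And>\<nu>. mi_order \<nu> \<le> sob_order s \<Longrightarrow> G \<nu> \<in> Lp p \<Omega>"
    "\<And>\<nu>. mi_order \<nu> \<le> sob_order s \<Longrightarrow> weak_deriv \<Omega> \<nu> f (G \<nu>)"
proof -
  have "\<exists>g. g \<in> Lp p \<Omega> \<and> weak_deriv \<Omega> \<nu> f g" if \<nu>: "mi_order \<nu> \<le> sob_order s" for \<nu>
  proof -
    let ?N = "\<lambda>\<nu>. INF g\<in>{g \<in> Lp p \<Omega>. weak_deriv \<Omega> \<nu> f g}. Lp_norm p \<Omega> g"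
    have "?N \<nu> \<le> (\<Sum>\<nu> | mi_order \<nu> \<le> sob_order s. ?N \<nu>)"
      using \<nu> finite_mi_order_le by (intro member_le_sum) auto
    also have "\<dots> \<le> sobolev_norm s p \<Omega> f" unfolding sobolev_norm_def Let_def by simp
    finally have "?N \<nu> < top" using assms by simp
    then show ?thesis by (auto simp: INF_less_iff)
  qed
  then have "\<forall>\<nu>. \<exists>g. mi_order \<nu> \<le> sob_order s \<longrightarrow> g \<in> Lp p \<Omega> \<and> weak_deriv \<Omega> \<nu> f g" by blast
  then show thesis using that by (metis (no_types, lifting))
qed

lemma sobolev_norm_zero: "open \<Omega> \<Longrightarrow> 1 \<le> p \<Longrightarrow> sobolev_norm s p \<Omega> (\<lambda>x. 0) = 0"
  by (subst sobolev_norm_eq[where G="\<lambda>_ _. 0"])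
    (auto simp: Lp_zero weak_deriv_zero Lp_norm_eq_pnorm slobodeckij_seminorm_def)

lemma sobolev_norm_cmult:
  fixes \<Omega> :: "(real^'n::finite) set"
  assumes \<Omega>: "open \<Omega>" and p: "1 \<le> p" and f: "sobolev_norm s p \<Omega> f < top"
  shows "sobolev_norm s p \<Omega> (\<lambda>x. c * f x) = ennreal \<bar>c\<bar> * sobolev_norm s p \<Omega> f"
proof -
  have p0: "0 < p" using p by simp
  obtain G where G: "\<And>\<nu>. mi_order \<nu> \<le> sob_order s \<Longrightarrow> G \<nu> \<in> Lp p \<Omega>"
    "\<And>\<nu>. mi_order \<nu> \<le> sob_order s \<Longrightarrow> weak_deriv \<Omega> \<nu> f (G \<nu>)"
    by (rule sobolev_norm_finiteE[OF f]) (rule that)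
  have "sobolev_norm s p \<Omega> (\<lambda>x. c * f x) = (\<Sum>\<nu> | mi_order \<nu> \<le> sob_order s. Lp_norm p \<Omega> (\<lambda>x. c * G \<nu> x)) +
    (if sob_frac s = 0 then 0 else \<Sum>\<nu> | mi_order \<nu> = sob_order s. slobodeckij_seminorm (sob_frac s) p \<Omega> (\<lambda>x. c * G \<nu> x))"
    by (intro sobolev_norm_eq[OF \<Omega> p] Lp_cmult[OF p0] weak_deriv_cmult G)
  also have "(\<Sum>\<nu> | mi_order \<nu> \<le> sob_order s. Lp_norm p \<Omega> (\<lambda>x. c * G \<nu> x)) =
      ennreal \<bar>c\<bar> * (\<Sum>\<nu> | mi_order \<nu> \<le> sob_order s. Lp_norm p \<Omega> (G \<nu>))"
    unfolding sum_distrib_left Lp_norm_eq_pnorm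
    by (intro sum.cong refl pnorm_cmult[OF p0] Lp_measurable[OF G(1)]) simp
  also have "(\<Sum>\<nu> | mi_order \<nu> = sob_order s. slobodeckij_seminorm (sob_frac s) p \<Omega> (\<lambda>x. c * G \<nu> x)) =
      ennreal \<bar>c\<bar> * (\<Sum>\<nu> | mi_order \<nu> = sob_order s. slobodeckij_seminorm (sob_frac s) p \<Omega> (G \<nu>))"
    unfolding sum_distrib_left
    by (intro sum.cong refl slobodeckij_cmult[OF p0] Lp_measurable[OF G(1)]) simp
  finally show ?thesis
    by (subst sobolev_norm_eq[OF \<Omega> p G]) (auto simp: distrib_left)
qed

lemma sobolev_space_cmult:
  "open \<Omega> \<Longrightarrow> 1 \<le> p \<Longrightarrow> f \<in> sobolev_space s p \<Omega> \<Longrightarrow> (\<lambda>x. c * f x) \<in> sobolev_space s p \<Omega>"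
  by (auto simp: sobolev_space_def sobolev_norm_cmult ennreal_mult_less_top intro: Lp_cmult)

subsection \<open>Test functions in Sobolev spaces\<close>

lemma Lp_norm_bounded_support:
  fixes K \<Omega> :: "(real^'n::finite) set"
  assumes \<Omega>: "open \<Omega>" and K: "compact K" and p: "1 \<le> p" and B: "0 \<le> B"
    "\<And>x. \<bar>g x\<bar> \<le> B" "\<And>x. x \<notin> K \<Longrightarrow> g x = 0"
  shows "Lp_norm p \<Omega> g \<le> ennreal (measure lborel K powr (1 / p) * B)"
proof -
  have Kb: "K \<in> sets borel" using K by (rule borel_compact)
  have \<kappa>: "emeasure lborel K = ennreal (measure lborel K)"
    using emeasure_compact_finite[OF K] by (auto simp: emeasure_eq_ennreal_measure)
  have "(\<integral>\<^sup>+x. ennreal (\<bar>g x\<bar> powr p) \<partial>lebesgue_on \<Omega>) = (\<integral>\<^sup>+x. ennreal (\<bar>g x\<bar> powr p) * indicator \<Omega> x \<partial>lebesgue)"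
    using \<Omega> by (intro nn_integral_restrict_space) simp
  also have "\<dots> \<le> (\<integral>\<^sup>+x. ennreal (B powr p) * indicator K x \<partial>lebesgue)"
    using B p by (intro nn_integral_mono) (auto intro!: ennreal_leI powr_mono2 split: split_indicator)
  also have "\<dots> = ennreal (B powr p) * ennreal (measure lborel K)"
    using Kb \<kappa> by (simp add: nn_integral_cmult_indicator)
  also have "\<dots> = ennreal ((measure lborel K powr (1 / p) * B) powr p)"
    using p by (simp add: ennreal_mult[symmetric] powr_mult powr_powr mult.commute)
  finally show ?thesis
    unfolding Lp_norm_def using p B(1) by (subst ennreal_root_le_iff) auto
qed

lemma test_fun_in_Lp:
  assumes "open \<Omega>" "1 \<le> p" "\<xi> \<in> test_fun \<Omega>"
  shows "\<xi> \<in> Lp p \<Omega>"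
proof -
  obtain K where K: "compact K" "\<And>x. x \<notin> K \<Longrightarrow> \<xi> x = 0" by (rule test_fun_support[OF assms(3)]) (rule that)
  obtain B where B: "B > 0" "\<And>x. \<bar>\<xi> x\<bar> \<le> B" by (rule test_fun_bounded[OF assms(3)]) (rule that)
  have "Lp_norm p \<Omega> \<xi> \<le> ennreal (measure lborel K powr (1 / p) * B)"
    using Lp_norm_bounded_support[OF assms(1) K(1) assms(2) _ B(2) K(2)] B(1) by simp
  then have "Lp_norm p \<Omega> \<xi> < top" by (rule le_less_trans) simp
  then show ?thesis
    using borel_measurable_lebesgue_on[OF test_fun_borel[OF assms(3)]] by (simp add: Lp_def)
qed

text \<open>The Sobolev norm of a test function is controlled by the seminorms that define the test function
  topology; one derivative more than the order suffices for the fractional part.\<close>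

lemma sobolev_norm_test_fun_bound:
  fixes K \<Omega> :: "(real^'n::finite) set"
  assumes \<Omega>: "open \<Omega>" and K: "compact K" and p: "1 \<le> p" and s: "0 \<le> s"
  obtains C where "C \<ge> 0" "\<And>\<xi> B. \<lbrakk>\<xi> \<in> test_fun \<Omega>; \<And>x. x \<notin> K \<Longrightarrow> \<xi> x = 0; 0 \<le> B;
      \<And>\<nu> y. mi_order \<nu> \<le> Suc (sob_order s) \<Longrightarrow> y \<in> K \<Longrightarrow> \<bar>partials \<nu> \<xi> y\<bar> \<le> B\<rbrakk>
    \<Longrightarrow> sobolev_norm s p \<Omega> \<xi> \<le> ennreal (C * B)"
proof -
  let ?\<theta> = "sob_frac s"
  have "\<exists>C\<ge>0. ?\<theta> \<noteq> 0 \<longrightarrow> (\<forall>g L. g \<in> borel_measurable borel \<longrightarrow> 0 \<le> L \<longrightarrow> (\<forall>x. \<bar>g x\<bar> \<le> L) \<longrightarrow>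
      (\<forall>x y. \<bar>g x - g y\<bar> \<le> L * norm (x - y)) \<longrightarrow> (\<forall>x. x \<notin> K \<longrightarrow> g x = 0) \<longrightarrow>
      slobodeckij_seminorm ?\<theta> p \<Omega> g \<le> ennreal (C * L))"
  proof (cases "?\<theta> = 0")
    case False
    then have \<theta>: "0 < ?\<theta>" "?\<theta> < 1" using sob_frac_bounds[OF s] by auto
    show ?thesis by (rule slobodeckij_lipschitz_bound[OF \<Omega> K p \<theta>]) blast
  qed auto
  then obtain C1 where C1: "C1 \<ge> 0" "\<And>g L. \<lbrakk>?\<theta> \<noteq> 0; g \<in> borel_measurable borel; 0 \<le> L; \<And>x. \<bar>g x\<bar> \<le> L;
      \<And>x y. \<bar>g x - g y\<bar> \<le> L * norm (x - y); \<And>x. x \<notin> K \<Longrightarrow> g x = 0\<rbrakk>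
    \<Longrightarrow> slobodeckij_seminorm ?\<theta> p \<Omega> g \<le> ennreal (C1 * L)"
    by blast
  define c where "c = measure lborel K powr (1 / p)"
  define n where "n = real CARD('n)"
  have n: "n \<ge> 1" by (simp add: n_def Suc_leI)
  define a where "a = real (card {\<nu> :: 'n \<Rightarrow> nat. mi_order \<nu> \<le> sob_order s}) * c"
  define b where "b = real (card {\<nu> :: 'n \<Rightarrow> nat. mi_order \<nu> = sob_order s}) * (C1 * n)"
  have pos: "c \<ge> 0" "a \<ge> 0" "b \<ge> 0" using C1(1) n by (auto simp: c_def a_def b_def)
  show thesis
  proof (rule that[of "a + b"])
    show "0 \<le> a + b" using pos by simp
    fix \<xi> B assume \<xi>: "\<xi> \<in> test_fun \<Omega>" and van: "\<And>x. x \<notin> K \<Longrightarrow> \<xi> x = 0" and B: "0 \<le> B"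
      and bd: "\<And>\<nu> y. mi_order \<nu> \<le> Suc (sob_order s) \<Longrightarrow> y \<in> K \<Longrightarrow> \<bar>partials \<nu> \<xi> y\<bar> \<le> B"
    have van': "partials \<nu> \<xi> x = 0" if "x \<notin> K" for \<nu> x
      by (rule partials_vanish[OF compact_imp_closed[OF K] van that])
    have bd': "\<bar>partials \<nu> \<xi> x\<bar> \<le> B" if "mi_order \<nu> \<le> Suc (sob_order s)" for \<nu> x
      using bd[OF that] van' B by (cases "x \<in> K") auto
    have "sobolev_norm s p \<Omega> \<xi> = (\<Sum>\<nu> | mi_order \<nu> \<le> sob_order s. Lp_norm p \<Omega> (partials \<nu> \<xi>)) +
      (if ?\<theta> = 0 then 0 else \<Sum>\<nu> | mi_order \<nu> = sob_order s. slobodeckij_seminorm ?\<theta> p \<Omega> (partials \<nu> \<xi>))"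
      by (intro sobolev_norm_eq[OF \<Omega> p] test_fun_in_Lp[OF \<Omega> p] test_fun_partials[OF \<xi>] weak_deriv_partials[OF \<Omega> \<xi>])
    also have "\<dots> \<le> ennreal (a * B) + ennreal (b * B)"
    proof (rule add_mono)
      have "(\<Sum>\<nu> | mi_order \<nu> \<le> sob_order s. Lp_norm p \<Omega> (partials \<nu> \<xi>)) \<le>
          (\<Sum>\<nu> \<in> {\<nu> :: 'n \<Rightarrow> nat. mi_order \<nu> \<le> sob_order s}. ennreal (c * B))"
        unfolding c_def using B bd' van'
        by (intro sum_mono Lp_norm_bounded_support[OF \<Omega> K p]) auto
      also have "\<dots> = ennreal (a * B)"
        using pos B by (simp add: a_def ennreal_mult ennreal_of_nat_eq_real_of_nat mult.assoc)
      finally show "(\<Sum>\<nu> | mi_order \<nu> \<le> sob_order s. Lp_norm p \<Omega> (partials \<nu> \<xi>)) \<le> ennreal (a * B)" .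
    next
      have "slobodeckij_seminorm ?\<theta> p \<Omega> (partials \<nu> \<xi>) \<le> ennreal (C1 * (n * B))"
        if \<nu>: "mi_order \<nu> = sob_order s" and \<theta>: "?\<theta> \<noteq> 0" for \<nu>
      proof (rule C1(2)[OF \<theta>])
        show "partials \<nu> \<xi> \<in> borel_measurable borel" by (rule test_fun_borel[OF test_fun_partials[OF \<xi>]])
        show "0 \<le> n * B" using n B by simp
        show "\<bar>partials \<nu> \<xi> x\<bar> \<le> n * B" for x
          using bd'[of \<nu> x] \<nu> mult_right_mono[OF n B] by simp
        show "\<bar>partials \<nu> \<xi> x - partials \<nu> \<xi> y\<bar> \<le> n * B * norm (x - y)" for x y
          unfolding n_def
        proof (rule test_fun_lipschitz[OF test_fun_smooth[OF test_fun_partials[OF \<xi>]] _ B])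
          fix i x
          obtain "is" where "is": "partials \<nu> = foldr partial_deriv is" "length is = mi_order \<nu>"
            by (rule partials_obtain_list[of \<nu>]) (rule that)
          have "partial_deriv i (partials \<nu> \<xi>) x = partials (count_list (i # is)) \<xi> x"
            using partials_count_list[OF open_UNIV test_fun_smooth[OF \<xi>], of x "i # is"] by (simp add: "is")
          moreover have "mi_order (count_list (i # is)) \<le> Suc (sob_order s)"
            using \<nu> "is"(2) mi_order_count_list[of "i # is"] by simp
          ultimately show "\<bar>partial_deriv i (partials \<nu> \<xi>) x\<bar> \<le> B" using bd' by simp
        qed
      qed (rule van')
      then have "(\<Sum>\<nu> | mi_order \<nu> = sob_order s. slobodeckij_seminorm ?\<theta> p \<Omega> (partials \<nu> \<xi>)) \<le>
          (\<Sum>\<nu> \<in> {\<nu> :: 'n \<Rightarrow> nat. mi_order \<nu> = sob_order s}. ennreal (C1 * (n * B)))" if "?\<theta> \<noteq> 0"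
        using that by (intro sum_mono) auto
      also have "\<dots> = ennreal (b * B)"
        using C1(1) n B by (simp add: b_def ennreal_mult ennreal_of_nat_eq_real_of_nat mult.assoc)
      finally show "(if ?\<theta> = 0 then 0 else \<Sum>\<nu> | mi_order \<nu> = sob_order s. slobodeckij_seminorm ?\<theta> p \<Omega> (partials \<nu> \<xi>)) \<le> ennreal (b * B)"
        by simp
    qed
    also have "\<dots> = ennreal ((a + b) * B)"
      using pos B by (simp add: distrib_right)
    finally show "sobolev_norm s p \<Omega> \<xi> \<le> ennreal ((a + b) * B)" .
  qed
qed

lemma test_fun_sobolev_norm_finite:
  assumes \<Omega>: "open \<Omega>" and p: "1 \<le> p" and s: "0 \<le> s" and \<xi>: "\<xi> \<in> test_fun \<Omega>"
  shows "sobolev_norm s p \<Omega> \<xi> < top"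
proof -
  obtain K where K: "compact K" "\<And>x. x \<notin> K \<Longrightarrow> \<xi> x = 0" by (rule test_fun_support[OF \<xi>]) (rule that)
  have "\<forall>\<nu>. \<exists>B. 0 \<le> B \<and> (\<forall>x. \<bar>partials \<nu> \<xi> x\<bar> \<le> B)"
    by (metis test_fun_bounded[OF test_fun_partials[OF \<xi>]] less_imp_le)
  then obtain b where b: "\<And>\<nu>. 0 \<le> b \<nu>" "\<And>\<nu> x. \<bar>partials \<nu> \<xi> x\<bar> \<le> b \<nu>" by metis
  define B where "B = (\<Sum>\<nu> | mi_order \<nu> \<le> Suc (sob_order s). b \<nu>)"
  have bB: "b \<nu> \<le> B" if "mi_order \<nu> \<le> Suc (sob_order s)" for \<nu>
    unfolding B_def using that b(1) finite_mi_order_le by (intro member_le_sum) auto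
  have B: "0 \<le> B" unfolding B_def using b(1) by (simp add: sum_nonneg)
  show ?thesis
  proof (rule sobolev_norm_test_fun_bound[OF \<Omega> K(1) p s])
    fix C assume C: "\<And>\<xi> B. \<lbrakk>\<xi> \<in> test_fun \<Omega>; \<And>x. x \<notin> K \<Longrightarrow> \<xi> x = 0; 0 \<le> B;
        \<And>\<nu> y. mi_order \<nu> \<le> Suc (sob_order s) \<Longrightarrow> y \<in> K \<Longrightarrow> \<bar>partials \<nu> \<xi> y\<bar> \<le> B\<rbrakk>
      \<Longrightarrow> sobolev_norm s p \<Omega> \<xi> \<le> ennreal (C * B)"
    have "sobolev_norm s p \<Omega> \<xi> \<le> ennreal (C * B)"
      by (rule C[OF \<xi> K(2) B]) (auto intro: order_trans[OF b(2) bB])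
    then show ?thesis by (rule le_less_trans) simp
  qed
qed

lemma test_fun_sobolev_space0:
  assumes \<Omega>: "open \<Omega>" and p: "1 \<le> p" and s: "0 \<le> s" and \<xi>: "\<xi> \<in> test_fun \<Omega>"
  shows "\<xi> \<in> sobolev_space0 s p \<Omega>"
  using test_fun_sobolev_norm_finite[OF assms] test_fun_in_Lp[OF \<Omega> p \<xi>] sobolev_norm_zero[OF \<Omega> p, of s] \<xi>
  by (auto simp: sobolev_space0_def sobolev_space_def intro!: bexI[of _ \<xi>])

lemma sobolev_space0_cmult:
  assumes \<Omega>: "open \<Omega>" and p: "1 \<le> p" and f: "f \<in> sobolev_space0 s p \<Omega>"
  shows "(\<lambda>x. c * f x) \<in> sobolev_space0 s p \<Omega>"
proof -
  have fs: "f \<in> sobolev_space s p \<Omega>" using f by (simp add: sobolev_space0_def)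
  have "\<exists>\<xi>\<in>test_fun \<Omega>. sobolev_norm s p \<Omega> (\<lambda>x. c * f x - \<xi> x) < ennreal \<epsilon>" if "\<epsilon> > 0" for \<epsilon> :: real
  proof -
    have "0 < \<epsilon> / (\<bar>c\<bar> + 1)" using \<open>\<epsilon> > 0\<close> by simp
    then obtain \<xi> where \<xi>: "\<xi> \<in> test_fun \<Omega>" "sobolev_norm s p \<Omega> (\<lambda>x. f x - \<xi> x) < ennreal (\<epsilon> / (\<bar>c\<bar> + 1))"
      using f unfolding sobolev_space0_def by blast
    have fin: "sobolev_norm s p \<Omega> (\<lambda>x. f x - \<xi> x) < top" using \<xi>(2) by (rule less_trans) simp
    have "sobolev_norm s p \<Omega> (\<lambda>x. c * f x - c * \<xi> x) = ennreal \<bar>c\<bar> * sobolev_norm s p \<Omega> (\<lambda>x. f x - \<xi> x)"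
      using sobolev_norm_cmult[OF \<Omega> p fin, of c] by (simp add: right_diff_distrib)
    also have "\<dots> \<le> ennreal \<bar>c\<bar> * ennreal (\<epsilon> / (\<bar>c\<bar> + 1))"
      using \<xi>(2) by (intro mult_left_mono) auto
    also have "\<dots> = ennreal (\<bar>c\<bar> * (\<epsilon> / (\<bar>c\<bar> + 1)))" using \<open>\<epsilon> > 0\<close> by (simp add: ennreal_mult[symmetric])
    also have "\<dots> < ennreal \<epsilon>"
    proof (rule ennreal_lessI[OF \<open>\<epsilon> > 0\<close>])
      have "\<bar>c\<bar> * \<epsilon> < \<epsilon> * (\<bar>c\<bar> + 1)" using \<open>\<epsilon> > 0\<close> by (simp add: algebra_simps)
      moreover have "0 < \<bar>c\<bar> + 1" by simp
      ultimately show "\<bar>c\<bar> * (\<epsilon> / (\<bar>c\<bar> + 1)) < \<epsilon>" by (simp only: times_divide_eq_right pos_divide_less_eq)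
    qed
    finally show ?thesis
      using smooth_on_cmult[OF open_UNIV test_fun_smooth[OF \<xi>(1)], of c] test_fun_mult[OF \<xi>(1) smooth_on_const, of c]
      by (intro bexI[of _ "\<lambda>x. c * \<xi> x"]) (simp_all add: mult.commute)
  qed
  then show ?thesis using sobolev_space_cmult[OF \<Omega> p fs] by (simp add: sobolev_space0_def)
qed

section \<open>The norm of a distribution on an open set\<close>

subsection \<open>Nonnegative order\<close>

text \<open>The Sobolev norm of a function depends on its weak derivatives only, and these are determined by the
distribution that the function induces. So the infimum in the definition is over a constant.\<close>

lemma dist_sobolev_norm_eq:
  assumes s: "0 \<le> s" and f: "f \<in> sobolev_space s p \<Omega>" "\<And>\<xi>. \<xi> \<in> test_fun \<Omega> \<Longrightarrow> v \<xi> = regular_dist \<Omega> f \<xi>"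
  shows "dist_sobolev_norm s p \<Omega> v = sobolev_norm s p \<Omega> f"
proof -
  have same: "sobolev_norm s p \<Omega> f' = sobolev_norm s p \<Omega> f"
    if "\<forall>\<xi>\<in>test_fun \<Omega>. v \<xi> = regular_dist \<Omega> f' \<xi>" for f'
  proof -
    have "regular_dist \<Omega> f' \<xi> = regular_dist \<Omega> f \<xi>" if "\<xi> \<in> test_fun \<Omega>" for \<xi>
      using that \<open>\<forall>\<xi>\<in>test_fun \<Omega>. v \<xi> = regular_dist \<Omega> f' \<xi>\<close> f(2) by metis
    then have "weak_deriv \<Omega> \<nu> f' = weak_deriv \<Omega> \<nu> f" for \<nu>
      by (auto simp: weak_deriv_def fun_eq_iff test_fun_partials)
    then show ?thesis by (simp only: sobolev_norm_def)
  qed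
  let ?R = "{f \<in> sobolev_space s p \<Omega>. \<forall>\<xi>\<in>test_fun \<Omega>. v \<xi> = regular_dist \<Omega> f \<xi>}"
  have fR: "f \<in> ?R" using f by auto
  have "(INF f'\<in>?R. sobolev_norm s p \<Omega> f') = sobolev_norm s p \<Omega> f"
  proof (rule antisym)
    show "(INF f'\<in>?R. sobolev_norm s p \<Omega> f') \<le> sobolev_norm s p \<Omega> f" by (rule INF_lower[OF fR])
    show "sobolev_norm s p \<Omega> f \<le> (INF f'\<in>?R. sobolev_norm s p \<Omega> f')"
      by (rule INF_greatest) (simp add: same)
  qed
  then show ?thesis using s by (simp add: dist_sobolev_norm_def)
qed

lemma dist_sobolev_norm_representative:
  assumes s: "0 \<le> s" and v: "dist_sobolev_norm s p \<Omega> v < top"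
  obtains f where "f \<in> sobolev_space s p \<Omega>" "\<And>\<xi>. \<xi> \<in> test_fun \<Omega> \<Longrightarrow> v \<xi> = regular_dist \<Omega> f \<xi>"
    "dist_sobolev_norm s p \<Omega> v = sobolev_norm s p \<Omega> f"
proof -
  obtain f where f: "f \<in> sobolev_space s p \<Omega>" "\<And>\<xi>. \<xi> \<in> test_fun \<Omega> \<Longrightarrow> v \<xi> = regular_dist \<Omega> f \<xi>"
    using s v by (auto simp: dist_sobolev_norm_def INF_less_iff)
  then show thesis using dist_sobolev_norm_eq[OF s f] that by blast
qed

text \<open>Completeness and the triangle inequality in one statement: an absolutely convergent series of
  distributions has a sum, whose norm is at most the sum of the norms. For nonnegative order the weak
  derivatives of the representatives are summed in \<open>L\<^sup>p\<close>.\<close>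

lemma dist_sobolev_norm_suminf_nonneg:
  fixes \<Omega> :: "(real^'n::finite) set"
  assumes \<Omega>: "open \<Omega>" and p: "1 \<le> p" and s: "0 \<le> s" and fin: "(\<Sum>k. dist_sobolev_norm s p \<Omega> (w k)) < top"
  shows "(\<forall>\<xi>\<in>test_fun \<Omega>. summable (\<lambda>k. w k \<xi>)) \<and>
    dist_sobolev_norm s p \<Omega> (\<lambda>\<xi>. \<Sum>k. w k \<xi>) \<le> (\<Sum>k. dist_sobolev_norm s p \<Omega> (w k))"
proof -
  let ?k = "sob_order s" and ?\<theta> = "sob_frac s" and ?M = "lebesgue_on \<Omega>"
  have finw: "dist_sobolev_norm s p \<Omega> (w k) < top" for k by (rule ennreal_suminf_lessD[OF fin])
  have "\<forall>k. \<exists>f. f \<in> sobolev_space s p \<Omega> \<and> (\<forall>\<xi>\<in>test_fun \<Omega>. w k \<xi> = regular_dist \<Omega> f \<xi>) \<and>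
      dist_sobolev_norm s p \<Omega> (w k) = sobolev_norm s p \<Omega> f"
  proof
    fix k
    show "\<exists>f. f \<in> sobolev_space s p \<Omega> \<and> (\<forall>\<xi>\<in>test_fun \<Omega>. w k \<xi> = regular_dist \<Omega> f \<xi>) \<and>
      dist_sobolev_norm s p \<Omega> (w k) = sobolev_norm s p \<Omega> f"
      by (rule dist_sobolev_norm_representative[OF s finw[of k]]) blast
  qed
  then obtain f where f: "\<And>k. f k \<in> sobolev_space s p \<Omega>" "\<And>k \<xi>. \<xi> \<in> test_fun \<Omega> \<Longrightarrow> w k \<xi> = regular_dist \<Omega> (f k) \<xi>"
    "\<And>k. dist_sobolev_norm s p \<Omega> (w k) = sobolev_norm s p \<Omega> (f k)"
    by metis
  have "\<forall>k. \<exists>G. \<forall>\<nu>. mi_order \<nu> \<le> ?k \<longrightarrow> G \<nu> \<in> Lp p \<Omega> \<and> weak_deriv \<Omega> \<nu> (f k) (G \<nu>)"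
  proof
    fix k
    have "sobolev_norm s p \<Omega> (f k) < top" using f(1)[of k] by (simp add: sobolev_space_def)
    then show "\<exists>G. \<forall>\<nu>. mi_order \<nu> \<le> ?k \<longrightarrow> G \<nu> \<in> Lp p \<Omega> \<and> weak_deriv \<Omega> \<nu> (f k) (G \<nu>)"
      by (rule sobolev_norm_finiteE) blast
  qed
  then obtain G where G: "\<And>k \<nu>. mi_order \<nu> \<le> ?k \<Longrightarrow> G k \<nu> \<in> Lp p \<Omega>"
      "\<And>k \<nu>. mi_order \<nu> \<le> ?k \<Longrightarrow> weak_deriv \<Omega> \<nu> (f k) (G k \<nu>)"
    by metis
  have norm_f: "sobolev_norm s p \<Omega> (f k) = (\<Sum>\<nu> | mi_order \<nu> \<le> ?k. Lp_norm p \<Omega> (G k \<nu>)) +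
    (if ?\<theta> = 0 then 0 else \<Sum>\<nu> | mi_order \<nu> = ?k. slobodeckij_seminorm ?\<theta> p \<Omega> (G k \<nu>))" for k
    by (rule sobolev_norm_eq[OF \<Omega> p G])
  have total: "(\<Sum>k. dist_sobolev_norm s p \<Omega> (w k)) =
      (\<Sum>\<nu> | mi_order \<nu> \<le> ?k. \<Sum>k. Lp_norm p \<Omega> (G k \<nu>)) +
      (if ?\<theta> = 0 then 0 else \<Sum>\<nu> | mi_order \<nu> = ?k. \<Sum>k. slobodeckij_seminorm ?\<theta> p \<Omega> (G k \<nu>))"
    unfolding f(3) norm_f
    by (simp add: suminf_add[symmetric, OF summableI summableI] suminf_sum[OF summableI])
  have Lp_fin: "(\<Sum>k. pnorm p ?M (G k \<nu>)) < top" if \<nu>: "mi_order \<nu> \<le> ?k" for \<nu>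
  proof -
    have "(\<Sum>k. pnorm p ?M (G k \<nu>)) \<le> (\<Sum>\<nu> | mi_order \<nu> \<le> ?k. \<Sum>k. Lp_norm p \<Omega> (G k \<nu>))"
      unfolding Lp_norm_eq_pnorm using \<nu> finite_mi_order_le
      by (intro member_le_sum[where f="\<lambda>\<nu>. \<Sum>k. pnorm p ?M (G k \<nu>)"]) auto
    also have "\<dots> \<le> (\<Sum>k. dist_sobolev_norm s p \<Omega> (w k))" unfolding total by simp
    also note fin
    finally show ?thesis .
  qed
  have slob_fin: "(\<Sum>k. slobodeckij_seminorm ?\<theta> p \<Omega> (G k \<nu>)) < top" if \<nu>: "mi_order \<nu> = ?k" "?\<theta> \<noteq> 0" for \<nu>
  proof -
    have "(\<Sum>k. slobodeckij_seminorm ?\<theta> p \<Omega> (G k \<nu>)) \<le> (\<Sum>\<nu> | mi_order \<nu> = ?k. \<Sum>k. slobodeckij_seminorm ?\<theta> p \<Omega> (G k \<nu>))"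
      using \<nu> finite_mi_order_eq
      by (intro member_le_sum[where f="\<lambda>\<nu>. \<Sum>k. slobodeckij_seminorm ?\<theta> p \<Omega> (G k \<nu>)"]) auto
    also have "\<dots> \<le> (\<Sum>k. dist_sobolev_norm s p \<Omega> (w k))" unfolding total using \<nu>(2) by simp
    also note fin
    finally show ?thesis .
  qed
  define H where "H \<nu> = (\<lambda>x. \<Sum>k. G k \<nu> x)" for \<nu>
  have meas: "G k \<nu> \<in> borel_measurable ?M" if "mi_order \<nu> \<le> ?k" for k \<nu>
    by (rule Lp_measurable[OF G(1)[OF that]])
  have AE: "AE x in ?M. summable (\<lambda>k. \<bar>G k \<nu> x\<bar>)" if "mi_order \<nu> \<le> ?k" for \<nu>
    by (rule AE_summable_of_pnorm[OF p meas[OF that] Lp_fin[OF that]])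
  have H_norm: "Lp_norm p \<Omega> (H \<nu>) \<le> (\<Sum>k. Lp_norm p \<Omega> (G k \<nu>))" if "mi_order \<nu> \<le> ?k" for \<nu>
    unfolding Lp_norm_eq_pnorm H_def
  proof (rule pnorm_le_suminf[OF p meas[OF that] Lp_fin[OF that]])
    show "AE x in ?M. \<bar>\<Sum>k. G k \<nu> x\<bar> \<le> (\<Sum>k. \<bar>G k \<nu> x\<bar>)"
      using AE[OF that] by eventually_elim (rule summable_rabs)
  qed
  have H_Lp: "H \<nu> \<in> Lp p \<Omega>" if "mi_order \<nu> \<le> ?k" for \<nu>
  proof -
    have "Lp_norm p \<Omega> (H \<nu>) < top"
      using le_less_trans[OF H_norm[OF that]] Lp_fin[OF that] by (simp add: Lp_norm_eq_pnorm)
    moreover have "H \<nu> \<in> borel_measurable ?M"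
      unfolding H_def using meas[OF that] by (rule borel_measurable_suminf)
    ultimately show ?thesis by (simp add: Lp_def)
  qed
  have H_sums: "(\<lambda>k. regular_dist \<Omega> (G k \<nu>) \<xi>) sums regular_dist \<Omega> (H \<nu>) \<xi>"
    if \<nu>: "mi_order \<nu> \<le> ?k" and \<xi>: "\<xi> \<in> test_fun \<Omega>" for \<nu> \<xi>
  proof -
    obtain K where K: "compact K" "K \<subseteq> \<Omega>" "\<And>x. x \<notin> K \<Longrightarrow> \<xi> x = 0"
      by (rule test_fun_support[OF \<xi>]) (rule that)
    obtain B where B: "\<And>x. \<bar>\<xi> x\<bar> \<le> B" by (rule test_fun_bounded[OF \<xi>]) (rule that)
    show ?thesis
      unfolding regular_dist_def H_def
      by (rule integral_suminf_mult_sums[OF p meas[OF \<nu>] Lp_fin[OF \<nu>]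
            borel_measurable_lebesgue_on[OF test_fun_borel[OF \<xi>]] B K(3) compact_lebesgue_on(1,2)[OF \<Omega> K(1,2)]])
  qed
  let ?o = "\<lambda>_::'n. 0::nat"
  have order0: "mi_order ?o \<le> ?k" by (simp add: mi_order_def)
  have f_sums: "(\<lambda>k. regular_dist \<Omega> (f k) \<xi>) sums regular_dist \<Omega> (H ?o) \<xi>" if "\<xi> \<in> test_fun \<Omega>" for \<xi>
    using H_sums[OF order0 that] G(2)[OF order0] that by (simp add: weak_deriv_def mi_order_def)
  have wd: "weak_deriv \<Omega> \<nu> (H ?o) (H \<nu>)" if \<nu>: "mi_order \<nu> \<le> ?k" for \<nu>
    unfolding weak_deriv_def
  proof
    fix \<xi> assume \<xi>: "\<xi> \<in> test_fun \<Omega>"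
    have "(\<lambda>k. regular_dist \<Omega> (G k \<nu>) \<xi>) sums ((- 1) ^ mi_order \<nu> * regular_dist \<Omega> (H ?o) (partials \<nu> \<xi>))"
      using sums_mult[OF f_sums[OF test_fun_partials[OF \<xi>]], of "(- 1) ^ mi_order \<nu>" \<nu>] G(2)[OF \<nu>] \<xi>
      by (simp add: weak_deriv_def)
    then show "regular_dist \<Omega> (H \<nu>) \<xi> = (- 1) ^ mi_order \<nu> * regular_dist \<Omega> (H ?o) (partials \<nu> \<xi>)"
      using H_sums[OF \<nu> \<xi>] sums_unique2 by blast
  qed
  have norm_H: "sobolev_norm s p \<Omega> (H ?o) \<le> (\<Sum>k. dist_sobolev_norm s p \<Omega> (w k))"
  proof -
    have "sobolev_norm s p \<Omega> (H ?o) = (\<Sum>\<nu> | mi_order \<nu> \<le> ?k. Lp_norm p \<Omega> (H \<nu>)) +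
      (if ?\<theta> = 0 then 0 else \<Sum>\<nu> | mi_order \<nu> = ?k. slobodeckij_seminorm ?\<theta> p \<Omega> (H \<nu>))"
      by (rule sobolev_norm_eq[OF \<Omega> p H_Lp wd])
    also have "\<dots> \<le> (\<Sum>k. dist_sobolev_norm s p \<Omega> (w k))"
      unfolding total
    proof (intro add_mono)
      show "(\<Sum>\<nu> | mi_order \<nu> \<le> ?k. Lp_norm p \<Omega> (H \<nu>)) \<le> (\<Sum>\<nu> | mi_order \<nu> \<le> ?k. \<Sum>k. Lp_norm p \<Omega> (G k \<nu>))"
        by (intro sum_mono H_norm) simp
      have "slobodeckij_seminorm ?\<theta> p \<Omega> (H \<nu>) \<le> (\<Sum>k. slobodeckij_seminorm ?\<theta> p \<Omega> (G k \<nu>))"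
        if \<nu>: "mi_order \<nu> = ?k" "?\<theta> \<noteq> 0" for \<nu>
        unfolding H_def
      proof (rule slobodeckij_suminf[OF \<Omega> p meas _ slob_fin[OF \<nu>]])
        show "AE x in ?M. summable (\<lambda>k. G k \<nu> x)"
          using AE[of \<nu>] \<nu>(1) by (auto elim!: eventually_mono intro: summable_rabs_cancel)
      qed (use \<nu> in simp)
      then show "(if ?\<theta> = 0 then 0 else \<Sum>\<nu> | mi_order \<nu> = ?k. slobodeckij_seminorm ?\<theta> p \<Omega> (H \<nu>)) \<le>
          (if ?\<theta> = 0 then 0 else \<Sum>\<nu> | mi_order \<nu> = ?k. \<Sum>k. slobodeckij_seminorm ?\<theta> p \<Omega> (G k \<nu>))"
        by (auto intro!: sum_mono)
    qed
    finally show ?thesis .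
  qed
  have H_space: "H ?o \<in> sobolev_space s p \<Omega>"
    using le_less_trans[OF norm_H fin] H_Lp[OF order0] by (simp add: sobolev_space_def)
  have w_sums: "(\<lambda>k. w k \<xi>) sums regular_dist \<Omega> (H ?o) \<xi>" if "\<xi> \<in> test_fun \<Omega>" for \<xi>
    using f_sums[OF that] f(2)[OF that] by simp
  have "dist_sobolev_norm s p \<Omega> (\<lambda>\<xi>. \<Sum>k. w k \<xi>) = sobolev_norm s p \<Omega> (H ?o)"
    by (rule dist_sobolev_norm_eq[OF s H_space]) (rule sums_unique[symmetric, OF w_sums])
  then show ?thesis using norm_H w_sums by (auto intro: sums_summable)
qed

subsection \<open>Negative order\<close>

lemma dist_sobolev_norm_neg:
  "s < 0 \<Longrightarrow> dist_sobolev_norm s q \<Omega> v =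
    (INF F\<in>{F \<in> sobolev_dual (- s) (q / (q - 1)) \<Omega>. \<forall>\<xi>\<in>test_fun \<Omega>. v \<xi> = F \<xi>}. dual_norm (- s) (q / (q - 1)) \<Omega> F)"
  by (simp add: dist_sobolev_norm_def Let_def)

text \<open>Rescale to norm one. If the norm is zero, all multiples of \<open>f\<close> are admissible in the supremum that
defines the dual norm, which forces the value at \<open>f\<close> to vanish.\<close>

lemma sobolev_dual_bound:
  assumes \<Omega>: "open \<Omega>" and p: "1 \<le> p" and F: "F \<in> sobolev_dual s p \<Omega>" and f: "f \<in> sobolev_space0 s p \<Omega>"
  shows "ennreal \<bar>F f\<bar> \<le> dual_norm s p \<Omega> F * sobolev_norm s p \<Omega> f"
proof -
  define D where "D = enn2real (dual_norm s p \<Omega> F)"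
  define n where "n = enn2real (sobolev_norm s p \<Omega> f)"
  have fin: "sobolev_norm s p \<Omega> f < top" using f by (simp add: sobolev_space0_def sobolev_space_def)
  have D: "dual_norm s p \<Omega> F = ennreal D" "D \<ge> 0" using F by (auto simp: sobolev_dual_def D_def less_top)
  have n: "sobolev_norm s p \<Omega> f = ennreal n" "n \<ge> 0" using fin by (auto simp: n_def less_top)
  have scale: "c * \<bar>F f\<bar> \<le> D" if c: "c \<ge> 0" "c * n \<le> 1" for c
  proof -
    have "sobolev_norm s p \<Omega> (\<lambda>x. c * f x) = ennreal (c * n)"
      using sobolev_norm_cmult[OF \<Omega> p fin, of c] c n by (simp add: ennreal_mult)
    then have "sobolev_norm s p \<Omega> (\<lambda>x. c * f x) \<le> 1" using c by simp
    then have "ennreal \<bar>F (\<lambda>x. c * f x)\<bar> \<le> dual_norm s p \<Omega> F"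
      unfolding dual_norm_def using sobolev_space0_cmult[OF \<Omega> p f] by (intro SUP_upper) simp
    moreover have "F (\<lambda>x. c * f x) = c * F f" using F f by (simp add: sobolev_dual_def)
    ultimately show ?thesis using c D by (simp add: abs_mult)
  qed
  have "\<bar>F f\<bar> \<le> D * n"
  proof (cases "n = 0")
    case True
    have "\<bar>F f\<bar> = 0"
    proof (rule ccontr)
      assume "\<bar>F f\<bar> \<noteq> 0"
      then have "(D + 1) / \<bar>F f\<bar> * \<bar>F f\<bar> = D + 1" by simp
      moreover have "(D + 1) / \<bar>F f\<bar> * \<bar>F f\<bar> \<le> D" using True D by (intro scale) auto
      ultimately show False by simp
    qed
    then show ?thesis using True by simp
  next
    case False
    then show ?thesis using scale[of "1 / n"] n by (simp add: divide_le_eq)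
  qed
  then show ?thesis using D n by (simp add: ennreal_mult[symmetric] ennreal_leI)
qed

text \<open>For negative order representatives are chosen with norm below \<open>b\<^sub>k\<close>, where the \<open>b\<^sub>k\<close> exceed the norms by
\<open>\<epsilon>\<close> in total, and summed pointwise as functionals. On test functions the sum is independent of the
choice, so \<open>\<epsilon>\<close> may tend to zero.\<close>

lemma dist_sobolev_norm_suminf_neg:
  fixes \<Omega> :: "(real^'n::finite) set"
  assumes \<Omega>: "open \<Omega>" and q: "1 < q" and s: "s < 0" and fin: "(\<Sum>k. dist_sobolev_norm s q \<Omega> (w k)) < top"
  shows "(\<forall>\<xi>\<in>test_fun \<Omega>. summable (\<lambda>k. w k \<xi>)) \<and>
    dist_sobolev_norm s q \<Omega> (\<lambda>\<xi>. \<Sum>k. w k \<xi>) \<le> (\<Sum>k. dist_sobolev_norm s q \<Omega> (w k))"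
proof -
  define p where "p = q / (q - 1)"
  have p: "1 \<le> p" using q by (simp add: p_def)
  note dsn = dist_sobolev_norm_neg[OF s, of q, folded p_def]
  have main: "(\<forall>\<xi>\<in>test_fun \<Omega>. summable (\<lambda>k. w k \<xi>)) \<and>
      dist_sobolev_norm s q \<Omega> (\<lambda>\<xi>. \<Sum>k. w k \<xi>) \<le> (\<Sum>k. dist_sobolev_norm s q \<Omega> (w k)) + ennreal \<epsilon>"
    if "\<epsilon> > 0" for \<epsilon> :: real
  proof -
    obtain b B where b: "\<And>k. 0 < b k" "b sums B" "\<And>k. dist_sobolev_norm s q \<Omega> (w k) < ennreal (b k)"
      "ennreal B \<le> (\<Sum>k. dist_sobolev_norm s q \<Omega> (w k)) + ennreal \<epsilon>"
      by (rule ex_positive_majorant[OF fin \<open>\<epsilon> > 0\<close>]) (rule that)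
    have "\<forall>k. \<exists>F. F \<in> sobolev_dual (- s) p \<Omega> \<and> (\<forall>\<xi>\<in>test_fun \<Omega>. w k \<xi> = F \<xi>) \<and> dual_norm (- s) p \<Omega> F < ennreal (b k)"
      using b(3) unfolding dsn INF_less_iff by blast
    then obtain F where F: "\<And>k. F k \<in> sobolev_dual (- s) p \<Omega>" "\<And>k \<xi>. \<xi> \<in> test_fun \<Omega> \<Longrightarrow> w k \<xi> = F k \<xi>"
      "\<And>k. dual_norm (- s) p \<Omega> (F k) < ennreal (b k)"
      by metis
    define S where "S f = (\<Sum>k. F k f)" for f
    have bound: "\<bar>F k f\<bar> \<le> b k * enn2real (sobolev_norm (- s) p \<Omega> f)" if f: "f \<in> sobolev_space0 (- s) p \<Omega>" for f k
    proof -
      have nf: "sobolev_norm (- s) p \<Omega> f = ennreal (enn2real (sobolev_norm (- s) p \<Omega> f))"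
        using f by (simp add: sobolev_space0_def sobolev_space_def less_top)
      have "ennreal \<bar>F k f\<bar> \<le> dual_norm (- s) p \<Omega> (F k) * sobolev_norm (- s) p \<Omega> f"
        by (rule sobolev_dual_bound[OF \<Omega> p F(1) f])
      also have "\<dots> \<le> ennreal (b k) * sobolev_norm (- s) p \<Omega> f"
        using F(3)[of k] by (intro mult_right_mono) auto
      also have "\<dots> = ennreal (b k * enn2real (sobolev_norm (- s) p \<Omega> f))"
        using b(1)[of k] by (subst nf, subst ennreal_mult) auto
      finally show ?thesis using b(1)[of k] by (subst (asm) ennreal_le_iff) auto
    qed
    have sm: "summable (\<lambda>k. F k f)" and Sb: "\<bar>S f\<bar> \<le> B * enn2real (sobolev_norm (- s) p \<Omega> f)"
      if f: "f \<in> sobolev_space0 (- s) p \<Omega>" for f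
    proof -
      have bs: "(\<lambda>k. b k * enn2real (sobolev_norm (- s) p \<Omega> f)) sums (B * enn2real (sobolev_norm (- s) p \<Omega> f))"
        by (rule sums_mult2[OF b(2)])
      have abs: "summable (\<lambda>k. \<bar>F k f\<bar>)"
        by (rule summable_comparison_test'[OF sums_summable[OF bs], of 0]) (use bound[OF f] in simp)
      then show "summable (\<lambda>k. F k f)" by (rule summable_rabs_cancel)
      have "\<bar>S f\<bar> \<le> (\<Sum>k. \<bar>F k f\<bar>)" unfolding S_def by (rule summable_rabs[OF abs])
      also have "\<dots> \<le> (\<Sum>k. b k * enn2real (sobolev_norm (- s) p \<Omega> f))"
        by (rule suminf_le[OF bound[OF f] abs sums_summable[OF bs]])
      also have "\<dots> = B * enn2real (sobolev_norm (- s) p \<Omega> f)" by (rule sums_unique[symmetric, OF bs])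
      finally show "\<bar>S f\<bar> \<le> B * enn2real (sobolev_norm (- s) p \<Omega> f)" .
    qed
    have B0: "B \<ge> 0" using sums_le[OF _ sums_zero b(2)] b(1) by (simp add: less_imp_le)
    have dn: "dual_norm (- s) p \<Omega> S \<le> ennreal B"
      unfolding dual_norm_def
    proof (rule SUP_least)
      fix f assume f: "f \<in> {f \<in> sobolev_space0 (- s) p \<Omega>. sobolev_norm (- s) p \<Omega> f \<le> 1}"
      then have "enn2real (sobolev_norm (- s) p \<Omega> f) \<le> 1" using enn2real_mono[of _ 1] by simp
      then have "\<bar>S f\<bar> \<le> B" using Sb[of f] f mult_left_mono[OF _ B0] by fastforce
      then show "ennreal \<bar>S f\<bar> \<le> ennreal B" by (rule ennreal_leI)
    qed
    have S: "S \<in> sobolev_dual (- s) p \<Omega>"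
      unfolding sobolev_dual_def
    proof (intro CollectI conjI ballI allI)
      show "S (\<lambda>x. f x + g x) = S f + S g"
        if "f \<in> sobolev_space0 (- s) p \<Omega>" "g \<in> sobolev_space0 (- s) p \<Omega>" for f g
        unfolding S_def using F(1) that by (subst suminf_add[OF sm sm]) (auto simp: sobolev_dual_def)
      show "S (\<lambda>x. c * f x) = c * S f" if "f \<in> sobolev_space0 (- s) p \<Omega>" for c f
        unfolding S_def using F(1) that by (subst suminf_mult[OF sm, symmetric]) (auto simp: sobolev_dual_def)
      show "dual_norm (- s) p \<Omega> S < top" using dn by (rule le_less_trans) simp
    qed
    have t0: "\<xi> \<in> sobolev_space0 (- s) p \<Omega>" if "\<xi> \<in> test_fun \<Omega>" for \<xi>
      using s by (intro test_fun_sobolev_space0[OF \<Omega> p _ that]) simp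
    have "dist_sobolev_norm s q \<Omega> (\<lambda>\<xi>. \<Sum>k. w k \<xi>) \<le> dual_norm (- s) p \<Omega> S"
      unfolding dsn using S F(2) by (intro INF_lower) (auto simp: S_def)
    also note dn
    also note b(4)
    finally show ?thesis using sm[OF t0] F(2) by simp
  qed
  have "dist_sobolev_norm s q \<Omega> (\<lambda>\<xi>. \<Sum>k. w k \<xi>) \<le> (\<Sum>k. dist_sobolev_norm s q \<Omega> (w k))"
  proof (rule ennreal_le_epsilon)
    fix \<epsilon> :: real assume "0 < \<epsilon>"
    then show "dist_sobolev_norm s q \<Omega> (\<lambda>\<xi>. \<Sum>k. w k \<xi>) \<le> (\<Sum>k. dist_sobolev_norm s q \<Omega> (w k)) + ennreal \<epsilon>"
      using main by blast
  qed
  then show ?thesis using main[of 1] by simp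
qed

lemma dist_sobolev_norm_suminf:
  fixes \<Omega> :: "(real^'n::finite) set"
  assumes "open \<Omega>" "1 < q" "(\<Sum>k. dist_sobolev_norm s q \<Omega> (w k)) < top"
  shows summable_of_dist_sobolev_norm: "\<xi> \<in> test_fun \<Omega> \<Longrightarrow> summable (\<lambda>k. w k \<xi>)"
    and dist_sobolev_norm_suminf_le:
      "dist_sobolev_norm s q \<Omega> (\<lambda>\<xi>. \<Sum>k. w k \<xi>) \<le> (\<Sum>k. dist_sobolev_norm s q \<Omega> (w k))"
  using dist_sobolev_norm_suminf_nonneg[of \<Omega> q s w] dist_sobolev_norm_suminf_neg[of \<Omega> q s w] assms
  by (cases "0 \<le> s"; simp)+

subsection \<open>Homogeneity and continuity on test functions\<close>

lemma dist_sobolev_norm_zero: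
  fixes \<Omega> :: "(real^'n::finite) set"
  assumes \<Omega>: "open \<Omega>" and q: "1 < q"
  shows "dist_sobolev_norm s q \<Omega> (\<lambda>\<xi>. 0) = 0"
proof (cases "0 \<le> s")
  case True
  have "(\<lambda>x. 0) \<in> sobolev_space s q \<Omega>"
    using \<Omega> q by (simp add: sobolev_space_def Lp_zero sobolev_norm_zero)
  then have "dist_sobolev_norm s q \<Omega> (\<lambda>\<xi>. 0) = sobolev_norm s q \<Omega> (\<lambda>x. 0)"
    by (rule dist_sobolev_norm_eq[OF True]) (simp add: regular_dist_def)
  then show ?thesis using \<Omega> q by (simp add: sobolev_norm_zero)
next
  case False
  let ?p = "q / (q - 1)"
  have d: "dual_norm (- s) ?p \<Omega> (\<lambda>_. 0) \<le> 0" unfolding dual_norm_def by (rule SUP_least) simp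
  then have "(\<lambda>_. 0) \<in> sobolev_dual (- s) ?p \<Omega>"
    by (simp add: sobolev_dual_def)
  then have "(INF F\<in>{F \<in> sobolev_dual (- s) ?p \<Omega>. \<forall>\<xi>\<in>test_fun \<Omega>. 0 = F \<xi>}. dual_norm (- s) ?p \<Omega> F) \<le>
      dual_norm (- s) ?p \<Omega> (\<lambda>_. 0)"
    by (intro INF_lower) simp
  then have "dist_sobolev_norm s q \<Omega> (\<lambda>\<xi>. 0) \<le> dual_norm (- s) ?p \<Omega> (\<lambda>_. 0)"
    unfolding dist_sobolev_norm_def Let_def using False by simp
  then show ?thesis using d by simp
qed

lemma dist_sobolev_norm_cmult:
  fixes \<Omega> :: "(real^'n::finite) set"
  assumes \<Omega>: "open \<Omega>" and q: "1 < q" and v: "dist_sobolev_norm s q \<Omega> v < top"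
  shows "dist_sobolev_norm s q \<Omega> (\<lambda>\<xi>. c * v \<xi>) \<le> ennreal \<bar>c\<bar> * dist_sobolev_norm s q \<Omega> v"
proof (cases "0 \<le> s")
  case True
  have p: "1 \<le> q" using q by simp
  obtain f where f: "f \<in> sobolev_space s q \<Omega>" "\<And>\<xi>. \<xi> \<in> test_fun \<Omega> \<Longrightarrow> v \<xi> = regular_dist \<Omega> f \<xi>"
    "dist_sobolev_norm s q \<Omega> v = sobolev_norm s q \<Omega> f"
    by (rule dist_sobolev_norm_representative[OF True v]) (rule that)
  have "dist_sobolev_norm s q \<Omega> (\<lambda>\<xi>. c * v \<xi>) = sobolev_norm s q \<Omega> (\<lambda>x. c * f x)"
    by (rule dist_sobolev_norm_eq[OF True sobolev_space_cmult[OF \<Omega> p f(1)]]) (simp add: regular_dist_cmult f(2))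
  also have "\<dots> = ennreal \<bar>c\<bar> * sobolev_norm s q \<Omega> f"
    using f(1) by (intro sobolev_norm_cmult[OF \<Omega> p]) (simp add: sobolev_space_def)
  finally show ?thesis using f(3) by simp
next
  case False
  define p where "p = q / (q - 1)"
  have "s < 0" using False by simp
  note dsn = dist_sobolev_norm_neg[OF this, of q, folded p_def]
  have dn: "dual_norm (- s) p \<Omega> (\<lambda>f. c * F f) = ennreal \<bar>c\<bar> * dual_norm (- s) p \<Omega> F" for F
    unfolding dual_norm_def by (simp add: SUP_mult_left_ennreal abs_mult ennreal_mult)
  have le: "dist_sobolev_norm s q \<Omega> (\<lambda>\<xi>. c * v \<xi>) \<le> ennreal \<bar>c\<bar> * dual_norm (- s) p \<Omega> F"
    if F: "F \<in> sobolev_dual (- s) p \<Omega>" "\<forall>\<xi>\<in>test_fun \<Omega>. v \<xi> = F \<xi>" for F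
  proof -
    have "(\<lambda>f. c * F f) \<in> sobolev_dual (- s) p \<Omega>"
      using F(1) by (auto simp: sobolev_dual_def dn ennreal_mult_less_top algebra_simps)
    then have "dist_sobolev_norm s q \<Omega> (\<lambda>\<xi>. c * v \<xi>) \<le> dual_norm (- s) p \<Omega> (\<lambda>f. c * F f)"
      unfolding dsn using F(2) by (intro INF_lower) auto
    then show ?thesis by (simp add: dn)
  qed
  show ?thesis
  proof (cases "c = 0")
    case True
    then show ?thesis using dist_sobolev_norm_zero[OF \<Omega> q] by simp
  next
    case c: False
    have "ennreal (1 / \<bar>c\<bar>) * dist_sobolev_norm s q \<Omega> (\<lambda>\<xi>. c * v \<xi>) \<le> dist_sobolev_norm s q \<Omega> v"
      unfolding dsn[where v=v]
    proof (rule INF_greatest)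
      fix F assume "F \<in> {F \<in> sobolev_dual (- s) p \<Omega>. \<forall>\<xi>\<in>test_fun \<Omega>. v \<xi> = F \<xi>}"
      then have "ennreal (1 / \<bar>c\<bar>) * dist_sobolev_norm s q \<Omega> (\<lambda>\<xi>. c * v \<xi>) \<le>
          ennreal (1 / \<bar>c\<bar>) * (ennreal \<bar>c\<bar> * dual_norm (- s) p \<Omega> F)"
        by (intro mult_left_mono le) auto
      also have "\<dots> = dual_norm (- s) p \<Omega> F"
        using c by (simp add: mult.assoc[symmetric] ennreal_mult[symmetric])
      finally show "ennreal (1 / \<bar>c\<bar>) * dist_sobolev_norm s q \<Omega> (\<lambda>\<xi>. c * v \<xi>) \<le> dual_norm (- s) p \<Omega> F" .
    qed
    then have "ennreal \<bar>c\<bar> * (ennreal (1 / \<bar>c\<bar>) * dist_sobolev_norm s q \<Omega> (\<lambda>\<xi>. c * v \<xi>)) \<le>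
        ennreal \<bar>c\<bar> * dist_sobolev_norm s q \<Omega> v"
      by (intro mult_left_mono) auto
    then show ?thesis using c by (simp add: mult.assoc[symmetric] ennreal_mult[symmetric])
  qed
qed

text \<open>Elements of Sobolev spaces of any order are continuous functionals on the test functions supported
in a fixed compact set, with constants that depend on the set and the order but not on the element.\<close>

lemma dist_sobolev_norm_bound:
  fixes K \<Omega> :: "(real^'n::finite) set"
  assumes \<Omega>: "open \<Omega>" and q: "1 < q" and K: "compact K" "K \<subseteq> \<Omega>"
  shows "\<exists>C\<ge>0. \<exists>m. \<forall>v \<xi> B. dist_sobolev_norm s q \<Omega> v < top \<longrightarrow> \<xi> \<in> test_fun \<Omega> \<longrightarrow> (\<forall>x. x \<notin> K \<longrightarrow> \<xi> x = 0) \<longrightarrow>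
    0 \<le> B \<longrightarrow> (\<forall>\<nu> y. mi_order \<nu> \<le> m \<longrightarrow> y \<in> K \<longrightarrow> \<bar>partials \<nu> \<xi> y\<bar> \<le> B) \<longrightarrow>
    ennreal \<bar>v \<xi>\<bar> \<le> ennreal (C * B) * dist_sobolev_norm s q \<Omega> v"
proof (cases "0 \<le> s")
  case True
  have p: "1 \<le> q" using q by simp
  show ?thesis
  proof (intro exI[of _ "measure lborel K + 1"] exI[of _ 0] conjI allI impI)
    fix v \<xi> B assume v: "dist_sobolev_norm s q \<Omega> v < top" and \<xi>: "\<xi> \<in> test_fun \<Omega>" "\<forall>x. x \<notin> K \<longrightarrow> \<xi> x = 0"
      and B: "0 \<le> B" "\<forall>\<nu> y. mi_order \<nu> \<le> 0 \<longrightarrow> y \<in> K \<longrightarrow> \<bar>partials \<nu> \<xi> y\<bar> \<le> B"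
    let ?o = "\<lambda>_::'n. 0::nat"
    obtain f where f: "f \<in> sobolev_space s q \<Omega>" "\<And>\<xi>. \<xi> \<in> test_fun \<Omega> \<Longrightarrow> v \<xi> = regular_dist \<Omega> f \<xi>"
      "dist_sobolev_norm s q \<Omega> v = sobolev_norm s q \<Omega> f"
      by (rule dist_sobolev_norm_representative[OF True v]) (rule that)
    obtain G where G: "\<And>\<nu>. mi_order \<nu> \<le> sob_order s \<Longrightarrow> G \<nu> \<in> Lp q \<Omega>"
      "\<And>\<nu>. mi_order \<nu> \<le> sob_order s \<Longrightarrow> weak_deriv \<Omega> \<nu> f (G \<nu>)"
      by (rule sobolev_norm_finiteE[of s q \<Omega> f]) (use f(1) that in \<open>auto simp: sobolev_space_def\<close>)
    have 0: "mi_order ?o \<le> sob_order s" by (simp add: mi_order_def)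
    have "v \<xi> = regular_dist \<Omega> (G ?o) \<xi>"
      using f(2)[OF \<xi>(1)] G(2)[OF 0] \<xi>(1) by (simp add: weak_deriv_def mi_order_def)
    then have "ennreal \<bar>v \<xi>\<bar> \<le> ennreal (B * (measure lborel K + 1)) * Lp_norm q \<Omega> (G ?o)"
      using \<xi>(2) B(2)[rule_format, of ?o] B(1)
      by (simp only:, intro abs_regular_dist_le[OF \<Omega> p G(1)[OF 0] \<xi>(1) K]) (auto simp: mi_order_def)
    also have "\<dots> \<le> ennreal (B * (measure lborel K + 1)) * sobolev_norm s q \<Omega> f"
    proof (rule mult_left_mono)
      have "Lp_norm q \<Omega> (G ?o) \<le> (\<Sum>\<nu> | mi_order \<nu> \<le> sob_order s. Lp_norm q \<Omega> (G \<nu>))"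
        using 0 finite_mi_order_le by (intro member_le_sum[where f="\<lambda>\<nu>. Lp_norm q \<Omega> (G \<nu>)"]) auto
      also have "\<dots> \<le> sobolev_norm s q \<Omega> f"
        by (subst sobolev_norm_eq[OF \<Omega> p G]) auto
      finally show "Lp_norm q \<Omega> (G ?o) \<le> sobolev_norm s q \<Omega> f" .
    qed simp
    finally show "ennreal \<bar>v \<xi>\<bar> \<le> ennreal ((measure lborel K + 1) * B) * dist_sobolev_norm s q \<Omega> v"
      unfolding f(3) by (simp only: mult.commute)
  qed simp
next
  case False
  define p where "p = q / (q - 1)"
  have p: "1 \<le> p" using q by (simp add: p_def)
  have "s < 0" using False by simp
  note dsn = dist_sobolev_norm_neg[OF this, of q, folded p_def]
  have s: "0 \<le> - s" using False by simp
  show ?thesis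
  proof (rule sobolev_norm_test_fun_bound[OF \<Omega> K(1) p s])
    fix C assume C: "C \<ge> 0" "\<And>\<xi> B. \<lbrakk>\<xi> \<in> test_fun \<Omega>; \<And>x. x \<notin> K \<Longrightarrow> \<xi> x = 0; 0 \<le> B;
        \<And>\<nu> y. mi_order \<nu> \<le> Suc (sob_order (- s)) \<Longrightarrow> y \<in> K \<Longrightarrow> \<bar>partials \<nu> \<xi> y\<bar> \<le> B\<rbrakk>
      \<Longrightarrow> sobolev_norm (- s) p \<Omega> \<xi> \<le> ennreal (C * B)"
    show ?thesis
    proof (intro exI[of _ C] exI[of _ "Suc (sob_order (- s))"] conjI allI impI)
      fix v \<xi> B assume v: "dist_sobolev_norm s q \<Omega> v < top" and \<xi>: "\<xi> \<in> test_fun \<Omega>" "\<forall>x. x \<notin> K \<longrightarrow> \<xi> x = 0"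
        and B: "0 \<le> B" "\<forall>\<nu> y. mi_order \<nu> \<le> Suc (sob_order (- s)) \<longrightarrow> y \<in> K \<longrightarrow> \<bar>partials \<nu> \<xi> y\<bar> \<le> B"
      have n: "sobolev_norm (- s) p \<Omega> \<xi> \<le> ennreal (C * B)"
        by (rule C(2)[OF \<xi>(1)]) (use \<xi>(2) B in auto)
      have le: "ennreal \<bar>v \<xi>\<bar> \<le> ennreal (C * B) * dual_norm (- s) p \<Omega> F"
        if F: "F \<in> sobolev_dual (- s) p \<Omega>" "\<forall>\<xi>\<in>test_fun \<Omega>. v \<xi> = F \<xi>" for F
      proof -
        have "ennreal \<bar>v \<xi>\<bar> \<le> dual_norm (- s) p \<Omega> F * sobolev_norm (- s) p \<Omega> \<xi>"
          using sobolev_dual_bound[OF \<Omega> p F(1) test_fun_sobolev_space0[OF \<Omega> p s \<xi>(1)]] F(2) \<xi>(1) by simp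
        also have "\<dots> \<le> dual_norm (- s) p \<Omega> F * ennreal (C * B)" by (intro mult_left_mono n) simp
        finally show ?thesis by (simp add: mult.commute)
      qed
      show "ennreal \<bar>v \<xi>\<bar> \<le> ennreal (C * B) * dist_sobolev_norm s q \<Omega> v"
      proof (rule ennreal_le_epsilon)
        fix \<epsilon> :: real assume "0 < \<epsilon>"
        define \<delta> where "\<delta> = \<epsilon> / (C * B + 1)"
        have CB: "C * B \<ge> 0" using C(1) B(1) by simp
        then have \<delta>: "\<delta> > 0" "C * B * \<delta> \<le> \<epsilon>"
          using \<open>0 < \<epsilon>\<close> by (auto simp: \<delta>_def divide_le_eq add_nonneg_pos algebra_simps)
        have "dist_sobolev_norm s q \<Omega> v < dist_sobolev_norm s q \<Omega> v + ennreal \<delta>"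
          using v \<delta>(1) by (simp add: ennreal_add_left_cancel_less[of _ 0, simplified])
        then obtain F where F: "F \<in> sobolev_dual (- s) p \<Omega>" "\<forall>\<xi>\<in>test_fun \<Omega>. v \<xi> = F \<xi>"
          "dual_norm (- s) p \<Omega> F < dist_sobolev_norm s q \<Omega> v + ennreal \<delta>"
          unfolding dsn[where v=v] INF_less_iff by blast
        have "ennreal \<bar>v \<xi>\<bar> \<le> ennreal (C * B) * (dist_sobolev_norm s q \<Omega> v + ennreal \<delta>)"
          using le[OF F(1,2)] F(3) by (meson less_imp_le mult_left_mono order_trans zero_le)
        also have "\<dots> = ennreal (C * B) * dist_sobolev_norm s q \<Omega> v + ennreal (C * B * \<delta>)"
          using CB \<delta>(1) by (simp add: distrib_left ennreal_mult)
        also have "\<dots> \<le> ennreal (C * B) * dist_sobolev_norm s q \<Omega> v + ennreal \<epsilon>"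
          by (intro add_left_mono ennreal_leI \<delta>)
        finally show "ennreal \<bar>v \<xi>\<bar> \<le> ennreal (C * B) * dist_sobolev_norm s q \<Omega> v + ennreal \<epsilon>" .
      qed
    qed (rule C(1))
  qed
qed

section \<open>Completeness by absolutely convergent series\<close>

text \<open>A space of functions on which absolutely norm convergent series converge pointwise, with the
  sum bounded by the sum of the norms, is a Banach space: the triangle inequality is the case of two
  summands, and a Cauchy sequence has a subsequence with summable increments.\<close>

lemma banach_space_on_of_series:
  fixes D :: "('a \<Rightarrow> real) set" and N :: "('a \<Rightarrow> real) \<Rightarrow> ennreal"
  assumes N_zero: "(\<lambda>z. 0) \<in> D" "N (\<lambda>z. 0) = 0"
    and D_cmult: "\<And>t u. u \<in> D \<Longrightarrow> (\<lambda>z. t * u z) \<in> D"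
    and N_cmult: "\<And>t u. N u < top \<Longrightarrow> N (\<lambda>z. t * u z) \<le> ennreal \<bar>t\<bar> * N u"
    and definite: "\<And>u. u \<in> D \<Longrightarrow> N u = 0 \<Longrightarrow> u = (\<lambda>z. 0)"
    and series: "\<And>w. (\<And>k. w k \<in> D) \<Longrightarrow> (\<Sum>k. N (w k)) < top \<Longrightarrow>
      (\<forall>z. summable (\<lambda>k. w k z)) \<and> (\<lambda>z. \<Sum>k. w k z) \<in> D \<and> N (\<lambda>z. \<Sum>k. w k z) \<le> (\<Sum>k. N (w k))"
  shows "banach_space_on {u \<in> D. N u < top} (\<lambda>u. enn2real (N u))"
proof -
  define V where "V = {u \<in> D. N u < top}"
  have homog: "N (\<lambda>z. t * u z) = ennreal \<bar>t\<bar> * N u" if "N u < top" for t u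
  proof (cases "t = 0")
    case False
    have fin: "N (\<lambda>z. t * u z) < top"
      using N_cmult[OF that, of t] that by (auto simp: ennreal_mult_less_top intro: le_less_trans)
    have "N u \<le> ennreal \<bar>1 / t\<bar> * N (\<lambda>z. t * u z)"
      using N_cmult[OF fin, of "1 / t"] False by simp
    then have "ennreal \<bar>t\<bar> * N u \<le> ennreal \<bar>t\<bar> * (ennreal \<bar>1 / t\<bar> * N (\<lambda>z. t * u z))"
      by (intro mult_left_mono) auto
    also have "\<dots> = N (\<lambda>z. t * u z)"
      using False by (simp add: mult.assoc[symmetric] ennreal_mult[symmetric])
    finally show ?thesis using N_cmult[OF that, of t] by (intro antisym)
  qed (simp add: N_zero)
  have N_neg: "N (\<lambda>z. - u z) = N u" for u
  proof -
    have le: "N (\<lambda>z. - u z) = N u" if "N u < top" for u using homog[OF that, of "-1"] by simp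
    show ?thesis
    proof (cases "N u < top \<or> N (\<lambda>z. - u z) < top")
      case True
      then show ?thesis using le[of u] le[of "\<lambda>z. - u z"] by auto
    next
      case False
      then show ?thesis by (metis less_top)
    qed
  qed
  have add: "(\<lambda>z. u z + v z) \<in> V \<and> N (\<lambda>z. u z + v z) \<le> N u + N v" if u: "u \<in> V" and v: "v \<in> V" for u v
  proof -
    define w where "w k = (if k = 0 then u else if k = Suc 0 then v else (\<lambda>z. 0))" for k :: nat
    have sums2: "(\<lambda>k. F (w k)) sums (F u + F v)" if "F (\<lambda>x. 0) = 0"
      for F :: "('a \<Rightarrow> real) \<Rightarrow> 'b::{comm_monoid_add, t2_space}"
      using sums_finite[of "{0, Suc 0}" "\<lambda>k. F (w k)"] that by (simp add: w_def)
    have D: "w k \<in> D" for k using u v N_zero by (simp add: w_def V_def)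
    have sN: "(\<Sum>k. N (w k)) = N u + N v"
      by (rule sums_unique[symmetric], rule sums2) (rule N_zero(2))
    then have fin: "(\<Sum>k. N (w k)) < top" using u v by (simp add: V_def)
    have "(\<Sum>k. w k z) = u z + v z" for z
      by (rule sums_unique[symmetric], rule sums2) simp
    then show ?thesis using series[OF D fin] fin by (auto simp: V_def sN intro: le_less_trans)
  qed
  have cmult: "(\<lambda>z. t * u z) \<in> V" if "u \<in> V" for t u
    using that by (auto simp: V_def D_cmult homog ennreal_mult_less_top)
  have diff: "(\<lambda>z. u z - v z) \<in> V" if "u \<in> V" "v \<in> V" for u v
    using add[OF that(1) cmult[OF that(2), of "-1"]] by simp
  have real_N: "N u = ennreal (enn2real (N u))" if "u \<in> V" for u using that by (simp add: V_def less_top)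
  let ?d = "\<lambda>u v. enn2real (N (\<lambda>z. u z - v z))"
  interpret Metric_space V ?d
  proof
    show "0 \<le> ?d u v" for u v by simp
    show "?d u v = ?d v u" for u v using N_neg[of "\<lambda>z. u z - v z"] by simp
    show "?d u v = 0 \<longleftrightarrow> u = v" if "u \<in> V" "v \<in> V" for u v
    proof
      assume "?d u v = 0"
      then have "N (\<lambda>z. u z - v z) = 0" using real_N[OF diff[OF that]] by simp
      then have "(\<lambda>z. u z - v z) = (\<lambda>z. 0)" using diff[OF that] by (intro definite) (auto simp: V_def)
      then show "u = v" by (simp add: fun_eq_iff)
    qed (simp add: N_zero)
    show "?d u w \<le> ?d u v + ?d v w" if "u \<in> V" "v \<in> V" "w \<in> V" for u v w
    proof -
      have "N (\<lambda>z. u z - w z) \<le> N (\<lambda>z. u z - v z) + N (\<lambda>z. v z - w z)"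
        using add[OF diff[OF that(1,2)] diff[OF that(2,3)]] by simp
      then have "ennreal (?d u w) \<le> ennreal (?d u v + ?d v w)"
        using real_N[OF diff[OF that(1,2)]] real_N[OF diff[OF that(2,3)]] real_N[OF diff[OF that(1,3)]] by simp
      then show ?thesis by (subst (asm) ennreal_le_iff) auto
    qed
  qed
  have complete: "mcomplete"
    unfolding mcomplete_def
  proof (intro allI impI)
    fix \<sigma> assume cau: "MCauchy \<sigma>"
    have \<sigma>: "\<sigma> n \<in> V" for n using cau by (auto simp: MCauchy_def)
    have "\<forall>k. \<exists>M. \<forall>n n'. M \<le> n \<longrightarrow> M \<le> n' \<longrightarrow> ?d (\<sigma> n) (\<sigma> n') < (1 / 2) ^ k"
      using cau by (auto simp: MCauchy_def)
    then obtain M where M: "\<And>k n n'. M k \<le> n \<Longrightarrow> M k \<le> n' \<Longrightarrow> ?d (\<sigma> n) (\<sigma> n') < (1 / 2) ^ k" by metis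
    \<comment> \<open>A strictly increasing choice of indices with \<open>r k\<close> at least \<open>M k\<close>.\<close>
    define r where "r k = k + (\<Sum>j\<le>k. M j)" for k
    have r: "strict_mono r" by (rule strict_monoI_Suc) (simp add: r_def)
    have rM: "M k \<le> r k" for k
      using member_le_sum[of k "{..k}" M] by (simp add: r_def)
    define w where "w k = (\<lambda>z. \<sigma> (r (Suc k)) z - \<sigma> (r k) z)" for k
    have wV: "w k \<in> V" for k unfolding w_def by (rule diff[OF \<sigma> \<sigma>])
    have wN: "N (w k) \<le> ennreal ((1 / 2) ^ k)" for k
    proof -
      have "M k \<le> r (Suc k)" using rM[of k] strict_monoD[OF r, of k "Suc k"] by simp
      then have "enn2real (N (w k)) \<le> (1 / 2) ^ k"
        unfolding w_def using M[of k "r (Suc k)" "r k"] rM[of k] by simp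
      then show ?thesis by (subst real_N[OF wV]) (rule ennreal_leI)
    qed
    have tail: "(\<Sum>k. N (w (k + m))) \<le> ennreal (2 * (1 / 2) ^ m)" for m
    proof -
      have "(\<Sum>k. N (w (k + m))) \<le> (\<Sum>k. ennreal ((1 / 2) ^ m * (1 / 2) ^ k))"
        by (intro suminf_le allI summableI order_trans[OF wN]) (simp add: power_add mult.commute)
      also have "\<dots> = ennreal ((1 / 2) ^ m * (1 / (1 - 1 / 2)))"
        by (intro suminf_ennreal_eq sums_mult geometric_sums) auto
      finally show ?thesis by (simp add: mult.commute)
    qed
    define S where "S m = (\<lambda>z. \<Sum>k. w (k + m) z)" for m
    have S: "(\<forall>z. summable (\<lambda>k. w (k + m) z)) \<and> S m \<in> V \<and> N (S m) \<le> ennreal (2 * (1 / 2) ^ m)" for m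
    proof -
      have fin: "(\<Sum>k. N (w (k + m))) < top" by (rule le_less_trans[OF tail]) simp
      have "(\<forall>z. summable (\<lambda>k. w (k + m) z)) \<and> S m \<in> D \<and> N (S m) \<le> (\<Sum>k. N (w (k + m)))"
        unfolding S_def using wV by (intro series[OF _ fin]) (auto simp: V_def)
      then show ?thesis using tail[of m] fin by (auto simp: V_def intro: order_trans le_less_trans)
    qed
    define x where "x = (\<lambda>z. \<sigma> (r 0) z + S 0 z)"
    have x: "x \<in> V" unfolding x_def using add[OF \<sigma> conjunct1[OF conjunct2[OF S]]] by blast
    have xS: "x z - \<sigma> (r m) z = S m z" for m z
    proof -
      have "(\<Sum>k<m. w k z) = \<sigma> (r m) z - \<sigma> (r 0) z"
        unfolding w_def by (rule sum_lessThan_telescope)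
      moreover have "S 0 z = (\<Sum>k. w (k + m) z) + (\<Sum>k<m. w k z)"
        using suminf_split_initial_segment[of "\<lambda>k. w k z" m] S[of 0] by (simp add: S_def)
      ultimately show ?thesis by (simp add: x_def S_def)
    qed
    have "limitin mtopology (\<sigma> \<circ> r) x sequentially"
      unfolding limitin_metric
    proof (intro conjI allI impI x)
      fix \<epsilon> :: real assume "\<epsilon> > 0"
      have "(\<lambda>m. 2 * (1 / 2 :: real) ^ m) \<longlonglongrightarrow> 2 * 0"
        by (intro tendsto_intros LIMSEQ_power_zero) simp
      then have "\<forall>\<^sub>F m in sequentially. 2 * (1 / 2) ^ m < \<epsilon>"
        using \<open>\<epsilon> > 0\<close> order_tendstoD(2) by fastforce
      then show "\<forall>\<^sub>F m in sequentially. (\<sigma> \<circ> r) m \<in> V \<and> ?d ((\<sigma> \<circ> r) m) x < \<epsilon>"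
      proof eventually_elim
        case (elim m)
        have "?d ((\<sigma> \<circ> r) m) x = enn2real (N (S m))"
          using N_neg[of "S m"] by (simp flip: xS)
        also have "\<dots> \<le> 2 * (1 / 2) ^ m"
          using S[of m] by (intro enn2real_leI) auto
        finally show ?case using elim \<sigma> by simp
      qed
    qed
    then show "\<exists>x. limitin mtopology \<sigma> x sequentially"
      using MCauchy_convergent_subsequence[OF cau r] by blast
  qed
  have "enn2real (N (\<lambda>z. t * u z)) = \<bar>t\<bar> * enn2real (N u)" if "u \<in> V" for t u
    using that by (simp add: V_def homog enn2real_mult)
  moreover have "enn2real (N u) = 0 \<longleftrightarrow> u = (\<lambda>z. 0)" if "u \<in> V" for u
    using that definite[of u] N_zero(2) by (auto simp: V_def enn2real_eq_0_iff)
  moreover have "enn2real (N (\<lambda>z. u z + v z)) \<le> enn2real (N u) + enn2real (N v)" if "u \<in> V" "v \<in> V" for u v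
  proof -
    have "ennreal (enn2real (N (\<lambda>z. u z + v z))) \<le> ennreal (enn2real (N u) + enn2real (N v))"
      using add[OF that] real_N[OF that(1)] real_N[OF that(2)] real_N[of "\<lambda>z. u z + v z"] by simp
    then show ?thesis by (subst (asm) ennreal_le_iff) auto
  qed
  ultimately show ?thesis
    unfolding banach_space_on_def V_def[symmetric]
    using complete add cmult N_zero by (auto simp: V_def)
qed

section \<open>Charts and smooth functions on the base\<close>

lemma chart_inv:
  assumes "is_chart c"
  shows chart_inv_left: "x \<in> fst c \<Longrightarrow> inv_into (fst c) (snd c) (snd c x) = x"
    and chart_inv_right: "y \<in> snd c ` fst c \<Longrightarrow> snd c (inv_into (fst c) (snd c) y) = y"
    and chart_inv_in: "y \<in> snd c ` fst c \<Longrightarrow> inv_into (fst c) (snd c) y \<in> fst c"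
    and chart_inv_image: "S \<subseteq> fst c \<Longrightarrow> y \<in> snd c ` S \<Longrightarrow> inv_into (fst c) (snd c) y \<in> S"
proof -
  have l: "inv_into (fst c) (snd c) (snd c x) = x" if "x \<in> fst c" for x
    using assms that by (simp add: is_chart_def homeomorphism_def)
  then show "x \<in> fst c \<Longrightarrow> inv_into (fst c) (snd c) (snd c x) = x" .
  show "y \<in> snd c ` fst c \<Longrightarrow> snd c (inv_into (fst c) (snd c) y) = y"
    by (rule f_inv_into_f)
  show "y \<in> snd c ` fst c \<Longrightarrow> inv_into (fst c) (snd c) y \<in> fst c"
    by (rule inv_into_into)
  show "S \<subseteq> fst c \<Longrightarrow> y \<in> snd c ` S \<Longrightarrow> inv_into (fst c) (snd c) y \<in> S"
    using l by auto
qed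

lemma chart_open_image:
  assumes "is_chart c" "open W" "W \<subseteq> fst c"
  shows "open (snd c ` W)"
proof -
  have "openin (top_of_set (fst c)) W" using assms by (auto simp: openin_open)
  then have "openin (top_of_set (snd c ` fst c)) (snd c ` W)"
    using assms(1) unfolding is_chart_def by (blast intro: homeomorphism_imp_open_map)
  then show ?thesis using assms(1) by (simp add: is_chart_def openin_open_eq)
qed

lemma chart_open: "is_chart c \<Longrightarrow> open (fst c)" "is_chart c \<Longrightarrow> open (snd c ` fst c)"
  by (simp_all add: is_chart_def)

lemma chart_compact_image:
  assumes "is_chart c" "compact K" "K \<subseteq> fst c"
  shows "compact (snd c ` K)"
  using assms by (intro compact_continuous_image) (auto simp: is_chart_def homeomorphism_def intro: continuous_on_subset)

lemma smooth_chart_is_chart: "smooth_chart A c \<Longrightarrow> is_chart c"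
  by (simp add: smooth_chart_def)

text \<open>Smoothness in every chart compatible with the atlas; the definition of smooth maps refers only to
the charts of the atlas itself.\<close>

definition smooth_fun :: "('m::topological_space, real^'n::finite) chart set \<Rightarrow> ('m \<Rightarrow> real) \<Rightarrow> bool" where
  "smooth_fun A f \<longleftrightarrow> (\<forall>c. smooth_chart A c \<longrightarrow> smooth_on (snd c ` fst c) (\<lambda>y. f (inv_into (fst c) (snd c) y)))"

lemma smooth_atlas_obtain:
  assumes "smooth_atlas A"
  obtains c where "c \<in> A" "x \<in> fst c" "is_chart c"
proof -
  have "x \<in> (\<Union>c\<in>A. fst c)" using assms by (simp add: smooth_atlas_def)
  then obtain c where "c \<in> A" "x \<in> fst c" by blast
  then show thesis using assms that by (simp add: smooth_atlas_def smooth_chart_def)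
qed

lemma smooth_map_on_imp_smooth_fun:
  fixes A :: "('m::topological_space, real^'n::finite) chart set"
  assumes A: "smooth_atlas A" and f: "smooth_map_on A euclidean_atlas UNIV f"
  shows "smooth_fun A f"
  unfolding smooth_fun_def
proof (intro allI impI)
  fix c :: "('m, real^'n) chart" assume c: "smooth_chart A c"
  show "smooth_on (snd c ` fst c) (\<lambda>y. f (inv_into (fst c) (snd c) y))"
  proof (rule smooth_on_locally)
    fix y assume y: "y \<in> snd c ` fst c"
    note ic = smooth_chart_is_chart[OF c]
    let ?x = "inv_into (fst c) (snd c) y"
    obtain d where d: "d \<in> A" "?x \<in> fst d" and id: "is_chart d"
      by (rule smooth_atlas_obtain[OF A]) (rule that)
    let ?T = "snd c ` (fst c \<inter> fst d)"
    have T: "open ?T" by (intro chart_open_image[OF ic] open_Int chart_open[OF ic] chart_open[OF id]) auto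
    have yT: "y \<in> ?T" using chart_inv_right[OF ic y] chart_inv_in[OF ic y] d(2) by (metis IntI image_eqI)
    have inT: "inv_into (fst c) (snd c) z \<in> fst c \<inter> fst d" if "z \<in> ?T" for z
      using chart_inv_image[OF ic _ that] by blast
    have fd: "smooth_on (snd d ` fst d) (\<lambda>y. f (inv_into (fst d) (snd d) y))"
      using f d(1) by (auto simp: smooth_map_on_def euclidean_atlas_def o_def id_def)
    have tr: "smooth_on ?T (transition c d)" using c d(1) by (simp add: smooth_chart_def)
    have "transition c d ` ?T \<subseteq> snd d ` fst d"
      using inT by (auto simp: transition_def simp del: IntE)
    from smooth_on_compose[OF T fd tr this]
    have "smooth_on ?T (\<lambda>z. f (inv_into (fst d) (snd d) (transition c d z)))" .
    then have "smooth_on ?T (\<lambda>y. f (inv_into (fst c) (snd c) y))"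
      by (rule smooth_on_cong[OF T]) (use inT chart_inv_left[OF id] in \<open>simp add: transition_def\<close>)
    then show "\<exists>T. open T \<and> y \<in> T \<and> smooth_on T (\<lambda>y. f (inv_into (fst c) (snd c) y))"
      using T yT by blast
  qed
qed

lemma smooth_fun_mult: "smooth_fun A f \<Longrightarrow> smooth_fun A g \<Longrightarrow> smooth_fun A (\<lambda>x. f x * g x)"
  by (simp add: smooth_fun_def smooth_on_mult smooth_chart_is_chart chart_open)

lemma smooth_fun_sum: "(\<And>i. i \<in> I \<Longrightarrow> smooth_fun A (f i)) \<Longrightarrow> smooth_fun A (\<lambda>x. \<Sum>i\<in>I. f i x)"
  by (simp add: smooth_fun_def smooth_on_sum smooth_chart_is_chart chart_open)

lemma smooth_fun_inverse: "smooth_fun A f \<Longrightarrow> (\<And>x. f x \<noteq> 0) \<Longrightarrow> smooth_fun A (\<lambda>x. inverse (f x))"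
  by (simp add: smooth_fun_def smooth_on_inverse smooth_chart_is_chart chart_open)

section \<open>Fibres and test sections\<close>

lemma fibre_iso_inv:
  assumes "fibre_iso E \<rho> x"
  shows fibre_inv_in: "inv_into (fibre E x) \<rho> v \<in> fibre E x"
    and fibre_inv_right: "\<rho> (inv_into (fibre E x) \<rho> v) = v"
    and fibre_inv_left: "a \<in> fibre E x \<Longrightarrow> inv_into (fibre E x) \<rho> (\<rho> a) = a"
  using assms by (auto simp: fibre_iso_def bij_betw_def intro: inv_into_into f_inv_into_f inv_into_f_f)

lemma vee_fibre_linear:
  assumes E: "smooth_vector_bundle E" and h: "h \<in> vee_fibre E x" and \<rho>: "fibre_iso E \<rho> x"
  shows "linear (\<lambda>v. h (inv_into (fibre E x) \<rho> v) d)"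
proof (rule linearI)
  let ?i = "inv_into (fibre E x) \<rho>"
  fix v w :: "real^'d" and t :: real
  have "?i (v + w) = fibre_add E (?i v) (?i w)"
    using E \<rho> fibre_iso_inv[OF \<rho>] fibre_inv_left[OF \<rho>, of "fibre_add E (?i v) (?i w)"]
    by (auto simp: fibre_iso_def smooth_vector_bundle_def)
  then show "h (?i (v + w)) d = h (?i v) d + h (?i w) d"
    using h fibre_inv_in[OF \<rho>] by (simp add: vee_fibre_def)
  have "?i (t *\<^sub>R v) = fibre_scale E t (?i v)"
    using E \<rho> fibre_iso_inv[OF \<rho>] fibre_inv_left[OF \<rho>, of "fibre_scale E t (?i v)"]
    by (auto simp: fibre_iso_def smooth_vector_bundle_def)
  then show "h (?i (t *\<^sub>R v)) d = t *\<^sub>R h (?i v) d"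
    using h fibre_inv_in[OF \<rho>] by (simp add: vee_fibre_def)
qed

lemma linear_cart_expansion:
  fixes L :: "real^'n::finite \<Rightarrow> real"
  assumes "linear L"
  shows "L v = (\<Sum>i\<in>UNIV. v $ i * L (axis i 1))"
proof -
  have "L v = L (\<Sum>i\<in>UNIV. v $ i *\<^sub>R axis i 1)"
    by (simp add: basis_expansion[of v, unfolded scalar_mult_eq_scaleR])
  also have "\<dots> = (\<Sum>i\<in>UNIV. v $ i * L (axis i 1))"
    by (simp add: linear_sum[OF assms] linear_cmul[OF assms])
  finally show ?thesis .
qed

lemma densities_zero: "(\<lambda>d. 0) \<in> densities A x"
  by (simp add: densities_def)

lemma densitiesI:
  assumes "\<And>c. \<not> chart_around A x c \<Longrightarrow> \<mu> c = 0"
    "\<And>c d. chart_around A x c \<Longrightarrow> chart_around A x d \<Longrightarrow> \<mu> d = abs_jacobian d c x * \<mu> c"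
  shows "\<mu> \<in> densities A x"
  unfolding densities_def mem_Collect_eq using assms by blast

lemma densitiesD:
  assumes "\<mu> \<in> densities A x"
  shows densities_outside: "\<not> chart_around A x c \<Longrightarrow> \<mu> c = 0"
    and densities_change: "chart_around A x c \<Longrightarrow> chart_around A x d \<Longrightarrow> \<mu> d = abs_jacobian d c x * \<mu> c"
  using assms unfolding densities_def mem_Collect_eq by blast+

lemma densities_add:
  assumes "\<mu> \<in> densities A x" "\<mu>' \<in> densities A x"
  shows "(\<lambda>d. \<mu> d + \<mu>' d) \<in> densities A x"
proof (rule densitiesI)
  fix c d assume "chart_around A x c" "chart_around A x d"
  from assms[THEN densities_change, OF this] show "\<mu> d + \<mu>' d = abs_jacobian d c x * (\<mu> c + \<mu>' c)"
    by (simp only: distrib_left)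
qed (simp add: assms[THEN densities_outside])

lemma densities_cmult:
  assumes "\<mu> \<in> densities A x"
  shows "(\<lambda>d. t * \<mu> d) \<in> densities A x"
proof (rule densitiesI)
  fix c d assume "chart_around A x c" "chart_around A x d"
  from assms[THEN densities_change, OF this] show "t * \<mu> d = abs_jacobian d c x * (t * \<mu> c)"
    by (simp only: mult.left_commute)
qed (simp add: assms[THEN densities_outside])

lemma vee_fibre_zero: "(\<lambda>a d. 0) \<in> vee_fibre E x"
  by (simp add: vee_fibre_def densities_zero)

lemma vee_fibre_add:
  "h \<in> vee_fibre E x \<Longrightarrow> h' \<in> vee_fibre E x \<Longrightarrow> (\<lambda>a d. h a d + h' a d) \<in> vee_fibre E x"
  by (auto simp: vee_fibre_def densities_add algebra_simps)

lemma vee_fibre_cmult: "h \<in> vee_fibre E x \<Longrightarrow> (\<lambda>a d. t * h a d) \<in> vee_fibre E x"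
  by (auto simp: vee_fibre_def densities_cmult algebra_simps)

lemma total_triv_is_chart: "total_triv_triple E c \<rho> \<Longrightarrow> is_chart c"
  by (simp add: total_triv_triple_def smooth_chart_def)

lemma total_triv_fibre_iso: "total_triv_triple E c \<rho> \<Longrightarrow> x \<in> fst c \<Longrightarrow> fibre_iso E \<rho> x"
  by (simp add: total_triv_triple_def trivialization_def)

lemma test_sections_iff:
  fixes E :: "('m::topological_space, 'n::finite, 'e::topological_space, 'r::finite) vbundle"
  assumes "compact (UNIV :: 'm set)"
  shows "\<eta> \<in> test_sections E \<longleftrightarrow> smooth_vee_section E \<eta>"
  using compact_Int_closed[OF assms closed_closure] by (simp add: test_sections_def section_support_def)

lemma test_sectionsI:
  fixes E :: "('m::topological_space, 'n::finite, 'e::topological_space, 'r::finite) vbundle"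
  assumes "compact (UNIV :: 'm set)" "\<And>x. \<eta> x \<in> vee_fibre E x"
    "\<And>c \<rho> l. total_triv_triple E c \<rho> \<Longrightarrow> smooth_on (snd c ` fst c) (vee_coeff E c \<rho> l \<eta>)"
  shows "\<eta> \<in> test_sections E"
  unfolding test_sections_iff[OF assms(1)] smooth_vee_section_def using assms(2,3) by blast

lemma test_sections_vee_fibre: "\<eta> \<in> test_sections E \<Longrightarrow> \<eta> x \<in> vee_fibre E x"
  unfolding test_sections_def smooth_vee_section_def by blast

lemma test_sections_smooth_coeff:
  "\<eta> \<in> test_sections E \<Longrightarrow> total_triv_triple E c \<rho> \<Longrightarrow> smooth_on (snd c ` fst c) (vee_coeff E c \<rho> l \<eta>)"
  unfolding test_sections_def smooth_vee_section_def by blast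

lemma test_sections_zero:
  fixes E :: "('m::topological_space, 'n::finite, 'e::topological_space, 'r::finite) vbundle"
  assumes "compact (UNIV :: 'm set)"
  shows "(\<lambda>x a d. 0) \<in> test_sections E"
proof (rule test_sectionsI[OF assms vee_fibre_zero])
  show "smooth_on (snd c ` fst c) (vee_coeff E c \<rho> l (\<lambda>x a d. 0))" for c and \<rho> :: "'e \<Rightarrow> real^'r" and l
    using smooth_on_const by (simp add: vee_coeff_def[abs_def] Let_def)
qed

lemma test_sections_add:
  fixes E :: "('m::topological_space, 'n::finite, 'e::topological_space, 'r::finite) vbundle"
  assumes M: "compact (UNIV :: 'm set)" and \<eta>: "\<eta> \<in> test_sections E" and \<zeta>: "\<zeta> \<in> test_sections E"
  shows "(\<lambda>x a d. \<eta> x a d + \<zeta> x a d) \<in> test_sections E"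
proof (rule test_sectionsI[OF M])
  show "(\<lambda>a d. \<eta> x a d + \<zeta> x a d) \<in> vee_fibre E x" for x
    by (intro vee_fibre_add test_sections_vee_fibre \<eta> \<zeta>)
  fix c \<rho> l assume c: "total_triv_triple E c \<rho>"
  have "vee_coeff E c \<rho> l (\<lambda>x a d. \<eta> x a d + \<zeta> x a d) = (\<lambda>y. vee_coeff E c \<rho> l \<eta> y + vee_coeff E c \<rho> l \<zeta> y)"
    by (simp add: vee_coeff_def Let_def fun_eq_iff)
  then show "smooth_on (snd c ` fst c) (vee_coeff E c \<rho> l (\<lambda>x a d. \<eta> x a d + \<zeta> x a d))"
    by (simp only:) (intro smooth_on_add chart_open(2)[OF total_triv_is_chart[OF c]] test_sections_smooth_coeff \<eta> \<zeta> c)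
qed

lemma test_sections_mult:
  fixes E :: "('m::topological_space, 'n::finite, 'e::topological_space, 'r::finite) vbundle"
  assumes M: "compact (UNIV :: 'm set)" and f: "smooth_fun (base_atlas E) f" and \<eta>: "\<eta> \<in> test_sections E"
  shows "(\<lambda>x a d. f x * \<eta> x a d) \<in> test_sections E"
proof (rule test_sectionsI[OF M])
  show "(\<lambda>a d. f x * \<eta> x a d) \<in> vee_fibre E x" for x
    by (intro vee_fibre_cmult test_sections_vee_fibre \<eta>)
  fix c \<rho> l assume c: "total_triv_triple E c \<rho>"
  have "vee_coeff E c \<rho> l (\<lambda>x a d. f x * \<eta> x a d) =
      (\<lambda>y. f (inv_into (fst c) (snd c) y) * vee_coeff E c \<rho> l \<eta> y)"
    by (simp add: vee_coeff_def Let_def fun_eq_iff)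
  moreover have "smooth_on (snd c ` fst c) (\<lambda>y. f (inv_into (fst c) (snd c) y))"
    using f c unfolding smooth_fun_def total_triv_triple_def by blast
  ultimately show "smooth_on (snd c ` fst c) (vee_coeff E c \<rho> l (\<lambda>x a d. f x * \<eta> x a d))"
    by (simp only:) (intro smooth_on_mult chart_open(2)[OF total_triv_is_chart[OF c]] test_sections_smooth_coeff[OF \<eta> c])
qed

lemma smooth_fun_const: "smooth_fun A (\<lambda>x. t)"
  by (simp add: smooth_fun_def smooth_on_const)

lemma test_sections_cmult:
  fixes E :: "('m::topological_space, 'n::finite, 'e::topological_space, 'r::finite) vbundle"
  assumes "compact (UNIV :: 'm set)" "\<eta> \<in> test_sections E"
  shows "(\<lambda>x a d. t * \<eta> x a d) \<in> test_sections E"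
  by (rule test_sections_mult[OF assms(1) smooth_fun_const assms(2)])

lemma test_sections_sum:
  fixes E :: "('m::topological_space, 'n::finite, 'e::topological_space, 'r::finite) vbundle"
  assumes M: "compact (UNIV :: 'm set)" and "\<And>i. i \<in> I \<Longrightarrow> s i \<in> test_sections E"
  shows "(\<lambda>x a d. \<Sum>i\<in>I. s i x a d) \<in> test_sections E"
  using assms(2)
  by (induction I rule: infinite_finite_induct) (auto intro: test_sections_zero[OF M] test_sections_add[OF M])

subsection \<open>Change of trivialization\<close>

text \<open>Between two trivializations the fibre coordinates change smoothly with the base point: the new
  coordinates of the point with old coordinates \<open>v\<close> are obtained by passing through a chart of the
  total space.\<close>

lemma trivialization_change_smooth:
  fixes E :: "('m::{t2_space,second_countable_topology}, 'n::finite,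
    'e::{t2_space,second_countable_topology}, 'r::finite) vbundle"
  assumes E: "smooth_vector_bundle E" and c: "smooth_chart (base_atlas E) c"
    and \<rho>: "trivialization E U \<rho>" and \<rho>': "trivialization E U' \<rho>'"
  shows "smooth_on (snd c ` (fst c \<inter> U \<inter> U')) (\<lambda>y. \<rho>' (inv_into (fibre E (inv_into (fst c) (snd c) y)) \<rho> v))"
proof (rule smooth_on_locally)
  let ?A = "base_atlas E" and ?T = "total_atlas E"
  let ?ic = "inv_into (fst c) (snd c)"
  define P where "P = (\<lambda>a. (proj E a, \<rho> a))"
  define I where "I = inv_into (proj E -` U) P"
  have ic: "is_chart c" by (rule smooth_chart_is_chart[OF c])
  have oU: "open U" "open U'" using \<rho> \<rho>' by (simp_all add: trivialization_def)
  have P: "inj_on P (proj E -` U)" and I_smooth: "smooth_map_on (prod_atlas ?A euclidean_atlas) ?T (U \<times> UNIV) I"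
    using \<rho> by (auto simp: trivialization_def diffeomorphism_on_def P_def I_def bij_betw_def)
  have iso: "fibre_iso E \<rho> x" if "x \<in> U" for x using \<rho> that by (simp add: trivialization_def)
  have I_eq: "I (x, w) = inv_into (fibre E x) \<rho> w" if "x \<in> U" for x w
    unfolding I_def using fibre_inv_in[OF iso[OF that], of w] fibre_inv_right[OF iso[OF that], of w] that
    by (intro inv_into_f_eq[OF P]) (auto simp: P_def fibre_def)
  have I_proj: "proj E (I (x, w)) = x" if "x \<in> U" for x w
    using fibre_inv_in[OF iso[OF that], of w] by (simp add: I_eq[OF that] fibre_def)
  fix y assume y: "y \<in> snd c ` (fst c \<inter> U \<inter> U')"
  define x where "x = ?ic y"
  have x: "x \<in> fst c" "x \<in> U" "x \<in> U'" "snd c x = y"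
    using chart_inv_image[OF ic _ y] chart_inv_right[OF ic, of y] y by (auto simp: x_def)
  have atlases: "smooth_atlas ?A" "smooth_atlas ?T" using E by (simp_all add: smooth_vector_bundle_def)
  obtain b where b: "b \<in> ?A" "x \<in> fst b" and ib: "is_chart b"
    by (rule smooth_atlas_obtain[OF atlases(1)]) (rule that)
  obtain t where t: "t \<in> ?T" "I (x, v) \<in> fst t" and it: "is_chart t"
    by (rule smooth_atlas_obtain[OF atlases(2)]) (rule that)
  define Q where "Q = {x \<in> U. I (x, v) \<in> fst t}"
  have "open Q"
  proof -
    have "continuous_on U (\<lambda>x. I (x, v))"
      using I_smooth by (auto simp: smooth_map_on_def intro!: continuous_on_compose2[of "U \<times> UNIV" I] continuous_intros)
    then have "open (U \<inter> (\<lambda>x. I (x, v)) -` fst t)"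
      by (rule continuous_open_preimage[OF _ oU(1) chart_open(1)[OF it]])
    moreover have "Q = U \<inter> (\<lambda>x. I (x, v)) -` fst t" by (auto simp: Q_def)
    ultimately show ?thesis by (simp only:)
  qed
  define W where "W = fst c \<inter> fst b \<inter> U' \<inter> Q"
  have W: "open W" "W \<subseteq> fst c"
    using \<open>open Q\<close> oU chart_open[OF ic] chart_open[OF ib] by (auto simp: W_def)
  define N where "N = snd c ` W"
  have N: "open N" unfolding N_def by (rule chart_open_image[OF ic W])
  have yN: "y \<in> N" unfolding N_def W_def Q_def using x b t by (intro image_eqI[of _ _ x]) auto
  have inW: "?ic z \<in> W" if "z \<in> N" for z using chart_inv_image[OF ic W(2)] that by (simp add: N_def)
  let ?p = "(fst b \<times> (UNIV :: (real^'r) set), map_prod (snd b) (id :: real^'r \<Rightarrow> real^'r))"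
  let ?ip = "inv_into (fst ?p) (snd ?p)"
  have p: "?p \<in> prod_atlas ?A euclidean_atlas"
    using b(1) unfolding prod_atlas_def euclidean_atlas_def by force
  have inj_b: "inj_on (snd b) (fst b)" using chart_inv_left[OF ib] by (rule inj_on_inverseI)
  have ip: "?ip (snd b x, w) = (x, w)" if "x \<in> fst b" for x w
  proof (rule inv_into_f_eq)
    show "inj_on (snd ?p) (fst ?p)" using inj_b by (auto simp: inj_on_def)
  qed (use that in auto)
  define G where "G = snd t \<circ> I \<circ> ?ip"
  have G: "smooth_on (snd ?p ` (U \<times> UNIV \<inter> fst ?p \<inter> I -` fst t)) G"
    using I_smooth p t(1) unfolding smooth_map_on_def G_def by blast
  define H where "H = (\<lambda>z. \<rho>' (inv_into (fst t) (snd t) z))"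
  have H: "smooth_on (snd t ` (proj E -` U' \<inter> fst t)) H"
    using \<rho>' t(1) by (auto simp: trivialization_def smooth_map_on_def euclidean_atlas_def H_def o_def id_def)
  have tr: "transition c b z = snd b (?ic z)" for z by (simp add: transition_def)
  have pair: "smooth_on N (\<lambda>z. (transition c b z, v))"
  proof (intro smooth_on_Pair[OF N] smooth_on_const)
    have "smooth_on (snd c ` (fst c \<inter> fst b)) (transition c b)" using c b(1) by (simp add: smooth_chart_def)
    then show "smooth_on N (transition c b)" by (rule smooth_on_subset) (auto simp: N_def W_def)
  qed
  have G_val: "G (transition c b z, v) = snd t (I (?ic z, v))" if "z \<in> N" for z
    using inW[OF that] ip[of "?ic z" v] by (simp add: G_def tr W_def)
  have GN: "smooth_on N (\<lambda>z. G (transition c b z, v))"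
  proof (rule smooth_on_compose[OF N G pair])
    show "(\<lambda>z. (transition c b z, v)) ` N \<subseteq> snd ?p ` (U \<times> UNIV \<inter> fst ?p \<inter> I -` fst t)"
    proof (rule image_subsetI)
      fix z assume "z \<in> N"
      from inW[OF this] show "(transition c b z, v) \<in> snd ?p ` (U \<times> UNIV \<inter> fst ?p \<inter> I -` fst t)"
        by (intro image_eqI[of _ _ "(?ic z, v)"]) (auto simp: tr W_def Q_def)
    qed
  qed
  have "smooth_on N (\<lambda>z. H (G (transition c b z, v)))"
  proof (rule smooth_on_compose[OF N H GN])
    show "(\<lambda>z. G (transition c b z, v)) ` N \<subseteq> snd t ` (proj E -` U' \<inter> fst t)"
      using inW I_proj by (auto simp: G_val W_def Q_def intro!: imageI)
  qed
  then have "smooth_on N (\<lambda>y. \<rho>' (inv_into (fibre E (?ic y)) \<rho> v))"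
  proof (rule smooth_on_cong[OF N])
    fix z assume z: "z \<in> N"
    then have "?ic z \<in> U" "I (?ic z, v) \<in> fst t" using inW[OF z] by (auto simp: W_def Q_def)
    then show "H (G (transition c b z, v)) = \<rho>' (inv_into (fibre E (?ic z)) \<rho> v)"
      using chart_inv_left[OF it] by (simp add: G_val[OF z] H_def I_eq)
  qed
  then show "\<exists>T. open T \<and> y \<in> T \<and> smooth_on T (\<lambda>y. \<rho>' (inv_into (fibre E (?ic y)) \<rho> v))"
    using N yN by blast
qed

section \<open>Decomposition of test sections into local sections\<close>

text \<open>The coefficient functions of a section of compact support in the chart domain, extended by zero to
elements of \<open>test_fun\<close>.\<close>

definition extended_coeff ::
  "('m, 'n::finite, 'e, 'r::finite) vbundle \<Rightarrow> ('m, real^'n) chart \<Rightarrow> ('e \<Rightarrow> real^'r) \<Rightarrow>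
   'r \<Rightarrow> ('m, 'n, 'e) vee_section \<Rightarrow> real^'n \<Rightarrow> real" where
  "extended_coeff E c \<rho> l \<eta> y = (if y \<in> snd c ` fst c then vee_coeff E c \<rho> l \<eta> y else 0)"

lemma extended_coeff_vanish:
  assumes "is_chart c" "K \<subseteq> fst c" "\<And>x. x \<notin> K \<Longrightarrow> \<eta> x = (\<lambda>a d. 0)" "y \<notin> snd c ` K"
  shows "extended_coeff E c \<rho> l \<eta> y = 0"
proof (cases "y \<in> snd c ` fst c")
  case True
  have "inv_into (fst c) (snd c) y \<notin> K"
    using assms(4) chart_inv_right[OF assms(1) True] by (metis image_eqI)
  then show ?thesis using assms(3) by (simp add: extended_coeff_def vee_coeff_def Let_def)
qed (simp add: extended_coeff_def)

lemma extended_coeff_test_fun: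
  fixes E :: "('m::topological_space, 'n::finite, 'e::topological_space, 'r::finite) vbundle"
  assumes c: "total_triv_triple E c \<rho>" and \<eta>: "\<eta> \<in> test_sections E"
    and K: "compact K" "K \<subseteq> fst c" "\<And>x. x \<notin> K \<Longrightarrow> \<eta> x = (\<lambda>a d. 0)"
  shows "extended_coeff E c \<rho> l \<eta> \<in> test_fun (snd c ` fst c)"
proof (rule test_funI)
  note ic = total_triv_is_chart[OF c]
  let ?\<Omega> = "snd c ` fst c"
  show cK: "compact (snd c ` K)" by (rule chart_compact_image[OF ic K(1,2)])
  show "snd c ` K \<subseteq> ?\<Omega>" using K(2) by auto
  show van: "extended_coeff E c \<rho> l \<eta> y = 0" if "y \<notin> snd c ` K" for y
    by (rule extended_coeff_vanish[OF ic K(2,3) that])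
  have "smooth_on ?\<Omega> (extended_coeff E c \<rho> l \<eta>)"
    by (rule smooth_on_cong[OF chart_open(2)[OF ic] test_sections_smooth_coeff[OF \<eta> c, of l]])
      (simp add: extended_coeff_def)
  moreover have "smooth_on (- snd c ` K) (extended_coeff E c \<rho> l \<eta>)"
    using cK by (intro smooth_on_cong[OF _ smooth_on_const[of _ 0]]) (auto simp: van compact_imp_closed)
  ultimately have "smooth_on (?\<Omega> \<union> - snd c ` K) (extended_coeff E c \<rho> l \<eta>)"
    using cK by (intro smooth_on_Un chart_open(2)[OF ic]) (auto simp: compact_imp_closed)
  moreover have "?\<Omega> \<union> - snd c ` K = UNIV" using K(2) by auto
  ultimately show "smooth_on UNIV (extended_coeff E c \<rho> l \<eta>)" by simp
qed

text \<open>The local section built from the \<open>l\<close>-th coefficient of \<open>\<eta>\<close> is \<open>\<eta>\<close> composed with the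
  projection of the fibre to the \<open>l\<close>-th coordinate direction. In this form it inherits from \<open>\<eta>\<close>
  that its values are densities, and its smoothness reduces to that of the change of trivialization.\<close>

lemma local_section_extended_coeff:
  fixes E :: "('m::{t2_space,second_countable_topology}, 'n::finite,
    'e::{t2_space,second_countable_topology}, 'r::finite) vbundle"
  assumes c: "total_triv_triple E c \<rho>" and \<eta>: "\<eta> \<in> test_sections E" and x: "x \<in> fst c" and a: "a \<in> fibre E x"
  shows "local_section E c \<rho> l (extended_coeff E c \<rho> l \<eta>) x a d =
    \<rho> a $ l * \<eta> x (inv_into (fibre E x) \<rho> (axis l 1)) d"
proof -
  note ic = total_triv_is_chart[OF c]
  let ?b = "inv_into (fibre E x) \<rho> (axis l 1)"
  have "?b \<in> fibre E x" by (rule fibre_inv_in[OF total_triv_fibre_iso[OF c x]])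
  then have dens: "\<eta> x ?b \<in> densities (base_atlas E) x"
    using test_sections_vee_fibre[OF \<eta>, of x] by (simp add: vee_fibre_def)
  have ca: "chart_around (base_atlas E) x c"
    using c x by (simp add: chart_around_def total_triv_triple_def)
  have coeff: "extended_coeff E c \<rho> l \<eta> (snd c x) = \<eta> x ?b c"
    using x chart_inv_left[OF ic x] by (simp add: extended_coeff_def vee_coeff_def Let_def)
  have "\<eta> x ?b d = \<eta> x ?b c * coord_density (base_atlas E) c x d"
  proof (cases "chart_around (base_atlas E) x d")
    case True
    then show ?thesis using densities_change[OF dens ca True] by (simp add: coord_density_def)
  next
    case False
    then show ?thesis using densities_outside[OF dens False] by (simp add: coord_density_def)
  qed
  then show ?thesis using x a by (simp add: local_section_def coeff)
qed

text \<open>In another trivialization the coefficients of the local section are those of \<open>\<eta>\<close> multiplied by the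
entries of the two transition matrices. This is smooth where the two trivializations overlap, and
the section vanishes off \<open>K\<close>; the two open sets cover the chart domain.\<close>

lemma local_section_test_section:
  fixes E :: "('m::{t2_space,second_countable_topology}, 'n::finite,
    'e::{t2_space,second_countable_topology}, 'r::finite) vbundle"
  assumes M: "compact (UNIV :: 'm set)" and E: "smooth_vector_bundle E"
    and c: "total_triv_triple E c \<rho>" and \<eta>: "\<eta> \<in> test_sections E"
    and K: "compact K" "K \<subseteq> fst c" "\<And>x. x \<notin> K \<Longrightarrow> \<eta> x = (\<lambda>a d. 0)"
  shows "local_section E c \<rho> l (extended_coeff E c \<rho> l \<eta>) \<in> test_sections E" (is "?s \<in> _")
proof (rule test_sectionsI[OF M])
  let ?e = "\<lambda>x. inv_into (fibre E x) \<rho> (axis l 1)"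
  note s_eq = local_section_extended_coeff[OF c \<eta>]
  have s_out: "?s x a = (\<lambda>d. 0)" if "x \<notin> fst c \<or> a \<notin> fibre E x" for x a
    using that by (auto simp: local_section_def fun_eq_iff)
  have s_in: "?s x a = (\<lambda>d. \<rho> a $ l * \<eta> x (?e x) d)" if "x \<in> fst c" "a \<in> fibre E x" for x a
    using s_eq[OF that] by (simp add: fun_eq_iff del: split_paired_All)
  have s_0: "?s x = (\<lambda>a d. 0)" if "x \<notin> K" for x
  proof
    fix a
    show "?s x a = (\<lambda>d. 0)"
      using s_out[of x a] s_in[of x a] K(3)[OF that] by (cases "x \<in> fst c \<and> a \<in> fibre E x") auto
  qed
  show "?s x \<in> vee_fibre E x" for x
  proof (cases "x \<in> fst c")
    case False
    then have "?s x = (\<lambda>a d. 0)" using s_out by blast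
    then show ?thesis by (simp only: vee_fibre_zero)
  next
    case x: True
    note iso = total_triv_fibre_iso[OF c x]
    have add: "fibre_add E a b \<in> fibre E x" "\<rho> (fibre_add E a b) = \<rho> a + \<rho> b"
      if "a \<in> fibre E x" "b \<in> fibre E x" for a b
      using E iso that by (auto simp: smooth_vector_bundle_def fibre_iso_def)
    have scale: "fibre_scale E t a \<in> fibre E x" "\<rho> (fibre_scale E t a) = t *\<^sub>R \<rho> a"
      if "a \<in> fibre E x" for t a
      using E iso that by (auto simp: smooth_vector_bundle_def fibre_iso_def)
    have "\<eta> x (?e x) \<in> densities (base_atlas E) x"
      using test_sections_vee_fibre[OF \<eta>, of x] fibre_inv_in[OF iso] by (simp add: vee_fibre_def)
    then have dens: "?s x a \<in> densities (base_atlas E) x" if "a \<in> fibre E x" for a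
      using densities_cmult s_in[OF x that] by (simp only:)
    show ?thesis
      unfolding vee_fibre_def mem_Collect_eq
    proof (intro conjI allI impI ballI)
      show "?s x a = (\<lambda>d. 0)" if "a \<notin> fibre E x" for a using s_out that by blast
      show "?s x a \<in> densities (base_atlas E) x" if "a \<in> fibre E x" for a by (rule dens[OF that])
      show "?s x (fibre_add E a b) = (\<lambda>d. ?s x a d + ?s x b d)"
        if "a \<in> fibre E x" "b \<in> fibre E x" for a b
        using add[OF that] s_in[OF x] that by (simp add: distrib_right)
      show "?s x (fibre_scale E t a) = (\<lambda>d. t * ?s x a d)" if "a \<in> fibre E x" for t a
        using scale[OF that] s_in[OF x] that by (simp add: mult.assoc)
    qed
  qed
  fix c' :: "('m, real^'n) chart" and \<rho>' :: "'e \<Rightarrow> real^'r" and m :: 'r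
  assume c': "total_triv_triple E c' \<rho>'"
  note ic' = total_triv_is_chart[OF c'] and ic = total_triv_is_chart[OF c]
  let ?ic' = "inv_into (fst c') (snd c')"
  define T1 where "T1 = snd c' ` (fst c' \<inter> fst c)"
  define T2 where "T2 = snd c' ` (fst c' - K)"
  have T1: "open T1" unfolding T1_def by (intro chart_open_image[OF ic'] open_Int chart_open[OF ic] chart_open[OF ic']) auto
  have T2: "open T2" unfolding T2_def
    using compact_imp_closed[OF K(1)] by (intro chart_open_image[OF ic'] open_Diff chart_open[OF ic']) auto
  have change: "smooth_on T1 (\<lambda>y. \<rho> (inv_into (fibre E (?ic' y)) \<rho>' v))" "smooth_on T1 (\<lambda>y. \<rho>' (inv_into (fibre E (?ic' y)) \<rho> v))" for v
  proof -
    have sc': "smooth_chart (base_atlas E) c'" and tr': "trivialization E (fst c') \<rho>'" and tr: "trivialization E (fst c) \<rho>"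
      using c c' by (simp_all add: total_triv_triple_def)
    have sets: "fst c' \<inter> fst c' \<inter> fst c = fst c' \<inter> fst c" "fst c' \<inter> fst c \<inter> fst c' = fst c' \<inter> fst c" by auto
    show "smooth_on T1 (\<lambda>y. \<rho> (inv_into (fibre E (?ic' y)) \<rho>' v))"
      using trivialization_change_smooth[OF E sc' tr' tr] unfolding T1_def sets .
    show "smooth_on T1 (\<lambda>y. \<rho>' (inv_into (fibre E (?ic' y)) \<rho> v))"
      using trivialization_change_smooth[OF E sc' tr tr'] unfolding T1_def sets .
  qed
  let ?f = "\<lambda>y. \<rho> (inv_into (fibre E (?ic' y)) \<rho>' (axis m 1)) $ l *
      (\<Sum>j\<in>UNIV. \<rho>' (?e (?ic' y)) $ j * vee_coeff E c' \<rho>' j \<eta> y)"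
  have "smooth_on T1 ?f"
    using test_sections_smooth_coeff[OF \<eta> c']
    by (intro smooth_on_mult[OF T1] smooth_on_sum[OF T1] smooth_on_linear_comp[OF bounded_linear_vec_nth T1] change)
      (rule smooth_on_subset, auto simp: T1_def)
  then have "smooth_on T1 (vee_coeff E c' \<rho>' m ?s)"
  proof (rule smooth_on_cong[OF T1])
    fix y assume y: "y \<in> T1"
    define x where "x = ?ic' y"
    have "x \<in> fst c' \<inter> fst c" using chart_inv_image[OF ic' _ y[unfolded T1_def]] by (simp add: x_def)
    then have x: "x \<in> fst c'" "x \<in> fst c" by auto
    note iso' = total_triv_fibre_iso[OF c' x(1)] and iso = total_triv_fibre_iso[OF c x(2)]
    have "\<eta> x (?e x) c' = \<eta> x (inv_into (fibre E x) \<rho>' (\<rho>' (?e x))) c'"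
      using fibre_inv_left[OF iso' fibre_inv_in[OF iso]] by simp
    also have "\<dots> = (\<Sum>j\<in>UNIV. \<rho>' (?e x) $ j * \<eta> x (inv_into (fibre E x) \<rho>' (axis j 1)) c')"
      by (rule linear_cart_expansion[OF vee_fibre_linear[OF E test_sections_vee_fibre[OF \<eta>] iso']])
    also have "\<dots> = (\<Sum>j\<in>UNIV. \<rho>' (?e x) $ j * vee_coeff E c' \<rho>' j \<eta> y)"
      by (simp add: vee_coeff_def Let_def x_def)
    finally have "\<eta> x (?e x) c' = (\<Sum>j\<in>UNIV. \<rho>' (?e x) $ j * vee_coeff E c' \<rho>' j \<eta> y)" .
    moreover have "vee_coeff E c' \<rho>' m ?s y = \<rho> (inv_into (fibre E x) \<rho>' (axis m 1)) $ l * \<eta> x (?e x) c'"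
      using s_in[OF x(2) fibre_inv_in[OF iso', of "axis m 1"]] by (simp add: vee_coeff_def Let_def x_def)
    ultimately show "?f y = vee_coeff E c' \<rho>' m ?s y" by (simp add: x_def)
  qed
  moreover have "smooth_on T2 (vee_coeff E c' \<rho>' m ?s)"
  proof (rule smooth_on_cong[OF T2 smooth_on_const[of _ 0]])
    fix y assume y: "y \<in> T2"
    have "?ic' y \<in> fst c' - K" using chart_inv_image[OF ic' _ y[unfolded T2_def]] by blast
    then show "0 = vee_coeff E c' \<rho>' m ?s y" using s_0[of "?ic' y"] by (simp add: vee_coeff_def Let_def)
  qed
  ultimately have "smooth_on (T1 \<union> T2) (vee_coeff E c' \<rho>' m ?s)" by (rule smooth_on_Un[OF T1 T2])
  moreover have "T1 \<union> T2 = snd c' ` fst c'" using K(2) by (auto simp: T1_def T2_def)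
  ultimately show "smooth_on (snd c' ` fst c') (vee_coeff E c' \<rho>' m ?s)" by simp
qed

lemma sum_local_sections:
  fixes E :: "('m::{t2_space,second_countable_topology}, 'n::finite,
    'e::{t2_space,second_countable_topology}, 'r::finite) vbundle"
  assumes E: "smooth_vector_bundle E" and c: "total_triv_triple E c \<rho>" and \<eta>: "\<eta> \<in> test_sections E"
    and K: "K \<subseteq> fst c" "\<And>x. x \<notin> K \<Longrightarrow> \<eta> x = (\<lambda>a d. 0)"
  shows "(\<lambda>x a d. \<Sum>l\<in>UNIV. local_section E c \<rho> l (extended_coeff E c \<rho> l \<eta>) x a d) = \<eta>"
proof (rule ext, rule ext, rule ext)
  fix x a d
  show "(\<Sum>l\<in>UNIV. local_section E c \<rho> l (extended_coeff E c \<rho> l \<eta>) x a d) = \<eta> x a d"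
  proof (cases "x \<in> fst c \<and> a \<in> fibre E x")
    case True
    then have x: "x \<in> fst c" and a: "a \<in> fibre E x" by auto
    note iso = total_triv_fibre_iso[OF c x]
    have "\<eta> x a d = \<eta> x (inv_into (fibre E x) \<rho> (\<rho> a)) d"
      using fibre_inv_left[OF iso a] by simp
    also have "\<dots> = (\<Sum>l\<in>UNIV. \<rho> a $ l * \<eta> x (inv_into (fibre E x) \<rho> (axis l 1)) d)"
      by (rule linear_cart_expansion[OF vee_fibre_linear[OF E test_sections_vee_fibre[OF \<eta>] iso]])
    finally show ?thesis by (simp add: local_section_extended_coeff[OF c \<eta> x a])
  next
    case False
    have "\<eta> x a d = 0"
    proof (cases "x \<in> fst c")
      case True
      then show ?thesis using False test_sections_vee_fibre[OF \<eta>, of x] by (simp add: vee_fibre_def)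
    next
      case False
      then show ?thesis using K by (metis subsetD)
    qed
    then show ?thesis using False by (auto simp: local_section_def)
  qed
qed

section \<open>Distributions on the manifold\<close>

lemma distributions_linear:
  assumes "u \<in> distributions E"
  shows distributions_outside: "\<eta> \<notin> test_sections E \<Longrightarrow> u \<eta> = 0"
    and distributions_add: "\<eta> \<in> test_sections E \<Longrightarrow> \<zeta> \<in> test_sections E \<Longrightarrow> u (\<lambda>x a d. \<eta> x a d + \<zeta> x a d) = u \<eta> + u \<zeta>"
    and distributions_cmult: "\<eta> \<in> test_sections E \<Longrightarrow> u (\<lambda>x a d. t * \<eta> x a d) = t * u \<eta>"
  using assms unfolding distributions_def mem_Collect_eq by blast+

lemma distributions_sum:
  fixes E :: "('m::topological_space, 'n::finite, 'e::topological_space, 'r::finite) vbundle"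
  assumes M: "compact (UNIV :: 'm set)" and u: "u \<in> distributions E" and "\<And>i. i \<in> I \<Longrightarrow> s i \<in> test_sections E"
  shows "u (\<lambda>x a d. \<Sum>i\<in>I. s i x a d) = (\<Sum>i\<in>I. u (s i))"
proof -
  have 0: "u (\<lambda>x a d. 0) = 0" using distributions_cmult[OF u test_sections_zero[OF M], of 0] by simp
  show ?thesis
    using assms(3)
  proof (induction I rule: infinite_finite_induct)
    case (insert i I)
    have "u (\<lambda>x a d. s i x a d + (\<Sum>i\<in>I. s i x a d)) = u (s i) + u (\<lambda>x a d. \<Sum>i\<in>I. s i x a d)"
      using insert.prems by (intro distributions_add[OF u] test_sections_sum[OF M]) auto
    then show ?case using insert by simp
  qed (simp_all add: 0)
qed

lemma mult_distribution_decomposition: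
  fixes E :: "('m::{t2_space,second_countable_topology}, 'n::finite,
    'e::{t2_space,second_countable_topology}, 'r::finite) vbundle"
  assumes M: "compact (UNIV :: 'm set)" and E: "smooth_vector_bundle E" and u: "u \<in> distributions E"
    and \<psi>: "smooth_fun (base_atlas E) \<psi>" and c: "total_triv_triple E c \<rho>" and \<eta>: "\<eta> \<in> test_sections E"
    and K: "compact K" "K \<subseteq> fst c" "\<And>x. x \<notin> K \<Longrightarrow> \<eta> x = (\<lambda>a d. 0)"
  shows "u (\<lambda>x a d. \<psi> x * \<eta> x a d) = (\<Sum>l\<in>UNIV. local_rep E c \<rho> (mult_distribution E \<psi> u) l (extended_coeff E c \<rho> l \<eta>))"
proof -
  let ?s = "\<lambda>l. local_section E c \<rho> l (extended_coeff E c \<rho> l \<eta>)"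
  have s: "?s l \<in> test_sections E" for l by (rule local_section_test_section[OF M E c \<eta> K])
  have "(\<lambda>x a d. \<psi> x * \<eta> x a d) = (\<lambda>x a d. \<psi> x * (\<Sum>l\<in>UNIV. ?s l x a d))"
    using sum_local_sections[OF E c \<eta> K(2,3)] by (simp add: fun_eq_iff)
  also have "\<dots> = (\<lambda>x a d. \<Sum>l\<in>UNIV. \<psi> x * ?s l x a d)" by (simp only: sum_distrib_left)
  finally have "u (\<lambda>x a d. \<psi> x * \<eta> x a d) = u (\<lambda>x a d. \<Sum>l\<in>UNIV. \<psi> x * ?s l x a d)" by (simp only:)
  also have "\<dots> = (\<Sum>l\<in>UNIV. u (\<lambda>x a d. \<psi> x * ?s l x a d))"
    by (rule distributions_sum[OF M u]) (rule test_sections_mult[OF M \<psi> s])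
  also have "\<dots> = (\<Sum>l\<in>UNIV. local_rep E c \<rho> (mult_distribution E \<psi> u) l (extended_coeff E c \<rho> l \<eta>))"
    using s by (simp add: local_rep_def mult_distribution_def)
  finally show ?thesis .
qed

lemma openin_test_topology: "openin (test_topology E) W \<longleftrightarrow> test_open E W"
  unfolding test_topology_def using istopology_test_open by (metis topology_inverse')

lemma topspace_test_topology:
  fixes E :: "('m::topological_space, 'n::finite, 'e::topological_space, 'r::finite) vbundle"
  assumes M: "compact (UNIV :: 'm set)"
  shows "topspace (test_topology E) = test_sections E"
proof (rule antisym)
  show "topspace (test_topology E) \<subseteq> test_sections E"
    using openin_topspace[of "test_topology E"] unfolding openin_test_topology test_open_def by blast
  have "test_open E (test_sections E)"
    unfolding test_open_def
  proof (intro conjI ballI exI[of _ "test_sections E"])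
    show "absolutely_convex (test_sections E)"
      unfolding absolutely_convex_def by (auto intro: test_sections_add[OF M] test_sections_cmult[OF M])
    show "\<forall>K. compact K \<longrightarrow> zero_nbhd E K (test_sections E)"
      unfolding zero_nbhd_def by (intro allI impI exI[of _ "{}"] exI[of _ 0] exI[of _ 1]) auto
  qed (auto intro: test_sections_add[OF M])
  then show "test_sections E \<subseteq> topspace (test_topology E)"
    by (intro openin_subset) (simp add: openin_test_topology)
qed

text \<open>A linear functional is continuous if it is bounded by finitely many of the seminorms that define
  the topology.\<close>

lemma distributionsI:
  fixes E :: "('m::topological_space, 'n::finite, 'e::topological_space, 'r::finite) vbundle"
  assumes M: "compact (UNIV :: 'm set)"
    and out: "\<And>\<eta>. \<eta> \<notin> test_sections E \<Longrightarrow> u \<eta> = 0"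
    and add: "\<And>\<eta> \<zeta>. \<eta> \<in> test_sections E \<Longrightarrow> \<zeta> \<in> test_sections E \<Longrightarrow> u (\<lambda>x a d. \<eta> x a d + \<zeta> x a d) = u \<eta> + u \<zeta>"
    and cmult: "\<And>t \<eta>. \<eta> \<in> test_sections E \<Longrightarrow> u (\<lambda>x a d. t * \<eta> x a d) = t * u \<eta>"
    and T: "finite T" "\<And>c \<rho> L. (c, \<rho>, L) \<in> T \<Longrightarrow> total_triv_triple E c \<rho> \<and> compact L \<and> L \<subseteq> fst c"
    and bound: "\<And>\<eta> B. \<eta> \<in> test_sections E \<Longrightarrow> 0 < B \<Longrightarrow> \<eta> \<in> seminorm_ball E T m B \<Longrightarrow> \<bar>u \<eta>\<bar> \<le> C * B"
  shows "u \<in> distributions E"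
proof -
  have "continuous_map (test_topology E) euclideanreal u"
    unfolding continuous_map_def
  proof (intro conjI allI impI)
    fix U :: "real set" assume "openin euclideanreal U"
    then have U: "open U" by simp
    show "openin (test_topology E) {\<eta> \<in> topspace (test_topology E). u \<eta> \<in> U}"
      unfolding openin_test_topology topspace_test_topology[OF M] test_open_def
    proof (intro conjI ballI)
      fix \<eta> assume \<eta>: "\<eta> \<in> {\<eta> \<in> test_sections E. u \<eta> \<in> U}"
      then obtain \<epsilon> where \<epsilon>: "\<epsilon> > 0" "ball (u \<eta>) \<epsilon> \<subseteq> U" using U open_contains_ball by blast
      define V where "V = {\<zeta> \<in> test_sections E. \<bar>u \<zeta>\<bar> < \<epsilon>}"
      show "\<exists>V\<subseteq>test_sections E. absolutely_convex V \<and> (\<forall>K. compact K \<longrightarrow> zero_nbhd E K V) \<and>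
          (\<forall>\<zeta>\<in>V. (\<lambda>x a d. \<eta> x a d + \<zeta> x a d) \<in> {\<eta> \<in> test_sections E. u \<eta> \<in> U})"
      proof (intro exI[of _ V] conjI allI impI ballI)
        show "V \<subseteq> test_sections E" by (auto simp: V_def)
        show "absolutely_convex V"
          unfolding absolutely_convex_def
        proof (intro ballI allI impI)
          fix \<zeta> \<zeta>' s t assume z: "\<zeta> \<in> V" "\<zeta>' \<in> V" and st: "\<bar>s\<bar> + \<bar>t\<bar> \<le> (1::real)"
          let ?m = "max \<bar>u \<zeta>\<bar> \<bar>u \<zeta>'\<bar>"
          have "u (\<lambda>x a d. s * \<zeta> x a d + t * \<zeta>' x a d) = s * u \<zeta> + t * u \<zeta>'"
            using z by (simp add: V_def add cmult test_sections_cmult[OF M])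
          also have "\<bar>\<dots>\<bar> \<le> \<bar>s\<bar> * ?m + \<bar>t\<bar> * ?m"
            by (intro order_trans[OF abs_triangle_ineq] add_mono) (simp_all add: abs_mult mult_left_mono)
          also have "\<dots> \<le> 1 * ?m" unfolding distrib_right[symmetric] by (rule mult_right_mono[OF st]) simp
          also have "1 * ?m < \<epsilon>" using z by (simp add: V_def)
          finally show "(\<lambda>x a d. s * \<zeta> x a d + t * \<zeta>' x a d) \<in> V"
            using z by (simp add: V_def test_sections_add[OF M] test_sections_cmult[OF M])
        qed
        fix K :: "'m set"
        show "zero_nbhd E K V"
          unfolding zero_nbhd_def
        proof (intro exI[of _ T] exI[of _ m] exI[of _ "\<epsilon> / (\<bar>C\<bar> + 1)"] conjI T(1))
          have B: "0 < \<epsilon> / (\<bar>C\<bar> + 1)" using \<epsilon>(1) by (simp add: add_nonneg_pos)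
          then show "0 < \<epsilon> / (\<bar>C\<bar> + 1)" .
          show "\<forall>c \<rho> L. (c, \<rho>, L) \<in> T \<longrightarrow> total_triv_triple E c \<rho> \<and> compact L \<and> L \<subseteq> fst c"
            using T(2) by blast
          show "{\<eta> \<in> test_sections E. section_support \<eta> \<subseteq> K} \<inter> seminorm_ball E T m (\<epsilon> / (\<bar>C\<bar> + 1)) \<subseteq> V"
          proof
            fix \<zeta> assume z: "\<zeta> \<in> {\<eta> \<in> test_sections E. section_support \<eta> \<subseteq> K} \<inter> seminorm_ball E T m (\<epsilon> / (\<bar>C\<bar> + 1))"
            then have "\<bar>u \<zeta>\<bar> \<le> C * (\<epsilon> / (\<bar>C\<bar> + 1))" using bound[OF _ B] by blast
            also have "\<dots> < (\<bar>C\<bar> + 1) * (\<epsilon> / (\<bar>C\<bar> + 1))" by (intro mult_strict_right_mono B) auto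
            also have "\<dots> = \<epsilon>" by (simp add: add_nonneg_pos less_imp_neq[symmetric])
            finally show "\<zeta> \<in> V" using z by (simp add: V_def)
          qed
        qed
      next
        fix \<zeta> assume z: "\<zeta> \<in> V"
        then have "u (\<lambda>x a d. \<eta> x a d + \<zeta> x a d) \<in> ball (u \<eta>) \<epsilon>"
          using \<eta> by (simp add: V_def add dist_real_def)
        then show "(\<lambda>x a d. \<eta> x a d + \<zeta> x a d) \<in> {\<eta> \<in> test_sections E. u \<eta> \<in> U}"
          using z \<eta> \<epsilon>(2) by (auto simp: V_def test_sections_add[OF M])
      qed
    qed auto
  qed auto
  then show ?thesis using out add cmult by (simp add: distributions_def)
qed

section \<open>The Sobolev space of a compact manifold\<close>

lemma seminorm_ballD:
  assumes "\<eta> \<in> seminorm_ball E T m B" "(c, \<rho>, L) \<in> T" "mi_order \<nu> \<le> m" "y \<in> snd c ` L"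
  shows "\<bar>partials \<nu> (vee_coeff E c \<rho> l \<eta>) y\<bar> < B"
  using assms unfolding seminorm_ball_def mem_Collect_eq by blast

locale compact_bundle_atlas =
  fixes E :: "('m::{t2_space,second_countable_topology}, 'n::finite,
               'e::{t2_space,second_countable_topology}, 'r::finite) vbundle"
    and \<Lambda> :: "nat \<Rightarrow> ('m, 'n, 'e, 'r) aug_triple" and N :: nat and e q :: real
  assumes M: "compact (UNIV :: 'm set)" and E: "smooth_vector_bundle E"
    and q: "1 < q" and atlas: "augmented_atlas E N \<Lambda>"
begin

abbreviation "coord_dom \<alpha> \<equiv> snd (chart (\<Lambda> \<alpha>)) ` fst (chart (\<Lambda> \<alpha>))"
abbreviation "supp \<alpha> \<equiv> closure {x. cutoff (\<Lambda> \<alpha>) x \<noteq> 0}"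
abbreviation "rep \<alpha> l u \<equiv> local_rep E (chart (\<Lambda> \<alpha>)) (triv (\<Lambda> \<alpha>)) (mult_distribution E (cutoff (\<Lambda> \<alpha>)) u) l"
abbreviation "norm_rep \<alpha> v \<equiv> dist_sobolev_norm e q (coord_dom \<alpha>) v"

text \<open>The functions \<open>\<omega>\<^sub>\<alpha> = \<psi>\<^sub>\<alpha> / (\<Sum>\<^sub>\<beta> \<psi>\<^sub>\<beta>\<^sup>2)\<close> satisfy \<open>\<Sum>\<^sub>\<alpha> \<psi>\<^sub>\<alpha> \<omega>\<^sub>\<alpha> = 1\<close> and
  are supported where \<open>\<psi>\<^sub>\<alpha>\<close> is. Writing \<open>\<eta> = \<Sum>\<^sub>\<alpha> \<psi>\<^sub>\<alpha> (\<omega>\<^sub>\<alpha> \<eta>)\<close> leaves in every summand one factor \<open>\<psi>\<^sub>\<alpha>\<close> for the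
  distribution and a section of compact support in the chart domain.\<close>

definition weight :: "nat \<Rightarrow> 'm \<Rightarrow> real" where
  "weight \<alpha> x = cutoff (\<Lambda> \<alpha>) x * inverse (\<Sum>\<beta>\<in>{1..N}. cutoff (\<Lambda> \<beta>) x * cutoff (\<Lambda> \<beta>) x)"

definition piece :: "nat \<Rightarrow> ('m, 'n, 'e) vee_section \<Rightarrow> ('m, 'n, 'e) vee_section" where
  "piece \<alpha> \<eta> = (\<lambda>x a d. weight \<alpha> x * \<eta> x a d)"

definition coef :: "nat \<Rightarrow> 'r \<Rightarrow> ('m, 'n, 'e) vee_section \<Rightarrow> real^'n \<Rightarrow> real" where
  "coef \<alpha> l \<eta> = extended_coeff E (chart (\<Lambda> \<alpha>)) (triv (\<Lambda> \<alpha>)) l (piece \<alpha> \<eta>)"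

lemma triple: "\<alpha> \<in> {1..N} \<Longrightarrow> total_triv_triple E (chart (\<Lambda> \<alpha>)) (triv (\<Lambda> \<alpha>))"
  using atlas by (simp add: augmented_atlas_def)

lemma open_dom: "\<alpha> \<in> {1..N} \<Longrightarrow> open (coord_dom \<alpha>)"
  by (rule chart_open(2)[OF total_triv_is_chart[OF triple]])

lemma supp: "compact (supp \<alpha>)" "\<alpha> \<in> {1..N} \<Longrightarrow> supp \<alpha> \<subseteq> fst (chart (\<Lambda> \<alpha>))"
  using compact_Int_closed[OF M closed_closure] atlas by (simp_all add: augmented_atlas_def)

lemma supp_image: "\<alpha> \<in> {1..N} \<Longrightarrow> compact (snd (chart (\<Lambda> \<alpha>)) ` supp \<alpha>)"
    "\<alpha> \<in> {1..N} \<Longrightarrow> snd (chart (\<Lambda> \<alpha>)) ` supp \<alpha> \<subseteq> coord_dom \<alpha>"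
  using supp by (auto intro!: chart_compact_image total_triv_is_chart[OF triple])

lemma cutoff_smooth: "\<alpha> \<in> {1..N} \<Longrightarrow> smooth_fun (base_atlas E) (cutoff (\<Lambda> \<alpha>))"
  using E atlas by (intro smooth_map_on_imp_smooth_fun) (auto simp: smooth_vector_bundle_def augmented_atlas_def)

lemma sum_squares_nonzero: "(\<Sum>\<beta>\<in>{1..N}. cutoff (\<Lambda> \<beta>) x * cutoff (\<Lambda> \<beta>) x) \<noteq> 0"
proof
  assume "(\<Sum>\<beta>\<in>{1..N}. cutoff (\<Lambda> \<beta>) x * cutoff (\<Lambda> \<beta>) x) = 0"
  then have "\<forall>\<beta>\<in>{1..N}. cutoff (\<Lambda> \<beta>) x * cutoff (\<Lambda> \<beta>) x = 0"
    by (subst (asm) sum_nonneg_eq_0_iff) auto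
  then have "(\<Sum>\<beta>\<in>{1..N}. cutoff (\<Lambda> \<beta>) x) = 0" by (intro sum.neutral) auto
  then show False using atlas by (simp add: augmented_atlas_def)
qed

lemma weight_smooth: "\<alpha> \<in> {1..N} \<Longrightarrow> smooth_fun (base_atlas E) (weight \<alpha>)"
  unfolding weight_def[abs_def]
  by (intro smooth_fun_mult smooth_fun_inverse smooth_fun_sum cutoff_smooth sum_squares_nonzero)

lemma weight_partition: "(\<Sum>\<alpha>\<in>{1..N}. cutoff (\<Lambda> \<alpha>) x * weight \<alpha> x) = 1"
  using sum_squares_nonzero[of x] by (simp add: weight_def mult.assoc[symmetric] sum_distrib_right[symmetric])

lemma weight_vanish: "x \<notin> supp \<alpha> \<Longrightarrow> weight \<alpha> x = 0"
  using closure_subset[of "{x. cutoff (\<Lambda> \<alpha>) x \<noteq> 0}"] by (auto simp: weight_def)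

lemma piece_test: "\<alpha> \<in> {1..N} \<Longrightarrow> \<eta> \<in> test_sections E \<Longrightarrow> piece \<alpha> \<eta> \<in> test_sections E"
  unfolding piece_def by (intro test_sections_mult[OF M] weight_smooth)

lemma piece_vanish: "x \<notin> supp \<alpha> \<Longrightarrow> piece \<alpha> \<eta> x = (\<lambda>a d. 0)"
  by (simp add: piece_def weight_vanish)

lemma coef_test:
  "\<alpha> \<in> {1..N} \<Longrightarrow> \<eta> \<in> test_sections E \<Longrightarrow> coef \<alpha> l \<eta> \<in> test_fun (coord_dom \<alpha>)"
  unfolding coef_def
  by (rule extended_coeff_test_fun[OF triple piece_test supp piece_vanish])

lemma coef_vanish:
  "\<alpha> \<in> {1..N} \<Longrightarrow> y \<notin> snd (chart (\<Lambda> \<alpha>)) ` supp \<alpha> \<Longrightarrow> coef \<alpha> l \<eta> y = 0"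
  unfolding coef_def
  by (rule extended_coeff_vanish[OF total_triv_is_chart[OF triple] supp(2) piece_vanish])

text \<open>A distribution is recovered from its local representations.\<close>

lemma reconstruct:
  assumes u: "u \<in> distributions E" and \<eta>: "\<eta> \<in> test_sections E"
  shows "u \<eta> = (\<Sum>\<alpha>\<in>{1..N}. \<Sum>l\<in>UNIV. rep \<alpha> l u (coef \<alpha> l \<eta>))"
proof -
  have "(\<Sum>\<alpha>\<in>{1..N}. cutoff (\<Lambda> \<alpha>) x * piece \<alpha> \<eta> x a d) = \<eta> x a d" for x a d
    unfolding piece_def mult.assoc[symmetric] sum_distrib_right[symmetric] weight_partition by simp
  then have "u \<eta> = u (\<lambda>x a d. \<Sum>\<alpha>\<in>{1..N}. cutoff (\<Lambda> \<alpha>) x * piece \<alpha> \<eta> x a d)" by simp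
  also have "\<dots> = (\<Sum>\<alpha>\<in>{1..N}. u (\<lambda>x a d. cutoff (\<Lambda> \<alpha>) x * piece \<alpha> \<eta> x a d))"
    by (rule distributions_sum[OF M u]) (rule test_sections_mult[OF M cutoff_smooth piece_test[OF _ \<eta>]])
  also have "\<dots> = (\<Sum>\<alpha>\<in>{1..N}. \<Sum>l\<in>UNIV. rep \<alpha> l u (coef \<alpha> l \<eta>))"
    unfolding coef_def
    by (intro sum.cong refl mult_distribution_decomposition[OF M E u cutoff_smooth triple piece_test[OF _ \<eta>] supp piece_vanish])
  finally show ?thesis .
qed

text \<open>The functions \<open>coef\<close> arise from the coefficients of \<open>\<eta>\<close> by multiplication with the smooth weight in
coordinates, so the Leibniz rule bounds their derivatives by the seminorms of \<open>\<eta>\<close>.\<close>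

lemma rep_bound:
  assumes \<alpha>: "\<alpha> \<in> {1..N}" and v: "norm_rep \<alpha> v < top"
  shows "\<exists>C\<ge>0. \<exists>m. \<forall>\<eta> B. \<eta> \<in> test_sections E \<longrightarrow> 0 < B \<longrightarrow>
    \<eta> \<in> seminorm_ball E {(chart (\<Lambda> \<alpha>), triv (\<Lambda> \<alpha>), supp \<alpha>)} m B \<longrightarrow> \<bar>v (coef \<alpha> l \<eta>)\<bar> \<le> C * B"
proof -
  let ?c = "chart (\<Lambda> \<alpha>)" and ?K = "snd (chart (\<Lambda> \<alpha>)) ` supp \<alpha>"
  obtain C1 m where C1: "C1 \<ge> 0" "\<And>v \<xi> B. norm_rep \<alpha> v < top \<Longrightarrow> \<xi> \<in> test_fun (coord_dom \<alpha>) \<Longrightarrow>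
      \<forall>x. x \<notin> ?K \<longrightarrow> \<xi> x = 0 \<Longrightarrow> 0 \<le> B \<Longrightarrow> \<forall>\<nu> y. mi_order \<nu> \<le> m \<longrightarrow> y \<in> ?K \<longrightarrow> \<bar>partials \<nu> \<xi> y\<bar> \<le> B \<Longrightarrow>
      ennreal \<bar>v \<xi>\<bar> \<le> ennreal (C1 * B) * norm_rep \<alpha> v"
    using dist_sobolev_norm_bound[OF open_dom[OF \<alpha>] q supp_image[OF \<alpha>], of e] by blast
  let ?h = "\<lambda>y. weight \<alpha> (inv_into (fst ?c) (snd ?c) y)"
  have h: "smooth_on (coord_dom \<alpha>) ?h"
    using weight_smooth[OF \<alpha>] triple[OF \<alpha>] unfolding smooth_fun_def total_triv_triple_def by blast
  show ?thesis
  proof (rule Leibniz_bound[OF open_dom[OF \<alpha>] supp_image[OF \<alpha>] h, of m])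
    fix C2 assume C2: "C2 \<ge> 0" "\<And>g B \<nu> y. \<lbrakk>smooth_on (coord_dom \<alpha>) g; 0 \<le> B;
        \<And>\<nu> y. mi_order \<nu> \<le> m \<Longrightarrow> y \<in> ?K \<Longrightarrow> \<bar>partials \<nu> g y\<bar> \<le> B; mi_order \<nu> \<le> m; y \<in> ?K\<rbrakk>
      \<Longrightarrow> \<bar>partials \<nu> (\<lambda>y. ?h y * g y) y\<bar> \<le> C2 * B"
    have fin: "norm_rep \<alpha> v = ennreal (enn2real (norm_rep \<alpha> v))" using v by (simp add: less_top)
    show ?thesis
    proof (intro exI[of _ "C1 * C2 * enn2real (norm_rep \<alpha> v)"] exI[of _ m] conjI allI impI)
      show "0 \<le> C1 * C2 * enn2real (norm_rep \<alpha> v)" using C1(1) C2(1) by simp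
      fix \<eta> :: "('m, 'n, 'e) vee_section" and B :: real
      assume \<eta>: "\<eta> \<in> test_sections E" and B: "0 < B" and ball: "\<eta> \<in> seminorm_ball E {(?c, triv (\<Lambda> \<alpha>), supp \<alpha>)} m B"
      let ?g = "vee_coeff E ?c (triv (\<Lambda> \<alpha>)) l \<eta>"
      have g: "smooth_on (coord_dom \<alpha>) ?g" by (rule test_sections_smooth_coeff[OF \<eta> triple[OF \<alpha>]])
      have gB: "\<bar>partials \<nu> ?g y\<bar> \<le> B" if "mi_order \<nu> \<le> m" "y \<in> ?K" for \<nu> y
        by (rule less_imp_le, rule seminorm_ballD[OF ball _ that]) simp
      have "\<bar>partials \<nu> (coef \<alpha> l \<eta>) y\<bar> \<le> C2 * B" if \<nu>: "mi_order \<nu> \<le> m" and y: "y \<in> ?K" for \<nu> y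
      proof -
        have "y \<in> coord_dom \<alpha>" using y supp_image(2)[OF \<alpha>] by blast
        then have "partials \<nu> (coef \<alpha> l \<eta>) y = partials \<nu> (\<lambda>y. ?h y * ?g y) y"
          unfolding partials_def
          by (intro foldr_partial_deriv_cong_open[OF open_dom[OF \<alpha>]])
            (auto simp: coef_def extended_coeff_def piece_def vee_coeff_def Let_def)
        then show ?thesis using C2(2)[OF g less_imp_le[OF B] gB \<nu> y] by simp
      qed
      then have "ennreal \<bar>v (coef \<alpha> l \<eta>)\<bar> \<le> ennreal (C1 * (C2 * B)) * norm_rep \<alpha> v"
        using C2(1) B coef_vanish[OF \<alpha>] by (intro C1(2)[OF v coef_test[OF \<alpha> \<eta>]]) auto
      also have "\<dots> = ennreal (C1 * C2 * enn2real (norm_rep \<alpha> v) * B)"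
        using C1(1) C2(1) B by (subst fin, subst ennreal_mult[symmetric]) (auto simp: mult_ac)
      finally show "\<bar>v (coef \<alpha> l \<eta>)\<bar> \<le> C1 * C2 * enn2real (norm_rep \<alpha> v) * B"
        using C1(1) C2(1) B by (subst (asm) ennreal_le_iff) auto
    qed
  qed
qed

text \<open>Local data of finite norm always glue to a continuous functional.\<close>

lemma glue_distribution:
  assumes W: "\<And>\<alpha> l. \<alpha> \<in> {1..N} \<Longrightarrow> norm_rep \<alpha> (W \<alpha> l) < top"
    and eq: "\<And>\<eta>. \<eta> \<in> test_sections E \<Longrightarrow> u \<eta> = (\<Sum>\<alpha>\<in>{1..N}. \<Sum>l\<in>UNIV. W \<alpha> l (coef \<alpha> l \<eta>))"
    and out: "\<And>\<eta>. \<eta> \<notin> test_sections E \<Longrightarrow> u \<eta> = 0"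
    and add: "\<And>\<eta> \<zeta>. \<eta> \<in> test_sections E \<Longrightarrow> \<zeta> \<in> test_sections E \<Longrightarrow> u (\<lambda>x a d. \<eta> x a d + \<zeta> x a d) = u \<eta> + u \<zeta>"
    and cmult: "\<And>t \<eta>. \<eta> \<in> test_sections E \<Longrightarrow> u (\<lambda>x a d. t * \<eta> x a d) = t * u \<eta>"
  shows "u \<in> distributions E"
proof -
  define T where "T = (\<lambda>\<alpha>. (chart (\<Lambda> \<alpha>), triv (\<Lambda> \<alpha>), supp \<alpha>)) ` {1..N}"
  have "\<forall>\<alpha> l. \<exists>C m. \<alpha> \<in> {1..N} \<longrightarrow> 0 \<le> C \<and> (\<forall>\<eta> B. \<eta> \<in> test_sections E \<longrightarrow> 0 < B \<longrightarrow>
      \<eta> \<in> seminorm_ball E {(chart (\<Lambda> \<alpha>), triv (\<Lambda> \<alpha>), supp \<alpha>)} m B \<longrightarrow> \<bar>W \<alpha> l (coef \<alpha> l \<eta>)\<bar> \<le> C * B)"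
    using rep_bound[OF _ W] by blast
  then obtain C m where C: "\<And>\<alpha> l \<eta> B. \<alpha> \<in> {1..N} \<Longrightarrow> \<eta> \<in> test_sections E \<Longrightarrow> 0 < B \<Longrightarrow>
      \<eta> \<in> seminorm_ball E {(chart (\<Lambda> \<alpha>), triv (\<Lambda> \<alpha>), supp \<alpha>)} (m \<alpha> l) B \<Longrightarrow> \<bar>W \<alpha> l (coef \<alpha> l \<eta>)\<bar> \<le> C \<alpha> l * B"
    by metis
  define k where "k = (\<Sum>\<alpha>\<in>{1..N}. \<Sum>l\<in>UNIV. m \<alpha> l)"
  have mk: "m \<alpha> l \<le> k" if "\<alpha> \<in> {1..N}" for \<alpha> l
  proof -
    have "m \<alpha> l \<le> (\<Sum>l\<in>UNIV. m \<alpha> l)" by (rule member_le_sum) auto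
    also have "\<dots> \<le> k" unfolding k_def using that by (intro member_le_sum[where f="\<lambda>\<alpha>. \<Sum>l\<in>UNIV. m \<alpha> l"]) auto
    finally show ?thesis .
  qed
  show ?thesis
  proof (rule distributionsI[OF M out add cmult])
    show "finite T" by (simp add: T_def)
    show "total_triv_triple E c \<rho> \<and> compact L \<and> L \<subseteq> fst c" if L: "(c, \<rho>, L) \<in> T" for c \<rho> L
    proof -
      obtain \<alpha> where "\<alpha> \<in> {1..N}" "c = chart (\<Lambda> \<alpha>)" "\<rho> = triv (\<Lambda> \<alpha>)" "L = supp \<alpha>"
        using L unfolding T_def by blast
      then show ?thesis using triple[of \<alpha>] supp[of \<alpha>] by simp
    qed
    fix \<eta> B assume \<eta>: "\<eta> \<in> test_sections E" and B: "0 < B" and ball: "\<eta> \<in> seminorm_ball E T k B"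
    have "\<bar>W \<alpha> l (coef \<alpha> l \<eta>)\<bar> \<le> C \<alpha> l * B" if \<alpha>: "\<alpha> \<in> {1..N}" for \<alpha> l
    proof (rule C[OF \<alpha> \<eta> B])
      have inT: "(chart (\<Lambda> \<alpha>), triv (\<Lambda> \<alpha>), supp \<alpha>) \<in> T" unfolding T_def using \<alpha> by (rule imageI)
      show "\<eta> \<in> seminorm_ball E {(chart (\<Lambda> \<alpha>), triv (\<Lambda> \<alpha>), supp \<alpha>)} (m \<alpha> l) B"
        using seminorm_ballD[OF ball inT order_trans[OF _ mk[OF \<alpha>]]]
        unfolding seminorm_ball_def mem_Collect_eq by blast
    qed
    then have "\<bar>u \<eta>\<bar> \<le> (\<Sum>\<alpha>\<in>{1..N}. \<Sum>l\<in>UNIV. C \<alpha> l * B)"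
      unfolding eq[OF \<eta>] by (intro order_trans[OF sum_abs] sum_mono) auto
    then show "\<bar>u \<eta>\<bar> \<le> (\<Sum>\<alpha>\<in>{1..N}. \<Sum>l\<in>UNIV. C \<alpha> l) * B"
      by (simp only: sum_distrib_right)
  qed
qed

lemma rep_cmult: "rep \<alpha> l (\<lambda>\<eta>. t * u \<eta>) = (\<lambda>\<xi>. t * rep \<alpha> l u \<xi>)"
  by (auto simp: local_rep_def mult_distribution_def)

lemma bundle_norm_eq: "bundle_sobolev_norm E N \<Lambda> e q u = (\<Sum>\<alpha>\<in>{1..N}. \<Sum>l\<in>UNIV. norm_rep \<alpha> (rep \<alpha> l u))"
  by (simp add: bundle_sobolev_norm_def)

lemma rep_norm_le: "\<alpha> \<in> {1..N} \<Longrightarrow> norm_rep \<alpha> (rep \<alpha> l u) \<le> bundle_sobolev_norm E N \<Lambda> e q u"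
proof -
  assume \<alpha>: "\<alpha> \<in> {1..N}"
  have "norm_rep \<alpha> (rep \<alpha> l u) \<le> (\<Sum>l\<in>UNIV. norm_rep \<alpha> (rep \<alpha> l u))"
    by (rule member_le_sum[where f="\<lambda>l. norm_rep \<alpha> (rep \<alpha> l u)"]) auto
  also have "\<dots> \<le> bundle_sobolev_norm E N \<Lambda> e q u"
    unfolding bundle_norm_eq using \<alpha>
    by (intro member_le_sum[where f="\<lambda>\<alpha>. \<Sum>l\<in>UNIV. norm_rep \<alpha> (rep \<alpha> l u)"]) auto
  finally show ?thesis .
qed

lemma bundle_norm_definite:
  assumes u: "u \<in> distributions E" and 0: "bundle_sobolev_norm E N \<Lambda> e q u = 0"
  shows "u = (\<lambda>\<eta>. 0)"
proof
  fix \<eta>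
  show "u \<eta> = 0"
  proof (cases "\<eta> \<in> test_sections E")
    case True
    have "rep \<alpha> l u (coef \<alpha> l \<eta>) = 0" if \<alpha>: "\<alpha> \<in> {1..N}" for \<alpha> l
    proof -
      have z: "norm_rep \<alpha> (rep \<alpha> l u) = 0" using rep_norm_le[OF \<alpha>, where l=l and u=u] 0 by simp
      \<comment> \<open>A constant series of norm zero converges absolutely, hence pointwise.\<close>
      have "summable (\<lambda>k::nat. rep \<alpha> l u (coef \<alpha> l \<eta>))"
        by (rule summable_of_dist_sobolev_norm[OF open_dom[OF \<alpha>] q _ coef_test[OF \<alpha> True], of e]) (simp add: z)
      then show ?thesis by (simp add: summable_const_iff)
    qed
    then show ?thesis by (simp add: reconstruct[OF u True])
  qed (rule distributions_outside[OF u])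
qed

text \<open>The local representations of the sum are the sums of the local representations, since both are
pointwise sums; so the local estimates apply to the sum.\<close>

lemma bundle_series:
  assumes w: "\<And>k. w k \<in> distributions E" and fin: "(\<Sum>k. bundle_sobolev_norm E N \<Lambda> e q (w k)) < top"
  shows "(\<forall>\<eta>. summable (\<lambda>k. w k \<eta>)) \<and> (\<lambda>\<eta>. \<Sum>k. w k \<eta>) \<in> distributions E \<and>
    bundle_sobolev_norm E N \<Lambda> e q (\<lambda>\<eta>. \<Sum>k. w k \<eta>) \<le> (\<Sum>k. bundle_sobolev_norm E N \<Lambda> e q (w k))"
proof -
  let ?u = "\<lambda>\<eta>. \<Sum>k. w k \<eta>"
  have fin': "(\<Sum>k. norm_rep \<alpha> (rep \<alpha> l (w k))) < top" if \<alpha>: "\<alpha> \<in> {1..N}" for \<alpha> l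
    by (rule le_less_trans[OF suminf_le fin]) (auto intro: rep_norm_le[OF \<alpha>])
  define W where "W \<alpha> l = (\<lambda>\<xi>. \<Sum>k. rep \<alpha> l (w k) \<xi>)" for \<alpha> l
  have W_le: "norm_rep \<alpha> (W \<alpha> l) \<le> (\<Sum>k. norm_rep \<alpha> (rep \<alpha> l (w k)))" if \<alpha>: "\<alpha> \<in> {1..N}" for \<alpha> l
    unfolding W_def by (rule dist_sobolev_norm_suminf_le[OF open_dom[OF \<alpha>] q fin'[OF \<alpha>]])
  have rep_sums: "(\<lambda>k. rep \<alpha> l (w k) \<xi>) sums W \<alpha> l \<xi>" if \<alpha>: "\<alpha> \<in> {1..N}" and \<xi>: "\<xi> \<in> test_fun (coord_dom \<alpha>)" for \<alpha> l \<xi>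
    unfolding W_def by (rule summable_sums[OF summable_of_dist_sobolev_norm[OF open_dom[OF \<alpha>] q fin'[OF \<alpha>] \<xi>]])
  have sums: "(\<lambda>k. w k \<eta>) sums (\<Sum>\<alpha>\<in>{1..N}. \<Sum>l\<in>UNIV. W \<alpha> l (coef \<alpha> l \<eta>))" if \<eta>: "\<eta> \<in> test_sections E" for \<eta>
    unfolding reconstruct[OF w \<eta>] by (intro sums_sum rep_sums coef_test \<eta>)
  have sm: "summable (\<lambda>k. w k \<eta>)" for \<eta>
  proof (cases "\<eta> \<in> test_sections E")
    case True
    then show ?thesis by (rule sums_summable[OF sums])
  next
    case False
    then show ?thesis by (simp add: distributions_outside[OF w])
  qed
  have rep_u: "rep \<alpha> l ?u = W \<alpha> l" for \<alpha> l
    by (auto simp: local_rep_def mult_distribution_def W_def)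
  have "?u \<in> distributions E"
  proof (rule glue_distribution[of W])
    show "norm_rep \<alpha> (W \<alpha> l) < top" if "\<alpha> \<in> {1..N}" for \<alpha> l
      by (rule le_less_trans[OF W_le[OF that] fin'[OF that]])
    show "?u \<eta> = (\<Sum>\<alpha>\<in>{1..N}. \<Sum>l\<in>UNIV. W \<alpha> l (coef \<alpha> l \<eta>))" if "\<eta> \<in> test_sections E" for \<eta>
      by (rule sums_unique[symmetric, OF sums[OF that]])
    show "?u \<eta> = 0" if "\<eta> \<notin> test_sections E" for \<eta>
      by (simp add: distributions_outside[OF w that])
    show "?u (\<lambda>x a d. \<eta> x a d + \<zeta> x a d) = ?u \<eta> + ?u \<zeta>" if "\<eta> \<in> test_sections E" "\<zeta> \<in> test_sections E" for \<eta> \<zeta>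
      unfolding distributions_add[OF w that] by (rule suminf_add[symmetric, OF sm sm])
    show "?u (\<lambda>x a d. t * \<eta> x a d) = t * ?u \<eta>" if "\<eta> \<in> test_sections E" for t \<eta>
      unfolding distributions_cmult[OF w that] by (rule suminf_mult[OF sm])
  qed
  moreover have "bundle_sobolev_norm E N \<Lambda> e q ?u \<le> (\<Sum>k. bundle_sobolev_norm E N \<Lambda> e q (w k))"
  proof -
    have "bundle_sobolev_norm E N \<Lambda> e q ?u \<le> (\<Sum>\<alpha>\<in>{1..N}. \<Sum>l\<in>UNIV. \<Sum>k. norm_rep \<alpha> (rep \<alpha> l (w k)))"
      unfolding bundle_norm_eq rep_u by (intro sum_mono W_le)
    also have "\<dots> = (\<Sum>k. bundle_sobolev_norm E N \<Lambda> e q (w k))"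
      unfolding bundle_norm_eq by (simp add: suminf_sum[OF summableI])
    finally show ?thesis .
  qed
  ultimately show ?thesis using sm by blast
qed

lemma bundle_sobolev_space_banach: "banach_space_on (bundle_sobolev_space E N \<Lambda> e q) (\<lambda>u. enn2real (bundle_sobolev_norm E N \<Lambda> e q u))"
  unfolding bundle_sobolev_space_def
proof (rule banach_space_on_of_series)
  have zero: "norm_rep \<alpha> (rep \<alpha> l (\<lambda>z. 0)) = 0" if \<alpha>: "\<alpha> \<in> {1..N}" for \<alpha> l
  proof -
    have "rep \<alpha> l (\<lambda>z. 0) = (\<lambda>\<xi>. 0)" by (auto simp: local_rep_def mult_distribution_def)
    then show ?thesis using dist_sobolev_norm_zero[OF open_dom[OF \<alpha>] q] by simp
  qed
  then show "bundle_sobolev_norm E N \<Lambda> e q (\<lambda>z. 0) = 0" by (simp add: bundle_norm_eq)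
  show "(\<lambda>z. 0) \<in> distributions E" by (simp add: distributions_def)
  show "(\<lambda>z. t * u z) \<in> distributions E" if "u \<in> distributions E" for t u
    using that by (auto simp: distributions_def algebra_simps intro!: continuous_map_real_mult)
  show "bundle_sobolev_norm E N \<Lambda> e q (\<lambda>z. t * u z) \<le> ennreal \<bar>t\<bar> * bundle_sobolev_norm E N \<Lambda> e q u"
    if "bundle_sobolev_norm E N \<Lambda> e q u < top" for t u
    unfolding bundle_norm_eq rep_cmult sum_distrib_left
    using le_less_trans[OF rep_norm_le that]
    by (intro sum_mono dist_sobolev_norm_cmult[OF open_dom q])
qed (fact bundle_norm_definite bundle_series)+

end

theorem theorem9p25:
  fixes E :: "('m::{t2_space,second_countable_topology}, 'n::finite,
               'e::{t2_space,second_countable_topology}, 'r::finite) vbundle"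
    and \<Lambda> :: "nat \<Rightarrow> ('m, 'n, 'e, 'r) aug_triple"
    and N :: nat and e q :: real
  assumes "compact (UNIV :: 'm set)"
    and "smooth_vector_bundle E"
    and "1 < q"
    and "augmented_atlas E N \<Lambda>"
    and "e \<notin> \<int> \<and> e < -1 \<Longrightarrow> GL_compatible_with_itself N \<Lambda>"
  shows "banach_space_on (bundle_sobolev_space E N \<Lambda> e q)
           (\<lambda>u. enn2real (bundle_sobolev_norm E N \<Lambda> e q u))"
proof -
  interpret compact_bundle_atlas E \<Lambda> N e q
    using assms(1-4) by unfold_locales
  show ?thesis by (rule bundle_sobolev_space_banach)
qed

end
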